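(* Let $s\ge1$. (i) The Shape Invariant Model is identifiable on $\mathcal F_s\times\mathfrak M([0,1])^\star$: the map $$\mathcal I:\ (f,g)\in\mathcal F_s\times\mathfrak M([0,1])^\star\longmapsto\mathbb P_{f,g}$$ is injective. (ii) Let $\nu>1$ and $A>0$. There exists a sufficiently small constant $c>0$ such that $$\liminf_{n\to+\infty}(\log n)^{2s+2}\ \inf_{\hat f}\ \sup_{(f,g)\in\mathcal F_s\times\mathfrak M_\nu([0,1])(A)}\mathbb E_{f,g}\|\hat f-f\|^2\ge c$$ and $$\liminf_{n\to+\infty}(\log n)^{2\nu+1}\ \inf_{\hat g}\ \sup_{(f,g)\in\mathcal F_s\times\mathfrak M_\nu([0,1])(A)}\mathbb E_{f,g}\|\hat g-g\|^2\ge c,$$ where the infima are over all estimators $\hat f$ with values in $\mathcal F_s$ (respectively $\hat g$ with values in $\mathfrak M_\nu([0,1])(A)$) that are measurable functions of $Y_1,\dots,Y_n$, and $\mathbb E_{f,g}$ is the expectation when $Y_1,\dots,Y_n$ are i.i.d. with law $\mathbb P_{f,g}$.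
   Context: $\mathfrak M([0,1])$ is the set of probability measures on $[0,1]$. For a $1$-periodic $f\in L^2_{\mathbb C}([0,1])$ and $g\in\mathfrak M([0,1])$, $\mathbb P_{f,g}$ is the law of the complex random curve $Y$ on $[0,1]$ given by $dY(x)=f(x-\tau)\,dx+dW(x)$, where $\tau\sim g$ and $W$ is a complex standard Brownian motion independent of $\tau$ ($W_1\sim\mathcal N_{\mathbb C}(0,1)$, i.e. independent real and imaginary parts, each centered real Gaussian with variance $1/2$). Equivalently, the Fourier coefficients of $Y$ are $\theta_\ell(f)e^{-2i\pi\ell\tau}+\xi_\ell$, $\ell\in\mathbb Z$, with $\xi_\ell$ i.i.d. $\mathcal N_{\mathbb C}(0,1)$ independent of $\tau$. $\theta_\ell(h)=\int_0^1e^{-2i\pi\ell t}h(t)\,dt$, and $\theta_\ell(g)=\int e^{-2i\pi\ell t}dg(t)$ for measures. As usual on the circle, the shift is taken modulo $1$ (the points $0$ and $1$ of $[0,1]$ are identified). $\|\cdot\|$ is the $L^2([0,1])$ norm (for $g$, the norm of densities). $\mathcal F_s=\{f\in L^2_{\mathbb C}([0,1]):\theta_1(f)\text{ is real},\ \theta_1(f)>0,\ \sum_\ell(1+|\ell|^{2s})|\theta_\ell(f)|^2<\infty\}$. $\mathfrak M([0,1])^\star=\{g\in\mathfrak M([0,1]):\theta_k(g)\ne0\ \forall k\in\mathbb Z\}$. $\mathfrak M_\nu([0,1])(A)=\{g\in\mathfrak M([0,1]):\sum_{k\in\mathbb Z}|k|^{2\nu}|\theta_k(g)|^2<A^2\}$.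 *)

theory Defs
  imports "HOL-Probability.Probability"
begin

section \<open>Functions and probability measures on the circle\<close>

text \<open>
  The points 0 and 1 of the unit interval are identified, so the circle is represented by its
  fundamental domain [0,1). Functions on the circle are 1-periodic Borel functions on the
  reals; elements of \<open>L\<^sup>2\<close> are represented by such functions, and equality in \<open>L\<^sup>2\<close> is
  equality almost everywhere.
\<close>

definition circle :: "real measure" where
  "circle = restrict_space lborel {0..<1}"

definition circle_L2 :: "(real \<Rightarrow> complex) set" where
  "circle_L2 = {f. f \<in> borel_measurable borel \<and> (\<forall>x. f (x + 1) = f x) \<and>
                   integrable circle (\<lambda>t. (norm (f t))\<^sup>2)}"

definition circle_probs :: "real measure set" where
  "circle_probs = {g. prob_space g \<and> sets g = sets circle}"

text \<open>Fourier coefficients \<open>\<theta>\<^sub>l\<close> of a function and of a measure; \<open>cis x\<close> is \<open>exp (\<i> x)\<close>.\<close>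

definition fourier_coeff :: "int \<Rightarrow> (real \<Rightarrow> complex) \<Rightarrow> complex" where
  "fourier_coeff l h = (LINT t|circle. cis (- 2 * pi * real_of_int l * t) * h t)"

definition fourier_coeff_measure :: "int \<Rightarrow> real measure \<Rightarrow> complex" where
  "fourier_coeff_measure l g = (LINT t|g. cis (- 2 * pi * real_of_int l * t))"

definition shape_class :: "real \<Rightarrow> (real \<Rightarrow> complex) set" where
  "shape_class s = {f \<in> circle_L2.
      fourier_coeff 1 f \<in> \<real> \<and> Re (fourier_coeff 1 f) > 0 \<and>
      (\<lambda>l::int. (1 + real_of_int \<bar>l\<bar> powr (2 * s)) * (norm (fourier_coeff l f))\<^sup>2) summable_on UNIV}"

definition probs_star :: "real measure set" where
  "probs_star = {g \<in> circle_probs. \<forall>k. fourier_coeff_measure k g \<noteq> 0}"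

definition probs_smooth :: "real \<Rightarrow> real \<Rightarrow> real measure set" where
  "probs_smooth \<nu> A = {g \<in> circle_probs.
      (\<lambda>k::int. real_of_int \<bar>k\<bar> powr (2 * \<nu>) * (norm (fourier_coeff_measure k g))\<^sup>2) summable_on UNIV \<and>
      (\<Sum>\<^sub>\<infinity>k::int. real_of_int \<bar>k\<bar> powr (2 * \<nu>) * (norm (fourier_coeff_measure k g))\<^sup>2) < A\<^sup>2}"


section \<open>The law of complex Brownian motion on [0,1]\<close>

text \<open>Paths on [0,1] carry the cylinder sigma-algebra, generated by the evaluations.\<close>

abbreviation path_space :: "(real \<Rightarrow> complex) measure" where
  "path_space \<equiv> PiM {0..1} (\<lambda>_. borel)"

text \<open>Centred real Gaussian law of variance \<open>v\<close>, including the Dirac measure for \<open>v = 0\<close>, and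
  the law \<open>N\<^sub>\<complex>(0,v)\<close>, whose real and imaginary parts are independent with variance \<open>v/2\<close>.\<close>

definition real_gauss :: "real \<Rightarrow> real measure" where
  "real_gauss v = distr std_normal_distribution borel (\<lambda>x. sqrt v * x)"

definition complex_gauss :: "real \<Rightarrow> complex measure" where
  "complex_gauss v =
     distr (real_gauss (v / 2) \<Otimes>\<^sub>M real_gauss (v / 2)) borel (\<lambda>(a, b). Complex a b)"

text \<open>The largest time of \<open>J\<close> before \<open>t\<close>, or the starting time 0 if there is none.\<close>

definition prev_time :: "real set \<Rightarrow> real \<Rightarrow> real" where
  "prev_time J t = Max (insert 0 {u \<in> J. u < t})"

text \<open>
  The law of \<open>(W\<^sub>t)\<^sub>t\<^sub>\<in>\<^sub>J\<close> for a finite set \<open>J\<close> of times: \<open>W\<^sub>t\<close> is the sum of the increments over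
  the times up to \<open>t\<close> in \<open>J\<close>, which are independent, each \<open>N\<^sub>\<complex>(0, \<cdot>)\<close> with variance the length
  of the time step.
\<close>

definition brownian_fdd :: "real set \<Rightarrow> (real \<Rightarrow> complex) measure" where
  "brownian_fdd J =
     distr (PiM J (\<lambda>t. complex_gauss (t - prev_time J t))) (PiM J (\<lambda>_. borel))
       (\<lambda>z. \<lambda>t\<in>J. \<Sum>u\<in>{u \<in> J. u \<le> t}. z u)"

text \<open>
  The law of \<open>W\<close> is the unique measure on the cylinder sigma-algebra with these marginals.
  The Borel sigma-algebra of C([0,1]) is the trace of the cylinder sigma-algebra, so the choice of
  a continuous version of \<open>W\<close> affects neither equality of laws nor the risks below.
\<close>

definition brownian_law :: "(real \<Rightarrow> complex) measure" where
  "brownian_law = projective_family.lim {0..1} brownian_fdd (\<lambda>_. borel)"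

lemma prob_space_real_gauss: "prob_space (real_gauss v)"
  and sets_real_gauss [simp, measurable_cong]: "sets (real_gauss v) = sets borel"
proof -
  interpret prob_space std_normal_distribution
    by (rule prob_space_normal_density) simp
  show "prob_space (real_gauss v)"
    unfolding real_gauss_def by (rule prob_space_distr) simp
  show "sets (real_gauss v) = sets borel" by (simp add: real_gauss_def)
qed

lemma char_real_gauss:
  assumes "v \<ge> 0" shows "char (real_gauss v) = (\<lambda>t. complex_of_real (exp (- (v * t\<^sup>2) / 2)))"
proof
  fix t
  have "char (real_gauss v) t = char std_normal_distribution (t * sqrt v)"
    unfolding char_def real_gauss_def
    by (subst integral_distr) (auto simp: mult_ac)
  also have "\<dots> = complex_of_real (exp (- (v * t\<^sup>2) / 2))"
    using assms by (simp add: char_std_normal_distribution power_mult_distrib mult_ac)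
  finally show "char (real_gauss v) t = complex_of_real (exp (- (v * t\<^sup>2) / 2))" .
qed

lemma real_gauss_add:
  assumes "a \<ge> 0" "b \<ge> 0"
  shows "distr (real_gauss a \<Otimes>\<^sub>M real_gauss b) borel (\<lambda>(x, y). x + y) = real_gauss (a + b)"
proof -
  interpret A: prob_space "real_gauss a" by (rule prob_space_real_gauss)
  interpret B: prob_space "real_gauss b" by (rule prob_space_real_gauss)
  interpret AB: pair_prob_space "real_gauss a" "real_gauss b" ..
  have 1: "prob_space (distr (real_gauss a \<Otimes>\<^sub>M real_gauss b) borel (\<lambda>(x, y). x + y))"
    by (rule AB.P.prob_space_distr) simp
  have 2: "prob_space (real_gauss (a + b))" by (rule prob_space_real_gauss)
  show ?thesis
  proof (rule Levy_uniqueness)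
    show "real_distribution (distr (real_gauss a \<Otimes>\<^sub>M real_gauss b) borel (\<lambda>(x, y). x + y))"
      using 1 by (auto simp: real_distribution_def real_distribution_axioms_def)
    show "real_distribution (real_gauss (a + b))"
      using 2 by (auto simp: real_distribution_def real_distribution_axioms_def)
    show "char (distr (real_gauss a \<Otimes>\<^sub>M real_gauss b) borel (\<lambda>(x, y). x + y)) = char (real_gauss (a + b))"
    proof
      fix t
      have "char (distr (real_gauss a \<Otimes>\<^sub>M real_gauss b) borel (\<lambda>(x, y). x + y)) t
          = (LINT p|(real_gauss a \<Otimes>\<^sub>M real_gauss b). iexp (t * fst p) * iexp (t * snd p))"
        unfolding char_def
        by (subst integral_distr) (auto simp: case_prod_beta distrib_left exp_add intro!: Bochner_Integration.integral_cong)
      also have "\<dots> = (LINT x|real_gauss a. LINT y|real_gauss b. iexp (t * x) * iexp (t * y))"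
        by (subst AB.integral_fst'[symmetric])
           (auto intro!: AB.P.integrable_const_bound[where B=1] simp: norm_mult)
      also have "\<dots> = char (real_gauss a) t * char (real_gauss b) t"
        by (simp add: char_def)
      also have "\<dots> = char (real_gauss (a + b)) t"
        using assms by (simp add: char_real_gauss exp_add[symmetric] field_simps flip: of_real_mult)
      finally show "char (distr (real_gauss a \<Otimes>\<^sub>M real_gauss b) borel (\<lambda>(x, y). x + y)) t = char (real_gauss (a + b)) t" .
    qed
  qed
qed

lemma measurable_Complex [measurable]:
  "(\<lambda>p. Complex (fst p) (snd p)) \<in> borel_measurable (borel \<Otimes>\<^sub>M borel)"
  unfolding Complex_eq by measurable

lemma prob_space_complex_gauss: "prob_space (complex_gauss v)"
  and sets_complex_gauss [simp, measurable_cong]: "sets (complex_gauss v) = sets borel"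
proof -
  interpret A: prob_space "real_gauss (v/2)" by (rule prob_space_real_gauss)
  interpret AB: pair_prob_space "real_gauss (v/2)" "real_gauss (v/2)" ..
  show "prob_space (complex_gauss v)"
    unfolding complex_gauss_def case_prod_beta by (rule AB.P.prob_space_distr) simp
  show "sets (complex_gauss v) = sets borel" by (simp add: complex_gauss_def)
qed

lemma nn_integral_real_gauss_add:
  assumes "a \<ge> 0" "b \<ge> 0" and [measurable]: "h \<in> borel_measurable borel"
  shows "(\<integral>\<^sup>+x. \<integral>\<^sup>+y. h (x + y) \<partial>real_gauss b \<partial>real_gauss a) = (\<integral>\<^sup>+x. h x \<partial>real_gauss (a + b))"
proof -
  interpret B: prob_space "real_gauss b" by (rule prob_space_real_gauss)
  show ?thesis
    unfolding real_gauss_add[OF assms(1,2), symmetric]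
    by (subst nn_integral_distr)
       (auto simp: B.nn_integral_fst[symmetric] case_prod_beta)
qed

lemma nn_integral_complex_gauss:
  assumes [measurable]: "h \<in> borel_measurable borel"
  shows "(\<integral>\<^sup>+z. h z \<partial>complex_gauss v) = (\<integral>\<^sup>+x. \<integral>\<^sup>+y. h (Complex x y) \<partial>real_gauss (v/2) \<partial>real_gauss (v/2))"
proof -
  interpret B: prob_space "real_gauss (v/2)" by (rule prob_space_real_gauss)
  show ?thesis
    unfolding complex_gauss_def case_prod_beta
    by (subst nn_integral_distr) (auto simp: B.nn_integral_fst[symmetric])
qed

lemma complex_gauss_add:
  assumes "a \<ge> 0" "b \<ge> 0"
  shows "distr (complex_gauss a \<Otimes>\<^sub>M complex_gauss b) borel (\<lambda>(x, y). x + y) = complex_gauss (a + b)"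
proof (rule measure_eqI)
  fix X assume "X \<in> sets (distr (complex_gauss a \<Otimes>\<^sub>M complex_gauss b) borel (\<lambda>(x, y). x + y))"
  then have X[measurable]: "X \<in> sets borel" by simp
  let ?h = "indicator X :: complex \<Rightarrow> ennreal"
  let ?A = "real_gauss (a/2)" and ?B = "real_gauss (b/2)"
  interpret B: prob_space "complex_gauss b" by (rule prob_space_complex_gauss)
  interpret rA: prob_space ?A by (rule prob_space_real_gauss)
  interpret rB: prob_space ?B by (rule prob_space_real_gauss)
  interpret AB: pair_prob_space ?A ?B ..
  have [measurable]: "(\<lambda>x. Complex (f x) (g x)) \<in> borel_measurable M"
    if [measurable]: "f \<in> borel_measurable M" "g \<in> borel_measurable M" for M :: "'x measure" and f g
    unfolding Complex_eq by measurable
  have "emeasure (distr (complex_gauss a \<Otimes>\<^sub>M complex_gauss b) borel (\<lambda>(x, y). x + y)) X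
      = (\<integral>\<^sup>+z. ?h z \<partial>distr (complex_gauss a \<Otimes>\<^sub>M complex_gauss b) borel (\<lambda>(x, y). x + y))"
    by (subst nn_integral_indicator) auto
  also have "\<dots> = (\<integral>\<^sup>+z. \<integral>\<^sup>+w. ?h (z + w) \<partial>complex_gauss b \<partial>complex_gauss a)"
    by (subst nn_integral_distr) (auto simp: B.nn_integral_fst[symmetric] case_prod_beta)
  also have "\<dots> = (\<integral>\<^sup>+x. \<integral>\<^sup>+x'. \<integral>\<^sup>+y. \<integral>\<^sup>+y'. ?h (Complex (x + y) (x' + y')) \<partial>?B \<partial>?B \<partial>?A \<partial>?A)"
  proof -
    have "Complex x y + Complex u w = Complex (x + u) (y + w)" for x y u w
      by (simp add: complex_eq_iff)
    then show ?thesis by (simp add: nn_integral_complex_gauss)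
  qed
  also have "\<dots> = (\<integral>\<^sup>+x. \<integral>\<^sup>+y. \<integral>\<^sup>+x'. \<integral>\<^sup>+y'. ?h (Complex (x + y) (x' + y')) \<partial>?B \<partial>?A \<partial>?B \<partial>?A)"
    by (intro nn_integral_cong AB.Fubini'[symmetric]) simp
  also have "\<dots> = (\<integral>\<^sup>+x. \<integral>\<^sup>+y. \<integral>\<^sup>+w. ?h (Complex (x + y) w) \<partial>real_gauss (a/2 + b/2) \<partial>?B \<partial>?A)"
    using assms by (subst nn_integral_real_gauss_add) auto
  also have "\<dots> = (\<integral>\<^sup>+x. \<integral>\<^sup>+w. ?h (Complex x w) \<partial>real_gauss (a/2 + b/2) \<partial>real_gauss (a/2 + b/2))"
  proof -
    interpret C: prob_space "real_gauss (a/2 + b/2)" by (rule prob_space_real_gauss)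
    have [measurable]: "(\<lambda>x. \<integral>\<^sup>+w. ?h (Complex x w) \<partial>real_gauss (a/2 + b/2)) \<in> borel_measurable borel"
      by measurable
    show ?thesis
      using assms
      by (subst nn_integral_real_gauss_add[of "a/2" "b/2" "\<lambda>x. \<integral>\<^sup>+w. ?h (Complex x w) \<partial>real_gauss (a/2 + b/2)"]) auto
  qed
  also have "\<dots> = (\<integral>\<^sup>+z. ?h z \<partial>complex_gauss (a + b))"
    by (subst nn_integral_complex_gauss) (auto simp: add_divide_distrib)
  also have "\<dots> = emeasure (complex_gauss (a + b)) X"
    by (rule nn_integral_indicator) simp
  finally show "emeasure (distr (complex_gauss a \<Otimes>\<^sub>M complex_gauss b) borel (\<lambda>(x, y). x + y)) X = emeasure (complex_gauss (a + b)) X" .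
qed simp

lemma prev_time_le: "finite J \<Longrightarrow> J \<subseteq> {0..1} \<Longrightarrow> t \<in> J \<Longrightarrow> prev_time J t \<le> t"
  unfolding prev_time_def by (subst Max_le_iff) auto

lemma sum_steps:
  assumes "finite H" "H \<subseteq> {0..1}" "t \<in> H"
  shows "(\<Sum>u\<in>{u\<in>H. u \<le> t}. u - prev_time H u) = t"
  using assms(3)
proof (induction "card {u\<in>H. u < t}" arbitrary: t rule: less_induct)
  case less
  have fin: "finite {u\<in>H. u < t}" using assms by simp
  have eq: "{u\<in>H. u \<le> t} = insert t {u\<in>H. u < t}" using less.prems by auto
  have "(\<Sum>u\<in>{u\<in>H. u \<le> t}. u - prev_time H u) = (t - prev_time H t) + (\<Sum>u\<in>{u\<in>H. u < t}. u - prev_time H u)"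
    unfolding eq using fin by (subst sum.insert) auto
  also have "(\<Sum>u\<in>{u\<in>H. u < t}. u - prev_time H u) = prev_time H t"
  proof (cases "{u\<in>H. u < t} = {}")
    case True then show ?thesis by (simp only: prev_time_def sum.empty) simp
  next
    case False
    define p where "p = Max {u\<in>H. u < t}"
    have p: "p \<in> H" "p < t" using Max_in[OF fin False] by (auto simp: p_def)
    have pm: "u \<le> p" if "u \<in> H" "u < t" for u using fin that by (auto simp: p_def)
    have pt: "prev_time H t = p"
      unfolding prev_time_def using fin False p(1) assms(2) by (subst Max_insert) (auto simp: p_def[symmetric])
    have e: "{u\<in>H. u < t} = {u\<in>H. u \<le> p}" using p pm by force
    have "card {u\<in>H. u < p} < card {u\<in>H. u < t}"
      using p by (intro psubset_card_mono fin) auto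
    from less.hyps[OF this p(1)] show ?thesis unfolding e pt .
  qed
  finally show ?case by simp
qed


lemma (in prob_space) distr_sum_complex_gauss:
  assumes "finite B" "B \<noteq> {}" "indep_vars (\<lambda>_. borel) X B"
    and "\<And>i. i \<in> B \<Longrightarrow> distr M borel (X i) = complex_gauss (v i)" "\<And>i. i \<in> B \<Longrightarrow> v i \<ge> 0"
  shows "distr M borel (\<lambda>\<omega>. \<Sum>i\<in>B. X i \<omega>) = complex_gauss (\<Sum>i\<in>B. v i)"
  using assms
proof (induction B rule: finite_ne_induct)
  case (singleton i)
  then show ?case by simp
next
  case (insert i B)
  have IH: "distr M borel (\<lambda>\<omega>. \<Sum>i\<in>B. X i \<omega>) = complex_gauss (\<Sum>i\<in>B. v i)"
    using insert.prems by (intro insert.IH) (auto intro: indep_vars_subset)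
  have "indep_var borel ((\<lambda>f. f i) \<circ> (\<lambda>\<omega>. restrict (\<lambda>i. X i \<omega>) {i}))
                  borel ((\<lambda>f. \<Sum>i\<in>B. f i) \<circ> (\<lambda>\<omega>. restrict (\<lambda>i. X i \<omega>) B))"
    using insert by (intro indep_var_compose[OF indep_var_restrict[OF insert.prems(1)]]) auto
  also have "((\<lambda>f. f i) \<circ> (\<lambda>\<omega>. restrict (\<lambda>i. X i \<omega>) {i})) = X i" by auto
  also have "((\<lambda>f. \<Sum>i\<in>B. f i) \<circ> (\<lambda>\<omega>. restrict (\<lambda>i. X i \<omega>) B)) = (\<lambda>\<omega>. \<Sum>i\<in>B. X i \<omega>)"
    by (auto cong: rev_conj_cong)
  finally have ind: "indep_var borel (X i) borel (\<lambda>\<omega>. \<Sum>i\<in>B. X i \<omega>)" .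
  note rv [measurable] = indep_var_rv1[OF ind] indep_var_rv2[OF ind]
  have "distr M borel (\<lambda>\<omega>. \<Sum>i\<in>insert i B. X i \<omega>)
      = distr (distr M (borel \<Otimes>\<^sub>M borel) (\<lambda>\<omega>. (X i \<omega>, \<Sum>i\<in>B. X i \<omega>))) borel (\<lambda>(x, y). x + y)"
    using insert.hyps by (subst distr_distr) (auto simp: comp_def)
  also have "\<dots> = distr (complex_gauss (v i) \<Otimes>\<^sub>M complex_gauss (\<Sum>i\<in>B. v i)) borel (\<lambda>(x, y). x + y)"
    using ind insert.prems IH by (simp add: indep_var_distribution_eq)
  also have "\<dots> = complex_gauss (v i + (\<Sum>i\<in>B. v i))"
    using insert.prems by (intro complex_gauss_add sum_nonneg) auto
  finally show ?case using insert.hyps by simp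
qed

lemma prob_space_brownian_fdd:
  assumes "finite J"
  shows "prob_space (brownian_fdd J)"
proof -
  interpret prob_space "PiM J (\<lambda>t. complex_gauss (t - prev_time J t))"
    by (intro prob_space_PiM prob_space_complex_gauss)
  show ?thesis
    unfolding brownian_fdd_def by (rule prob_space_distr) measurable
qed

lemma brownian_fdd_projective:
  assumes "J \<subseteq> H" "finite H" "H \<subseteq> {0..1}"
  shows "brownian_fdd J = distr (brownian_fdd H) (PiM J (\<lambda>_. borel)) (\<lambda>f. restrict f J)"
proof (cases "J = {}")
  case True
  interpret J: prob_space "brownian_fdd J" using True by (intro prob_space_brownian_fdd) auto
  interpret H: prob_space "brownian_fdd H" using assms by (intro prob_space_brownian_fdd) auto
  have s: "sets (brownian_fdd J) = {{}, {\<lambda>_. undefined}}"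
    by (auto simp: brownian_fdd_def True sets_PiM_empty)
  have "prob_space (distr (brownian_fdd H) (PiM J (\<lambda>_. borel)) (\<lambda>f. restrict f J))"
    using measurable_restrict_subset[OF assms(1), of "\<lambda>_. borel"]
    by (intro H.prob_space_distr) (simp add: brownian_fdd_def)
  then interpret D: prob_space "distr (brownian_fdd H) (PiM J (\<lambda>_. borel)) (\<lambda>f. restrict f J)" .
  show ?thesis
  proof (rule measure_eqI)
    fix X assume "X \<in> sets (brownian_fdd J)"
    then consider "X = {}" | "X = {\<lambda>_. undefined}" using s by auto
    then show "emeasure (brownian_fdd J) X = emeasure (distr (brownian_fdd H) (PiM J (\<lambda>_. borel)) (\<lambda>f. restrict f J)) X"
    proof cases
      case 2
      then show ?thesis
        using J.emeasure_space_1 D.emeasure_space_1 by (simp add: True brownian_fdd_def space_PiM)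
    qed simp
  qed (simp add: brownian_fdd_def)
next
  case False
  have finJ: "finite J" and J01: "J \<subseteq> {0..1}" using assms finite_subset by auto
  define N where "N = PiM H (\<lambda>t. complex_gauss (t - prev_time H t))"
  interpret N: prob_space N
    unfolding N_def by (intro prob_space_PiM prob_space_complex_gauss)
  have sN [measurable_cong]: "sets N = sets (PiM H (\<lambda>_. borel))"
    unfolding N_def by (intro sets_PiM_cong) auto
  define B where "B = (\<lambda>s. {u\<in>H. u \<le> s \<and> (\<forall>t\<in>J. t < s \<longrightarrow> t < u)})"
  have finB: "finite (B s)" and BH: "B s \<subseteq> H" for s using assms by (auto simp: B_def)
  have Bne: "s \<in> B s" if "s \<in> J" for s using that assms by (auto simp: B_def)
  have disj: "disjoint_family_on B J"
    unfolding disjoint_family_on_def B_def by (force simp: not_less)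
  have UB: "{u\<in>H. u \<le> t} = (\<Union>s\<in>{s\<in>J. s \<le> t}. B s)" if "t \<in> J" for t
  proof safe
    fix u assume u: "u \<in> H" "u \<le> t"
    define s where "s = Min {s\<in>J. u \<le> s}"
    have "s \<in> {s\<in>J. u \<le> s}"
      unfolding s_def using finJ u that by (intro Min_in) auto
    moreover have "s \<le> r" if "r \<in> J" "u \<le> r" for r
      unfolding s_def using finJ that by (intro Min_le) auto
    ultimately show "u \<in> (\<Union>s\<in>{s\<in>J. s \<le> t}. B s)"
      using u that by (intro UN_I[of s]) (force simp: B_def not_le[symmetric])+
  qed (auto simp: B_def)
  have sumB: "(\<Sum>u\<in>{u\<in>H. u \<le> t}. z u) = (\<Sum>s\<in>{s\<in>J. s \<le> t}. \<Sum>u\<in>B s. z u)"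
    if "t \<in> J" for t and z :: "real \<Rightarrow> 'b::comm_monoid_add"
    unfolding UB[OF that] using finJ finB disj
    by (intro sum.UNION_disjoint) (auto simp: disjoint_family_on_def)
  have steps: "(\<Sum>u\<in>B s. u - prev_time H u) = s - prev_time J s" if s: "s \<in> J" for s
  proof -
    have "s = (\<Sum>u\<in>{u\<in>H. u \<le> s}. u - prev_time H u)"
      using sum_steps[of H s] assms s by auto
    also have "\<dots> = (\<Sum>r\<in>{r\<in>J. r \<le> s}. \<Sum>u\<in>B r. u - prev_time H u)" by (rule sumB[OF s])
    also have "{r\<in>J. r \<le> s} = insert s {r\<in>J. r < s}" using s by auto
    also have "(\<Sum>r\<in>\<dots>. \<Sum>u\<in>B r. u - prev_time H u)
        = (\<Sum>u\<in>B s. u - prev_time H u) + (\<Sum>r\<in>{r\<in>J. r < s}. \<Sum>u\<in>B r. u - prev_time H u)"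
      using finJ by (subst sum.insert) auto
    also have "(\<Sum>r\<in>{r\<in>J. r < s}. \<Sum>u\<in>B r. u - prev_time H u) = prev_time J s"
    proof (cases "{r\<in>J. r < s} = {}")
      case True then show ?thesis by (simp only: prev_time_def sum.empty) simp
    next
      case False
      define p where "p = Max {r\<in>J. r < s}"
      have fin: "finite {r\<in>J. r < s}" using finJ by simp
      have p: "p \<in> J" "p < s" using Max_in[OF fin False] by (auto simp: p_def)
      have pm: "u \<le> p" if "u \<in> J" "u < s" for u using fin that by (auto simp: p_def)
      have ps: "prev_time J s = p"
        unfolding prev_time_def using fin False p(1) J01 by (subst Max_insert) (auto simp: p_def[symmetric])
      have e: "{r\<in>J. r < s} = {r\<in>J. r \<le> p}" using p pm by force
      show ?thesis
        unfolding e ps sumB[OF p(1), symmetric] using assms p by (intro sum_steps) auto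
    qed
    finally show ?thesis by simp
  qed
  have dN: "distr N borel (\<lambda>z. z u) = complex_gauss (u - prev_time H u)" if "u \<in> H" for u
  proof -
    have "distr N borel (\<lambda>z. z u) = distr N (complex_gauss (u - prev_time H u)) (\<lambda>z. z u)"
      by (intro distr_cong) auto
    also have "\<dots> = complex_gauss (u - prev_time H u)"
      unfolding N_def using that by (intro distr_PiM_component prob_space_complex_gauss)
    finally show ?thesis .
  qed
  have indN: "N.indep_vars (\<lambda>_. borel) (\<lambda>u z. z u) H"
  proof (cases "H = {}")
    case False
    have "distr N (PiM H (\<lambda>_. borel)) (\<lambda>z. \<lambda>u\<in>H. z u) = distr N N (\<lambda>z. z)"
      by (intro distr_cong) (auto simp: sN, auto simp: N_def space_PiM PiE_iff extensional_restrict)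
    also have "\<dots> = PiM H (\<lambda>u. distr N borel (\<lambda>z. z u))"
      using dN by (auto simp: distr_id N_def intro!: PiM_cong)
    finally show ?thesis
      using False by (subst N.indep_vars_iff_distr_eq_PiM') auto
  next
    case True
    then show ?thesis using False assms by auto
  qed
  have dB: "distr N borel (\<lambda>z. \<Sum>u\<in>B s. z u) = complex_gauss (s - prev_time J s)" if "s \<in> J" for s
    unfolding steps[OF that, symmetric]
    using Bne[OF that] BH[of s] assms prev_time_le[of H]
    by (intro N.distr_sum_complex_gauss finB N.indep_vars_subset[OF indN BH] dN) auto
  have "N.indep_vars (\<lambda>_. borel) (\<lambda>s z. (\<lambda>f. \<Sum>u\<in>B s. f u) (restrict (\<lambda>u. z u) (B s))) J"
    using BH by (intro N.indep_vars_compose2[OF N.indep_vars_restrict[OF indN _ disj]]) auto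
  then have ind: "N.indep_vars (\<lambda>_. borel) (\<lambda>s z. \<Sum>u\<in>B s. z u) J"
    by (simp cong: sum.cong)
  have mB [measurable]: "(\<lambda>z. \<Sum>u\<in>B s. z u) \<in> borel_measurable N" for s
    unfolding measurable_cong_sets[OF sN refl]
    using BH[of s] by (intro borel_measurable_sum measurable_component_singleton) auto
  have inc: "distr N (PiM J (\<lambda>_. borel)) (\<lambda>z. \<lambda>s\<in>J. \<Sum>u\<in>B s. z u)
      = PiM J (\<lambda>s. complex_gauss (s - prev_time J s))"
    using ind False dB by (subst (asm) N.indep_vars_iff_distr_eq_PiM') (auto intro!: PiM_cong)
  have mH: "(\<lambda>z. \<lambda>t\<in>H. \<Sum>u\<in>{u\<in>H. u \<le> t}. z u) \<in> N \<rightarrow>\<^sub>M PiM H (\<lambda>_. borel)"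
    by measurable
  have "distr (brownian_fdd H) (PiM J (\<lambda>_. borel)) (\<lambda>f. restrict f J)
      = distr N (PiM J (\<lambda>_. borel)) (\<lambda>z. \<lambda>t\<in>J. \<Sum>u\<in>{u\<in>H. u \<le> t}. z u)"
    unfolding brownian_fdd_def N_def[symmetric] using assms
    by (subst distr_distr)
       (auto simp: comp_def Int_absorb1 intro!: distr_cong measurable_restrict_subset mH)
  also have "\<dots> = distr (distr N (PiM J (\<lambda>_. borel)) (\<lambda>z. \<lambda>s\<in>J. \<Sum>u\<in>B s. z u)) (PiM J (\<lambda>_. borel))
       (\<lambda>y. \<lambda>t\<in>J. \<Sum>s\<in>{s\<in>J. s \<le> t}. y s)"
    by (subst distr_distr) (auto simp: comp_def sumB intro!: distr_cong)
  also have "\<dots> = brownian_fdd J"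
    unfolding inc brownian_fdd_def ..
  finally show ?thesis by simp
qed

text \<open>The marginals are consistent, so the Daniell-Kolmogorov theorem yields the law of \<open>W\<close>.\<close>

lemma polish_projective_brownian: "polish_projective {0..1} brownian_fdd"
  unfolding polish_projective_def projective_family_def
  using brownian_fdd_projective prob_space_brownian_fdd by blast


section \<open>The shape invariant model\<close>

text \<open>The law of \<open>Y\<^sub>x = (\<integral>\<^sub>0\<^sup>x f(y - \<tau>) dy) + W\<^sub>x\<close>, \<open>0 \<le> x \<le> 1\<close>, with \<open>\<tau> \<sim> g\<close> independent of \<open>W\<close>.\<close>

definition shape_law :: "(real \<Rightarrow> complex) \<Rightarrow> real measure \<Rightarrow> (real \<Rightarrow> complex) measure" where
  "shape_law f g = distr (g \<Otimes>\<^sub>M brownian_law) path_space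
     (\<lambda>(\<tau>, w). \<lambda>x\<in>{0..1}. (LINT y:{0..x}|lborel. f (y - \<tau>)) + w x)"

definition sample_law :: "nat \<Rightarrow> (real \<Rightarrow> complex) \<Rightarrow> real measure \<Rightarrow> (nat \<Rightarrow> real \<Rightarrow> complex) measure" where
  "sample_law n f g = PiM {..<n} (\<lambda>_. shape_law f g)"

definition l2_dist_sq :: "(real \<Rightarrow> complex) \<Rightarrow> (real \<Rightarrow> complex) \<Rightarrow> ennreal" where
  "l2_dist_sq u v = (\<integral>\<^sup>+t. ennreal ((norm (u t - v t))\<^sup>2) \<partial>circle)"

text \<open>
  The density of \<open>g\<close>. It is meaningful only for absolutely continuous \<open>g\<close>; every element of
  \<open>probs_smooth \<nu> A\<close> with \<open>\<nu> \<ge> 0\<close> is, having square-summable Fourier coefficients.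
\<close>

definition prob_density :: "real measure \<Rightarrow> real \<Rightarrow> complex" where
  "prob_density g t = complex_of_real (enn2real (RN_deriv circle g t))"

text \<open>
  The Borel sigma-algebra on \<open>S\<close> for the \<open>L\<^sup>2\<close> (pseudo)metric pulled back along \<open>e\<close>: the open
  sets are those that contain with each point \<open>x\<close> a ball around \<open>x\<close>, of radius \<open>sqrt r\<close>.
\<close>

definition l2_borel :: "'a set \<Rightarrow> ('a \<Rightarrow> real \<Rightarrow> complex) \<Rightarrow> 'a measure" where
  "l2_borel S e = sigma S {U. U \<subseteq> S \<and>
      (\<forall>x\<in>U. \<exists>r>0. \<forall>y\<in>S. l2_dist_sq (e y) (e x) < ennreal r \<longrightarrow> y \<in> U)}"

definition shape_estimators :: "nat \<Rightarrow> real \<Rightarrow> ((nat \<Rightarrow> real \<Rightarrow> complex) \<Rightarrow> (real \<Rightarrow> complex)) set" where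
  "shape_estimators n s =
     PiM {..<n} (\<lambda>_. path_space) \<rightarrow>\<^sub>M l2_borel (shape_class s) (\<lambda>f. f)"

definition prob_estimators :: "nat \<Rightarrow> real \<Rightarrow> real \<Rightarrow> ((nat \<Rightarrow> real \<Rightarrow> complex) \<Rightarrow> real measure) set" where
  "prob_estimators n \<nu> A =
     PiM {..<n} (\<lambda>_. path_space) \<rightarrow>\<^sub>M l2_borel (probs_smooth \<nu> A) prob_density"

text \<open>The risks take values in the extended nonnegative reals, since the classes are unbounded.\<close>

definition minimax_risk_shape :: "nat \<Rightarrow> real \<Rightarrow> real \<Rightarrow> real \<Rightarrow> ennreal" where
  "minimax_risk_shape n s \<nu> A =
     (INF fh \<in> shape_estimators n s. SUP (f, g) \<in> shape_class s \<times> probs_smooth \<nu> A.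
        \<integral>\<^sup>+y. l2_dist_sq (fh y) f \<partial>sample_law n f g)"

definition minimax_risk_prob :: "nat \<Rightarrow> real \<Rightarrow> real \<Rightarrow> real \<Rightarrow> ennreal" where
  "minimax_risk_prob n s \<nu> A =
     (INF gh \<in> prob_estimators n \<nu> A. SUP (f, g) \<in> shape_class s \<times> probs_smooth \<nu> A.
        \<integral>\<^sup>+y. l2_dist_sq (prob_density (gh y)) (prob_density g) \<partial>sample_law n f g)"

end

theory Submission
  imports Defs
begin

text \<open>
  Identifiability. An observation is the sum of the drift \<open>\<integral>\<^sub>0\<^sup>x f(y - \<tau>)
  dy\<close> and an independent Brownian motion. Every finite linear combination of values of the path has a
  characteristic function that is the product of the one of the drift and a nonvanishing Gaussian one
  (\<open>char_shape_law\<close>, \<open>brownian_char_nonzero\<close>), so the law of the observation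
  determines the law of the drift. Riemann sums (\<open>Riemann_Stieltjes_sums\<close>) add the first Fourier
  coefficient \<open>\<theta>\<^sub>1(f) exp(-2\<pi>i\<tau>)\<close> of the shifted shape to the functionals
  under control, and a bounded random vector is determined by its characteristic function
  (\<open>distr_eqI_bounded_char\<close>). Since \<open>\<theta>\<^sub>1(f) > 0\<close>, this coefficient
  reveals \<open>\<theta>\<^sub>1(f)\<close> as its modulus and the shift \<open>\<tau>\<close> through its
  argument. Its law yields the distribution of the shift, and its joint law with the drift yields the drift
  for almost every shift, hence \<open>f\<close> (\<open>shape_model_identifiable\<close>).

  Lower bounds. The shape class prescribes the sign of \<open>\<theta>\<^sub>1(f)\<close> but no lower bound
  on it, and identification rests on \<open>\<theta>\<^sub>1(f)\<close>. At \<open>\<theta>\<^sub>1(f) =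
  0\<close> it breaks down in two ways: under uniform shifts the modes \<open>e\<^sub>-\<^sub>1\<close> and
  \<open>-e\<^sub>-\<^sub>1\<close> have the same law (\<open>shape_law_sign_uniform\<close>), and the zero
  shape says nothing about the shift (\<open>shape_law_zero\<close>). For a fixed sample size, adding a
  sufficiently small multiple of \<open>e\<^sub>1\<close> enters the class and changes the laws of the samples
  by arbitrarily little in total variation (\<open>sample_laws_close\<close>). The two-point method
  (\<open>two_point_lower_bound\<close>) then bounds both minimax risks from below by constants that do not
  depend on the sample size, and the powers of the logarithm are eventually at least 1.

  The total variation estimate rests on \<open>brownian_law_shift_le\<close>: translating Brownian motion by
  an \<open>e\<close>-Lipschitz function changes its law by at most \<open>sqrt (exp (2 e\<^sup>2) -
  1)\<close>. It follows from the second moments of the Gaussian densities on finite grids, uniformly in the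
  grid.
\<close>

section \<open>Translates of Gaussian measures\<close>

text \<open>
  The factor is the quotient of the normal densities with means \<open>a\<close> and 0.
\<close>

lemma nn_integral_real_gauss_shift:
  assumes v: "v > 0" and [measurable]: "h \<in> borel_measurable borel"
  shows "(\<integral>\<^sup>+x. h (x + a) \<partial>real_gauss v) =
    (\<integral>\<^sup>+x. ennreal (exp ((a * x - a\<^sup>2 / 2) / v)) * h x \<partial>real_gauss v)"
proof -
  have rg: "real_gauss v = density lborel (normal_density 0 (sqrt v))"
  proof -
    interpret prob_space std_normal_distribution by (rule prob_space_normal_density) simp
    have "distributed std_normal_distribution lborel (\<lambda>x. x) std_normal_density"
      by (auto simp: distributed_def intro!: distr_id2)
    from normal_density_affine[OF this, of "sqrt v" 0] v
    have "distributed std_normal_distribution lborel (\<lambda>x. sqrt v * x) (normal_density 0 (sqrt v))"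
      by simp
    then have "distr std_normal_distribution lborel (\<lambda>x. sqrt v * x) = density lborel (normal_density 0 (sqrt v))"
      by (simp add: distributed_def)
    moreover have "distr std_normal_distribution lborel (\<lambda>x. sqrt v * x) = distr std_normal_distribution borel (\<lambda>x. sqrt v * x)"
      by (intro distr_cong) auto
    ultimately show ?thesis unfolding real_gauss_def by simp
  qed
  have dens: "normal_density 0 (sqrt v) (x - a) = normal_density 0 (sqrt v) x * exp ((a * x - a\<^sup>2 / 2) / v)" for x
    using v by (simp add: normal_density_def exp_add[symmetric] field_simps power2_eq_square)
  have "(\<integral>\<^sup>+x. h (x + a) \<partial>real_gauss v) = (\<integral>\<^sup>+x. ennreal (normal_density 0 (sqrt v) x) * h (x + a) \<partial>lborel)"
    unfolding rg by (subst nn_integral_density) auto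
  also have "\<dots> = (\<integral>\<^sup>+x. ennreal (normal_density 0 (sqrt v) (x - a)) * h x \<partial>lborel)"
    by (subst nn_integral_real_affine[where c = 1 and t = "-a"]) (auto simp: add.commute)
  also have "\<dots> = (\<integral>\<^sup>+x. ennreal (normal_density 0 (sqrt v) x) * (ennreal (exp ((a * x - a\<^sup>2 / 2) / v)) * h x) \<partial>lborel)"
    by (simp add: dens ennreal_mult' mult.assoc)
  also have "\<dots> = (\<integral>\<^sup>+x. ennreal (exp ((a * x - a\<^sup>2 / 2) / v)) * h x \<partial>real_gauss v)"
    unfolding rg by (subst nn_integral_density) auto
  finally show ?thesis .
qed

text \<open>
  The density of \<open>N\<^sub>\<complex>(m,v)\<close> with respect to
  \<open>N\<^sub>\<complex>(0,v)\<close>. For \<open>v = 0\<close> the division by zero makes it 1, which is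
  right for the Dirac measure shifted by \<open>m = 0\<close>; this case occurs when a path is observed at
  time 0.
\<close>

definition gauss_shift_density :: "real \<Rightarrow> complex \<Rightarrow> complex \<Rightarrow> real" where
  "gauss_shift_density v m z = exp ((2 * (m \<bullet> z) - (norm m)\<^sup>2) / v)"

lemma gauss_shift_density_nonneg [simp]: "0 \<le> gauss_shift_density v m z"
  by (simp add: gauss_shift_density_def)

lemma measurable_gauss_shift_density [measurable]: "gauss_shift_density v m \<in> borel_measurable borel"
  unfolding gauss_shift_density_def by measurable

lemma gauss_shift_density_Complex:
  assumes "v \<noteq> 0"
  shows "gauss_shift_density v m (Complex x y) =
     exp ((Re m * x - (Re m)\<^sup>2 / 2) / (v / 2)) * exp ((Im m * y - (Im m)\<^sup>2 / 2) / (v / 2))"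
  using assms
  by (simp add: gauss_shift_density_def exp_add[symmetric] inner_complex_def cmod_power2 field_simps)

lemma nn_integral_complex_gauss_shift:
  assumes v: "v > 0 \<or> v = 0 \<and> m = 0" and [measurable]: "h \<in> borel_measurable borel"
  shows "(\<integral>\<^sup>+z. h (z + m) \<partial>complex_gauss v) =
    (\<integral>\<^sup>+z. ennreal (gauss_shift_density v m z) * h z \<partial>complex_gauss v)"
proof (cases "m = 0")
  case True then show ?thesis by (simp add: gauss_shift_density_def)
next
  case False
  then have v: "v > 0" using v by auto
  have [measurable]: "(\<lambda>x. Complex (f x) (g x)) \<in> borel_measurable M"
    if [measurable]: "f \<in> borel_measurable M" "g \<in> borel_measurable M" for M :: "'x measure" and f g
    unfolding Complex_eq by measurable
  interpret R: prob_space "real_gauss (v/2)" by (rule prob_space_real_gauss)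
  let ?d = "\<lambda>a x. ennreal (exp ((a * x - a\<^sup>2 / 2) / (v / 2)))"
  have "Complex x y + m = Complex (x + Re m) (y + Im m)" for x y by (simp add: complex_eq_iff)
  then have "(\<integral>\<^sup>+z. h (z + m) \<partial>complex_gauss v)
     = (\<integral>\<^sup>+x. \<integral>\<^sup>+y. h (Complex (x + Re m) (y + Im m)) \<partial>real_gauss (v/2) \<partial>real_gauss (v/2))"
    by (simp add: nn_integral_complex_gauss)
  also have "\<dots> = (\<integral>\<^sup>+x. \<integral>\<^sup>+y. ?d (Im m) y * h (Complex (x + Re m) y) \<partial>real_gauss (v/2) \<partial>real_gauss (v/2))"
    using v by (subst nn_integral_real_gauss_shift) auto
  also have "\<dots> = (\<integral>\<^sup>+x. ?d (Re m) x * (\<integral>\<^sup>+y. ?d (Im m) y * h (Complex x y) \<partial>real_gauss (v/2)) \<partial>real_gauss (v/2))"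
    using v by (subst nn_integral_real_gauss_shift[of "v/2" "\<lambda>x. \<integral>\<^sup>+y. ?d (Im m) y * h (Complex x y) \<partial>real_gauss (v/2)"]) auto
  also have "\<dots> = (\<integral>\<^sup>+x. \<integral>\<^sup>+y. ennreal (gauss_shift_density v m (Complex x y)) * h (Complex x y) \<partial>real_gauss (v/2) \<partial>real_gauss (v/2))"
    using v by (simp add: gauss_shift_density_Complex ennreal_mult' mult.assoc nn_integral_cmult)
  also have "\<dots> = (\<integral>\<^sup>+z. ennreal (gauss_shift_density v m z) * h z \<partial>complex_gauss v)"
    by (subst nn_integral_complex_gauss) auto
  finally show ?thesis .
qed

lemma nn_integral_gauss_shift_density:
  assumes "v > 0 \<or> v = 0 \<and> m = 0"
  shows "(\<integral>\<^sup>+z. ennreal (gauss_shift_density v m z) \<partial>complex_gauss v) = 1"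
proof -
  interpret prob_space "complex_gauss v" by (rule prob_space_complex_gauss)
  show ?thesis
    using nn_integral_complex_gauss_shift[OF assms, of "\<lambda>_. 1"] by (simp add: emeasure_space_1)
qed

text \<open>
  Completing the square, the squared density for the shift \<open>m\<close> is a constant times the density
  for the shift \<open>2 m\<close>, which has integral 1.
\<close>

lemma nn_integral_gauss_shift_density_sq:
  assumes "v > 0 \<or> v = 0 \<and> m = 0"
  shows "(\<integral>\<^sup>+z. ennreal ((gauss_shift_density v m z)\<^sup>2) \<partial>complex_gauss v) = ennreal (exp (2 * (norm m)\<^sup>2 / v))"
proof -
  have "(gauss_shift_density v m z)\<^sup>2 = exp (2 * (norm m)\<^sup>2 / v) * gauss_shift_density v (2 * m) z" for z
  proof -
    have "(2 * m) \<bullet> z = 2 * (m \<bullet> z)" by (simp add: inner_complex_def algebra_simps)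
    then show ?thesis
      by (cases "v = 0") (simp_all add: gauss_shift_density_def exp_add[symmetric] power2_eq_square norm_mult field_simps)
  qed
  then have "(\<integral>\<^sup>+z. ennreal ((gauss_shift_density v m z)\<^sup>2) \<partial>complex_gauss v)
     = (\<integral>\<^sup>+z. ennreal (exp (2 * (norm m)\<^sup>2 / v)) * ennreal (gauss_shift_density v (2 * m) z) \<partial>complex_gauss v)"
    by (simp add: ennreal_mult')
  also have "\<dots> = ennreal (exp (2 * (norm m)\<^sup>2 / v))"
    using assms by (simp add: nn_integral_cmult nn_integral_gauss_shift_density)
  finally show ?thesis .
qed

text \<open>
  Both sides are product measures, and coordinate by coordinate they agree on boxes.
\<close>

lemma distr_PiM_complex_gauss_shift:
  fixes v :: "'i \<Rightarrow> real"
  assumes J: "finite J" and v: "\<And>t. t \<in> J \<Longrightarrow> v t > 0 \<or> v t = 0 \<and> m t = 0"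
  defines "N \<equiv> PiM J (\<lambda>t. complex_gauss (v t))"
  shows "distr N (PiM J (\<lambda>_. borel)) (\<lambda>z. \<lambda>t\<in>J. z t + m t)
    = density N (\<lambda>z. ennreal (\<Prod>t\<in>J. gauss_shift_density (v t) (m t) (z t)))"
proof -
  let ?M = "\<lambda>t. distr (complex_gauss (v t)) borel (\<lambda>z. z + m t)"
  have pr: "prob_space (?M t)" for t
    by (intro prob_space.prob_space_distr prob_space_complex_gauss) auto
  interpret M: product_prob_space ?M
    by (simp add: pr product_prob_space_def product_prob_space_axioms_def product_sigma_finite_def prob_space_imp_sigma_finite)
  interpret C: product_prob_space "\<lambda>t. complex_gauss (v t)"
    by (simp add: prob_space_complex_gauss product_prob_space_def product_prob_space_axioms_def product_sigma_finite_def prob_space_imp_sigma_finite)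
  have sN [measurable_cong]: "sets N = sets (PiM J (\<lambda>_. borel))"
    unfolding N_def by (intro sets_PiM_cong) auto
  have 1: "distr N (PiM J (\<lambda>_. borel)) (\<lambda>z. \<lambda>t\<in>J. z t + m t) = PiM J ?M"
  proof (rule M.PiM_eqI[OF J])
    show "sets (distr N (PiM J (\<lambda>_. borel)) (\<lambda>z. \<lambda>t\<in>J. z t + m t)) = sets (PiM J ?M)"
      by simp (intro sets_PiM_cong, auto)
    fix A assume "\<And>i. i \<in> J \<Longrightarrow> A i \<in> sets (?M i)"
    then have A[measurable]: "\<And>i. i \<in> J \<Longrightarrow> A i \<in> sets borel" by simp
    have "(\<lambda>z. \<lambda>t\<in>J. z t + m t) -` (Pi\<^sub>E J A) \<inter> space N = (\<Pi>\<^sub>E t\<in>J. (\<lambda>z. z + m t) -` A t)"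
      by (auto simp: N_def space_PiM PiE_iff complex_gauss_def)
    then have "emeasure (distr N (PiM J (\<lambda>_. borel)) (\<lambda>z. \<lambda>t\<in>J. z t + m t)) (Pi\<^sub>E J A)
      = emeasure N (\<Pi>\<^sub>E t\<in>J. (\<lambda>z. z + m t) -` A t)"
      using J by (subst emeasure_distr) (auto intro!: sets_PiM_I_finite)
    also have "\<dots> = (\<Prod>t\<in>J. emeasure (complex_gauss (v t)) ((\<lambda>z. z + m t) -` A t))"
      unfolding N_def
      by (subst C.emeasure_PiM[OF J]) (auto intro!: measurable_sets_borel[OF _ A])
    also have "\<dots> = (\<Prod>t\<in>J. emeasure (?M t) (A t))"
      by (intro prod.cong refl) (subst emeasure_distr, auto simp: complex_gauss_def)
    finally show "emeasure (distr N (PiM J (\<lambda>_. borel)) (\<lambda>z. \<lambda>t\<in>J. z t + m t)) (Pi\<^sub>E J A) = (\<Prod>t\<in>J. emeasure (?M t) (A t))" .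
  qed
  have 2: "density N (\<lambda>z. ennreal (\<Prod>t\<in>J. gauss_shift_density (v t) (m t) (z t))) = PiM J ?M"
  proof (rule M.PiM_eqI[OF J])
    show "sets (density N (\<lambda>z. ennreal (\<Prod>t\<in>J. gauss_shift_density (v t) (m t) (z t)))) = sets (PiM J ?M)"
      unfolding sets_density sN by (intro sets_PiM_cong) auto
    fix A assume "\<And>i. i \<in> J \<Longrightarrow> A i \<in> sets (?M i)"
    then have A[measurable]: "\<And>i. i \<in> J \<Longrightarrow> A i \<in> sets borel" by simp
    have ind: "indicator (Pi\<^sub>E J A) z = (\<Prod>t\<in>J. indicator (A t) (z t) :: ennreal)" if z: "z \<in> space N" for z
    proof (cases "z \<in> Pi\<^sub>E J A")
      case False
      then obtain t where "t \<in> J" "z t \<notin> A t" using z False by (auto simp: N_def space_PiM PiE_iff)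
      then show ?thesis using J False by (auto simp: indicator_def intro!: prod_zero[symmetric])
    qed (auto simp: PiE_iff)
    have PA: "Pi\<^sub>E J A \<in> sets N"
      unfolding sN using J A by (intro sets_PiM_I_finite) auto
    have "emeasure (density N (\<lambda>z. ennreal (\<Prod>t\<in>J. gauss_shift_density (v t) (m t) (z t)))) (Pi\<^sub>E J A)
      = (\<integral>\<^sup>+z. ennreal (\<Prod>t\<in>J. gauss_shift_density (v t) (m t) (z t)) * indicator (Pi\<^sub>E J A) z \<partial>N)"
      using PA by (intro emeasure_density) auto
    also have "\<dots> = (\<integral>\<^sup>+z. (\<Prod>t\<in>J. ennreal (gauss_shift_density (v t) (m t) (z t)) * indicator (A t) (z t)) \<partial>N)"
      by (intro nn_integral_cong) (simp add: ind prod_ennreal prod.distrib)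
    also have "\<dots> = (\<Prod>t\<in>J. \<integral>\<^sup>+z. ennreal (gauss_shift_density (v t) (m t) z) * indicator (A t) z \<partial>complex_gauss (v t))"
      unfolding N_def using A
      by (intro C.product_nn_integral_prod[OF J, of "\<lambda>t z. ennreal (gauss_shift_density (v t) (m t) z) * indicator (A t) z"]) auto
    also have "\<dots> = (\<Prod>t\<in>J. emeasure (?M t) (A t))"
    proof (intro prod.cong refl)
      fix t assume t: "t \<in> J"
      have "(\<integral>\<^sup>+z. ennreal (gauss_shift_density (v t) (m t) z) * indicator (A t) z \<partial>complex_gauss (v t))
        = (\<integral>\<^sup>+z. indicator (A t) (z + m t) \<partial>complex_gauss (v t))"
        using A[OF t] by (intro nn_integral_complex_gauss_shift[OF v[OF t], symmetric]) auto
      also have "\<dots> = (\<integral>\<^sup>+z. indicator (A t) z \<partial>?M t)"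
        using A[OF t] by (subst nn_integral_distr) auto
      also have "\<dots> = emeasure (?M t) (A t)"
        using A[OF t] by (intro nn_integral_indicator) auto
      finally show "(\<integral>\<^sup>+z. ennreal (gauss_shift_density (v t) (m t) z) * indicator (A t) z \<partial>complex_gauss (v t)) = emeasure (?M t) (A t)" .
    qed
    finally show "emeasure (density N (\<lambda>z. ennreal (\<Prod>t\<in>J. gauss_shift_density (v t) (m t) (z t)))) (Pi\<^sub>E J A) = (\<Prod>t\<in>J. emeasure (?M t) (A t))" .
  qed
  show ?thesis unfolding 1 2 ..
qed

text \<open>
  Cauchy-Schwarz bounds the difference of the two measures on a set by the standard deviation of the density.
  Second moments of densities multiply over independent coordinates, so this bound, unlike the sum of the
  distances of the coordinates, survives the passage to many coordinates.
\<close>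

lemma (in prob_space) density_set_le:
  assumes [measurable]: "L \<in> borel_measurable M" "A \<in> sets M" and pos: "\<And>x. 0 \<le> L x"
    and 1: "(\<integral>\<^sup>+x. ennreal (L x) \<partial>M) = 1"
    and 2: "(\<integral>\<^sup>+x. ennreal ((L x)\<^sup>2) \<partial>M) \<le> ennreal (1 + d\<^sup>2)" and d: "d \<ge> 0"
  shows "measure (density M L) A \<le> measure M A + d"
proof -
  have iL: "integrable M L" using 1 pos by (intro integrableI_nonneg) auto
  have iL2: "integrable M (\<lambda>x. (L x)\<^sup>2)" using 2 by (intro integrableI_nonneg) (auto simp: top.extremum_strict le_less_trans)
  have EL: "expectation L = 1" using 1 pos by (simp add: integral_eq_nn_integral)
  have EL2: "expectation (\<lambda>x. (L x)\<^sup>2) \<le> 1 + d\<^sup>2"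
    using 2 by (simp add: integral_eq_nn_integral enn2real_leI)
  define X where "X x = indicator A x * (L x - 1)" for x
  have X2: "(X x)\<^sup>2 = indicator A x * ((L x)\<^sup>2 - 2 * L x + 1)" for x
    by (auto simp: X_def indicator_def power2_eq_square algebra_simps)
  have [measurable]: "X \<in> borel_measurable M" unfolding X_def by measurable
  have iX: "integrable M X" unfolding X_def
    by (rule Bochner_Integration.integrable_bound[of _ "\<lambda>x. L x - 1"]) (auto simp: iL indicator_def)
  have iX2': "integrable M (\<lambda>x. (L x)\<^sup>2 - 2 * L x + 1)" using iL iL2 by auto
  have iX2: "integrable M (\<lambda>x. (X x)\<^sup>2)"
    by (rule Bochner_Integration.integrable_bound[OF iX2']) (auto simp: X2 indicator_def)
  have "(expectation X)\<^sup>2 \<le> expectation (\<lambda>x. (X x)\<^sup>2)"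
    using variance_eq[OF iX iX2] variance_positive[of X] by simp
  also have "\<dots> \<le> expectation (\<lambda>x. (L x)\<^sup>2 - 2 * L x + 1)"
  proof (rule integral_mono[OF iX2 iX2'])
    fix x have "(L x)\<^sup>2 - 2 * L x + 1 = (L x - 1)\<^sup>2" by (simp add: power2_eq_square algebra_simps)
    then show "(X x)\<^sup>2 \<le> (L x)\<^sup>2 - 2 * L x + 1" by (auto simp: X2 indicator_def)
  qed
  also have "\<dots> = expectation (\<lambda>x. (L x)\<^sup>2) - 1" using iL iL2 EL by (simp add: prob_space)
  also have "\<dots> \<le> d\<^sup>2" using EL2 by simp
  finally have "expectation X \<le> d" using d by (rule power2_le_imp_le)
  moreover have "expectation X = measure (density M L) A - measure M A"
  proof -
    have "expectation X = expectation (\<lambda>x. indicator A x * L x - indicator A x)"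
      by (intro Bochner_Integration.integral_cong) (auto simp: X_def algebra_simps)
    also have "\<dots> = expectation (\<lambda>x. indicator A x * L x) - expectation (indicator A)"
      by (intro Bochner_Integration.integral_diff integrable_real_mult_indicator integrable_real_indicator
          Bochner_Integration.integrable_bound[OF iL, of "\<lambda>x. indicator A x * L x"])
        (auto simp: indicator_def emeasure_finite less_top[symmetric])
    also have "expectation (\<lambda>x. indicator A x * L x) = measure (density M L) A"
      using pos by (subst integral_eq_nn_integral)
         (auto simp: measure_def emeasure_density ennreal_mult' mult.commute ennreal_indicator intro!: arg_cong[where f=enn2real] nn_integral_cong)
    finally show ?thesis by simp
  qed
  ultimately show ?thesis by simp
qed

section \<open>Translates of Brownian motion\<close>

text \<open>
  Adding \<open>h\<close> to a path adds the increments of \<open>h\<close> to the increments of the path.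
\<close>

lemma sum_increments_prev_time:
  fixes h :: "real \<Rightarrow> 'a::ab_group_add"
  assumes "finite H" "H \<subseteq> {0..1}" "t \<in> H"
  shows "(\<Sum>u\<in>{u\<in>H. u \<le> t}. h u - h (prev_time H u)) = h t - h 0"
  using assms(3)
proof (induction "card {u\<in>H. u < t}" arbitrary: t rule: less_induct)
  case less
  define S where "S = {u\<in>H. u < t}"
  have fin: "finite S" using assms by (simp add: S_def)
  have "{u\<in>H. u \<le> t} = insert t S" using less.prems by (auto simp: S_def)
  then have "(\<Sum>u\<in>{u\<in>H. u \<le> t}. h u - h (prev_time H u))
      = (h t - h (prev_time H t)) + (\<Sum>u\<in>S. h u - h (prev_time H u))"
    using fin by (simp add: S_def)
  also have "(\<Sum>u\<in>S. h u - h (prev_time H u)) = h (prev_time H t) - h 0"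
  proof (cases "S = {}")
    case True
    then have "prev_time H t = 0" unfolding prev_time_def S_def[symmetric] by simp
    then show ?thesis using True by simp
  next
    case False
    have p: "Max S \<in> S" and le: "\<And>u. u \<in> S \<Longrightarrow> u \<le> Max S" using fin False by auto
    then have "prev_time H t = Max S"
      unfolding prev_time_def S_def[symmetric] using fin False assms(2)
      by (subst Max_insert) (auto simp: S_def)
    moreover have "S = {u\<in>H. u \<le> Max S}" using p le by (force simp: S_def)
    moreover have "card {u\<in>H. u < Max S} < card {u\<in>H. u < t}"
      using p assms(1) by (intro psubset_card_mono) (auto simp: S_def)
    ultimately show ?thesis using less.hyps[of "Max S"] p by (simp add: S_def)
  qed
  finally show ?case by simp
qed

lemma sum_time_steps_le_1:
  assumes "finite J" "J \<subseteq> {0..1}"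
  shows "(\<Sum>t\<in>J. t - prev_time J t) \<le> 1"
proof (cases "J = {}")
  case False
  then have "Max J \<in> J" "J = {u\<in>J. u \<le> Max J}" using assms by auto
  then show ?thesis using sum_steps[OF assms \<open>Max J \<in> J\<close>] assms by auto
qed simp

text \<open>
  The sets that can be approximated by elements of the algebra, simultaneously for two finite measures, form a
  sigma-algebra.
\<close>

lemma algebra_approx:
  assumes G: "algebra \<Omega> G" and M: "finite_measure M" "sets M = sigma_sets \<Omega> G"
    and N: "finite_measure N" "sets N = sigma_sets \<Omega> G"
    and A: "A \<in> sigma_sets \<Omega> G" and e: "e > 0"
  shows "\<exists>B\<in>G. measure M (sym_diff A B) < e \<and> measure N (sym_diff A B) < e"
  using A e
proof (induction arbitrary: e)
  case (Basic a)
  then show ?case by (intro bexI[of _ a]) auto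
next
  case Empty
  then show ?case using algebra_iff_Un[THEN iffD1, OF G] by (intro bexI[of _ "{}"]) auto
next
  case (Compl a)
  interpret algebra \<Omega> G by fact
  obtain B where B: "B \<in> G" "measure M (sym_diff a B) < e" "measure N (sym_diff a B) < e"
    using Compl by blast
  have "a \<subseteq> \<Omega>" using Compl.hyps sigma_sets_into_sp[OF space_closed] by auto
  moreover have "B \<subseteq> \<Omega>" using B space_closed by auto
  ultimately have "sym_diff (\<Omega> - a) (\<Omega> - B) = sym_diff a B" by auto
  then show ?case using B by (intro bexI[of _ "\<Omega> - B"]) auto
next
  case (Union a)
  interpret algebra \<Omega> G by fact
  interpret M: finite_measure M by fact
  interpret N: finite_measure N by fact
  let ?A = "\<Union>i. a i" and ?An = "\<lambda>n::nat. \<Union>i<n. a i"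
  have am: "a i \<in> sets M" "a i \<in> sets N" for i using Union.hyps M N by auto
  have GM: "B \<in> sets M" "B \<in> sets N" if "B \<in> G" for B using that M N by auto
  have UA: "(\<Union>n. ?An n) = ?A" by auto
  have inc: "incseq ?An" by (force simp: incseq_def)
  have 1: "(\<lambda>n. measure M (?An n)) \<longlonglongrightarrow> measure M ?A"
    using M.finite_Lim_measure_incseq[OF _ inc] am unfolding UA by auto
  have 2: "(\<lambda>n. measure N (?An n)) \<longlonglongrightarrow> measure N ?A"
    using N.finite_Lim_measure_incseq[OF _ inc] am unfolding UA by auto
  have "\<forall>\<^sub>F n in sequentially. measure M (?An n) > measure M ?A - e / 2 \<and> measure N (?An n) > measure N ?A - e / 2"
    using order_tendstoD(1)[OF 1, of "measure M ?A - e / 2"] order_tendstoD(1)[OF 2, of "measure N ?A - e / 2"] Union.prems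
    by (auto intro: eventually_conj)
  then obtain n where n: "measure M (?An n) > measure M ?A - e / 2" "measure N (?An n) > measure N ?A - e / 2"
    by (auto simp: eventually_sequentially)
  \<comment> \<open>The tail after \<open>n\<close> costs \<open>e / 2\<close>, the \<open>n\<close> approximations together less than \<open>e / 2\<close>.\<close>
  define r where "r = e / (2 * (real n + 1))"
  have r: "r > 0" "real n * r < e / 2" using Union.prems by (auto simp: r_def field_simps)
  have "\<forall>i. \<exists>B\<in>G. measure M (sym_diff (a i) B) < r \<and> measure N (sym_diff (a i) B) < r"
    using Union.IH r by blast
  then obtain B where B: "\<And>i. B i \<in> G" "\<And>i. measure M (sym_diff (a i) (B i)) < r"
    "\<And>i. measure N (sym_diff (a i) (B i)) < r" by metis
  have bound: "measure K (sym_diff ?A (\<Union>i<n. B i)) < e"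
    if K: "finite_measure K" "\<And>i. a i \<in> sets K" "\<And>i. B i \<in> sets K"
      "measure K (?An n) > measure K ?A - e / 2" "\<And>i. measure K (sym_diff (a i) (B i)) < r" for K
  proof -
    interpret K: finite_measure K by fact
    note [measurable] = K(2,3)
    have "measure K (sym_diff ?A (\<Union>i<n. B i)) \<le> measure K ((?A - ?An n) \<union> (\<Union>i<n. sym_diff (a i) (B i)))"
      by (intro K.finite_measure_mono) auto
    also have "\<dots> \<le> measure K (?A - ?An n) + measure K (\<Union>i<n. sym_diff (a i) (B i))"
      by (intro measure_Un_le) auto
    also have "measure K (?A - ?An n) = measure K ?A - measure K (?An n)"
      by (intro K.finite_measure_Diff) auto
    also have "measure K (\<Union>i<n. sym_diff (a i) (B i)) \<le> (\<Sum>i<n. measure K (sym_diff (a i) (B i)))"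
      by (intro K.finite_measure_subadditive_finite) auto
    also have "\<dots> \<le> (\<Sum>i<n. r)" using K(5) by (intro sum_mono less_imp_le)
    also have "\<dots> = real n * r" by simp
    finally show ?thesis using r K(4) by linarith
  qed
  have "(\<Union>i<n. B i) \<in> G" using B by auto
  then show ?case
    using bound[OF \<open>finite_measure M\<close> am(1) GM(1)[OF B(1)] n(1) B(2)]
      bound[OF \<open>finite_measure N\<close> am(2) GM(2)[OF B(1)] n(2) B(3)] by blast
qed

text \<open>
  A total variation bound need only be checked on an algebra of generators. It is applied to the cylinder
  sets, where it reduces to finite-dimensional Gaussian measures.
\<close>

lemma measure_le_add_from_algebra:
  assumes G: "algebra \<Omega> G" and M: "finite_measure M" "sets M = sigma_sets \<Omega> G"
    and N: "finite_measure N" "sets N = sigma_sets \<Omega> G"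
    and le: "\<And>B. B \<in> G \<Longrightarrow> measure M B \<le> measure N B + d"
    and A: "A \<in> sigma_sets \<Omega> G"
  shows "measure M A \<le> measure N A + d"
proof (rule field_le_epsilon)
  fix e :: real assume "e > 0"
  then obtain B where B: "B \<in> G" "measure M (sym_diff A B) < e / 2" "measure N (sym_diff A B) < e / 2"
    using algebra_approx[OF G M N A, of "e / 2"] by auto
  interpret M: finite_measure M by fact
  interpret N: finite_measure N by fact
  have s: "A \<in> sets M" "B \<in> sets M" "A \<in> sets N" "B \<in> sets N" using A B M N by auto
  have "measure M A \<le> measure M (B \<union> sym_diff A B)" using s by (intro M.finite_measure_mono) auto
  also have "\<dots> \<le> measure M B + measure M (sym_diff A B)" using s by (intro measure_Un_le) auto
  also have "measure M B \<le> measure N B + d" by (rule le[OF B(1)])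
  also have "measure N B \<le> measure N (A \<union> sym_diff A B)" using s by (intro N.finite_measure_mono) auto
  also have "\<dots> \<le> measure N A + measure N (sym_diff A B)" using s by (intro measure_Un_le) auto
  finally show "measure M A \<le> measure N A + d + e" using B by linarith
qed

lemma sets_brownian_law [simp, measurable_cong]: "sets brownian_law = sets path_space"
  and prob_space_brownian_law: "prob_space brownian_law"
proof -
  interpret polish_projective "{0..1}" brownian_fdd by (rule polish_projective_brownian)
  show "sets brownian_law = sets path_space" by (simp add: brownian_law_def)
  show "prob_space brownian_law" unfolding brownian_law_def by (rule P.prob_space_axioms)
qed

lemma brownian_law_marginal:
  assumes "finite J" "J \<subseteq> {0..1}"
  shows "distr brownian_law (PiM J (\<lambda>_. borel)) (\<lambda>w. restrict w J) = brownian_fdd J"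
proof (rule measure_eqI)
  interpret polish_projective "{0..1}" brownian_fdd by (rule polish_projective_brownian)
  show "sets (distr brownian_law (PiM J (\<lambda>_. borel)) (\<lambda>w. restrict w J)) = sets (brownian_fdd J)"
    using assms by (simp add: sets_P)
  fix X assume "X \<in> sets (distr brownian_law (PiM J (\<lambda>_. borel)) (\<lambda>w. restrict w J))"
  then have X: "X \<in> sets (PiM J (\<lambda>_. borel))" by simp
  have "emeasure (distr brownian_law (PiM J (\<lambda>_. borel)) (\<lambda>w. restrict w J)) X = emeasure brownian_law (emb {0..1} J X)"
    using assms X by (subst emeasure_distr)
      (auto simp: prod_emb_def brownian_law_def measurable_cong_sets[OF sets_lim refl] space_PiM
        intro!: measurable_restrict_subset)
  also have "\<dots> = emeasure (brownian_fdd J) X"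
    unfolding brownian_law_def using assms X by (intro emeasure_lim_emb) auto
  finally show "emeasure (distr brownian_law (PiM J (\<lambda>_. borel)) (\<lambda>w. restrict w J)) X = emeasure (brownian_fdd J) X" .
qed

text \<open>
  On a grid \<open>J\<close> the increments are independent, and the shifted measure has a density whose
  second moment is the exponential of the sum of \<open>2 |\<Delta>h|\<^sup>2 / \<Delta>t\<close>. For a
  Lipschitz \<open>h\<close> this sum is at most \<open>2 e\<^sup>2\<close>, whatever the grid.
\<close>

lemma brownian_fdd_shift_le:
  fixes h :: "real \<Rightarrow> complex"
  assumes J: "finite J" "J \<subseteq> {0..1}" and h0: "h 0 = 0" and e: "e \<ge> 0"
    and h: "\<And>s t. 0 \<le> s \<Longrightarrow> s \<le> t \<Longrightarrow> t \<le> 1 \<Longrightarrow> norm (h t - h s) \<le> e * (t - s)"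
    and X: "X \<in> sets (PiM J (\<lambda>_. borel))"
  shows "measure (distr (brownian_fdd J) (PiM J (\<lambda>_. borel)) (\<lambda>w. \<lambda>t\<in>J. w t + h t)) X
    \<le> measure (brownian_fdd J) X + sqrt (exp (2 * e\<^sup>2) - 1)"
proof -
  define v where "v t = t - prev_time J t" for t
  define m where "m t = h t - h (prev_time J t)" for t
  define N where "N = PiM J (\<lambda>t. complex_gauss (v t))"
  define S where "S = (\<lambda>z::real \<Rightarrow> complex. \<lambda>t\<in>J. \<Sum>u\<in>{u \<in> J. u \<le> t}. z u)"
  define L where "L z = (\<Prod>t\<in>J. gauss_shift_density (v t) (m t) (z t))" for z
  interpret N: prob_space N unfolding N_def by (intro prob_space_PiM prob_space_complex_gauss)
  interpret C: product_prob_space "\<lambda>t. complex_gauss (v t)"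
    by (simp add: prob_space_complex_gauss product_prob_space_def product_prob_space_axioms_def product_sigma_finite_def prob_space_imp_sigma_finite)
  have sN [measurable_cong]: "sets N = sets (PiM J (\<lambda>_. borel))"
    unfolding N_def by (intro sets_PiM_cong) auto
  have prev: "0 \<le> prev_time J t" for t unfolding prev_time_def using J by (intro Max_ge) auto
  have v: "v t \<ge> 0" if "t \<in> J" for t using prev_time_le[OF J that] by (simp add: v_def)
  have m: "norm (m t) \<le> e * v t" if "t \<in> J" for t
    unfolding m_def v_def using prev prev_time_le[OF J that] J that by (intro h) auto
  have vm: "v t > 0 \<or> v t = 0 \<and> m t = 0" if "t \<in> J" for t using v[OF that] m[OF that] by (cases "v t = 0") auto
  have fdd: "brownian_fdd J = distr N (PiM J (\<lambda>_. borel)) S"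
    unfolding brownian_fdd_def N_def v_def S_def ..
  have mS [measurable]: "S \<in> PiM J (\<lambda>_. borel) \<rightarrow>\<^sub>M PiM J (\<lambda>_. borel)"
    unfolding S_def by measurable
  have mS' [measurable]: "(\<lambda>z. \<lambda>t\<in>J. z t + h t) \<in> PiM J (\<lambda>_. borel) \<rightarrow>\<^sub>M PiM J (\<lambda>_. borel)"
    by measurable
  have mS'' [measurable]: "(\<lambda>z. \<lambda>t\<in>J. z t + m t) \<in> PiM J (\<lambda>_. borel) \<rightarrow>\<^sub>M PiM J (\<lambda>_. borel)"
    by measurable
  have shift: "(\<lambda>t\<in>J. S z t + h t) = S (\<lambda>t\<in>J. z t + m t)" for z
  proof
    fix t show "(\<lambda>t\<in>J. S z t + h t) t = S (\<lambda>t\<in>J. z t + m t) t"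
      using sum_increments_prev_time[OF J, of t h] h0
      by (auto simp: S_def sum.distrib m_def)
  qed
  have "distr (brownian_fdd J) (PiM J (\<lambda>_. borel)) (\<lambda>w. \<lambda>t\<in>J. w t + h t)
     = distr N (PiM J (\<lambda>_. borel)) (\<lambda>z. S (\<lambda>t\<in>J. z t + m t))"
    unfolding fdd by (subst distr_distr) (auto simp: comp_def shift)
  also have "\<dots> = distr (distr N (PiM J (\<lambda>_. borel)) (\<lambda>z. \<lambda>t\<in>J. z t + m t)) (PiM J (\<lambda>_. borel)) S"
    by (subst distr_distr) (auto simp: comp_def)
  also have "distr N (PiM J (\<lambda>_. borel)) (\<lambda>z. \<lambda>t\<in>J. z t + m t) = density N L"
    unfolding N_def L_def using vm by (intro distr_PiM_complex_gauss_shift J) auto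
  finally have D: "distr (brownian_fdd J) (PiM J (\<lambda>_. borel)) (\<lambda>w. \<lambda>t\<in>J. w t + h t) = distr (density N L) (PiM J (\<lambda>_. borel)) S" .
  have [measurable]: "L \<in> borel_measurable N" unfolding L_def by measurable
  have sX: "S -` X \<inter> space N \<in> sets N"
    using X by (intro measurable_sets[of S N "PiM J (\<lambda>_. borel)"]) auto
  have "measure (distr (density N L) (PiM J (\<lambda>_. borel)) S) X = measure (density N L) (S -` X \<inter> space N)"
    using X by (subst measure_distr) auto
  also have "\<dots> \<le> measure N (S -` X \<inter> space N) + sqrt (exp (2 * e\<^sup>2) - 1)"
  proof (rule N.density_set_le[OF _ sX])
    show "L \<in> borel_measurable N" by measurable
    show "0 \<le> L z" for z by (simp add: L_def prod_nonneg)
    have "(\<integral>\<^sup>+z. ennreal (L z) \<partial>N) = (\<Prod>t\<in>J. \<integral>\<^sup>+z. ennreal (gauss_shift_density (v t) (m t) z) \<partial>complex_gauss (v t))"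
      unfolding L_def N_def
      by (subst C.product_nn_integral_prod[OF J(1), symmetric]) (auto simp: prod_ennreal)
    also have "\<dots> = 1" using vm by (simp add: nn_integral_gauss_shift_density)
    finally show "(\<integral>\<^sup>+z. ennreal (L z) \<partial>N) = 1" .
    have "(\<integral>\<^sup>+z. ennreal ((L z)\<^sup>2) \<partial>N) = (\<Prod>t\<in>J. \<integral>\<^sup>+z. ennreal ((gauss_shift_density (v t) (m t) z)\<^sup>2) \<partial>complex_gauss (v t))"
      unfolding L_def N_def
      by (subst C.product_nn_integral_prod[OF J(1), symmetric]) (auto simp: prod_ennreal prod_power_distrib)
    also have "\<dots> = (\<Prod>t\<in>J. ennreal (exp (2 * (norm (m t))\<^sup>2 / v t)))"
      using vm by (simp add: nn_integral_gauss_shift_density_sq)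
    also have "\<dots> = ennreal (exp (\<Sum>t\<in>J. 2 * (norm (m t))\<^sup>2 / v t))"
      using J by (simp add: prod_ennreal exp_sum)
    also have "(\<Sum>t\<in>J. 2 * (norm (m t))\<^sup>2 / v t) \<le> (\<Sum>t\<in>J. 2 * e\<^sup>2 * v t)"
    proof (rule sum_mono)
      fix t assume t: "t \<in> J"
      have "(norm (m t))\<^sup>2 \<le> (e * v t)\<^sup>2" using m[OF t] by (intro power_mono) auto
      then show "2 * (norm (m t))\<^sup>2 / v t \<le> 2 * e\<^sup>2 * v t"
        using v[OF t] by (cases "v t = 0") (auto simp: field_simps power2_eq_square)
    qed
    also have "\<dots> = 2 * e\<^sup>2 * (\<Sum>t\<in>J. v t)" by (simp add: sum_distrib_left)
    also have "\<dots> \<le> 2 * e\<^sup>2 * 1"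
      using sum_time_steps_le_1[OF J] unfolding v_def by (intro mult_left_mono) auto
    finally show "(\<integral>\<^sup>+z. ennreal ((L z)\<^sup>2) \<partial>N) \<le> ennreal (1 + (sqrt (exp (2 * e\<^sup>2) - 1))\<^sup>2)"
      by (simp add: ennreal_leI)
  qed simp
  also have "measure N (S -` X \<inter> space N) = measure (brownian_fdd J) X"
    unfolding fdd using X by (subst measure_distr) auto
  finally show ?thesis unfolding D .
qed

text \<open>
  A quantitative fragment of the Cameron-Martin theorem: the bound for grids is uniform in the grid, so it
  passes to the cylinder sigma-algebra.
\<close>

lemma brownian_law_shift_le:
  fixes h :: "real \<Rightarrow> complex"
  assumes h0: "h 0 = 0" and e: "e \<ge> 0"
    and h: "\<And>s t. 0 \<le> s \<Longrightarrow> s \<le> t \<Longrightarrow> t \<le> 1 \<Longrightarrow> norm (h t - h s) \<le> e * (t - s)"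
    and A: "A \<in> sets path_space"
  shows "measure (distr brownian_law path_space (\<lambda>w. \<lambda>t\<in>{0..1}. w t + h t)) A
    \<le> measure brownian_law A + sqrt (exp (2 * e\<^sup>2) - 1)"
proof -
  interpret polish_projective "{0..1}" brownian_fdd by (rule polish_projective_brownian)
  interpret B: prob_space brownian_law by (rule prob_space_brownian_law)
  have mh [measurable]: "(\<lambda>w. \<lambda>t\<in>K. w t + h t) \<in> PiM K (\<lambda>_. borel) \<rightarrow>\<^sub>M PiM K (\<lambda>_. borel)" for K
    by measurable
  let ?D = "distr brownian_law path_space (\<lambda>w. \<lambda>t\<in>{0..1}. w t + h t)"
  interpret D: prob_space ?D by (rule B.prob_space_distr) simp
  show ?thesis
  proof (rule measure_le_add_from_algebra[OF algebra_generator])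
    show "finite_measure ?D" "finite_measure brownian_law" by unfold_locales
    show "sets ?D = sigma_sets (space path_space) generator" "sets brownian_law = sigma_sets (space path_space) generator"
      by (simp_all add: sets_PiM_generator)
    show "A \<in> sigma_sets (space path_space) generator" using A by (simp add: sets_PiM_generator)
    fix B assume "B \<in> generator"
    then obtain J X where J: "finite J" "J \<subseteq> {0..1}" and X: "X \<in> sets (PiM J (\<lambda>_. borel))"
      and B: "B = emb {0..1} J X" by cases
    have r [measurable]: "(\<lambda>w. restrict w J) \<in> path_space \<rightarrow>\<^sub>M PiM J (\<lambda>_. borel)"
      using J by (intro measurable_restrict_subset)
    have emb: "measure K B = measure (distr K (PiM J (\<lambda>_. borel)) (\<lambda>w. restrict w J)) X"
      if "sets K = sets path_space" for K
      using J X that unfolding B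
      by (subst measure_distr)
         (auto simp: prod_emb_def space_PiM sets_eq_imp_space_eq[OF that] measurable_cong_sets[OF that refl])
    have "distr ?D (PiM J (\<lambda>_. borel)) (\<lambda>w. restrict w J)
      = distr (distr brownian_law (PiM J (\<lambda>_. borel)) (\<lambda>w. restrict w J)) (PiM J (\<lambda>_. borel)) (\<lambda>w. \<lambda>t\<in>J. w t + h t)"
    proof -
      have "restrict (\<lambda>t\<in>{0..1}. w t + h t) J = (\<lambda>t\<in>J. restrict w J t + h t)" for w
        using J by (auto simp: restrict_def fun_eq_iff)
      then show ?thesis by (subst (1 2) distr_distr) (auto simp: comp_def)
    qed
    then show "measure ?D B \<le> measure brownian_law B + sqrt (exp (2 * e\<^sup>2) - 1)"
      using brownian_fdd_shift_le[OF J h0 e h X] by (simp add: emb brownian_law_marginal[OF J])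
  qed
qed

section \<open>Periodic functions on the circle and drifts\<close>

lemma prob_space_circle: "prob_space circle"
  unfolding circle_def by (intro prob_space_restrict_space) auto

lemma sets_circle [measurable_cong]: "sets circle = sets (restrict_space borel {0..<1})"
  unfolding circle_def by (intro sets_restrict_space_cong) simp

lemma space_circle [simp]: "space circle = {0..<1}"
  by (simp add: circle_def)

lemma measurable_circle_borel: "f \<in> borel \<rightarrow>\<^sub>M M \<Longrightarrow> f \<in> circle \<rightarrow>\<^sub>M M"
  unfolding circle_def by (intro measurable_restrict_space1) simp

lemma nn_integral_circle:
  assumes [measurable]: "F \<in> borel_measurable borel"
  shows "(\<integral>\<^sup>+t. F t \<partial>circle) = (\<integral>\<^sup>+t. F t * indicator {0..<1} t \<partial>lborel)"
  unfolding circle_def by (subst nn_integral_restrict_space) auto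

lemma periodic_add_int:
  fixes F :: "real \<Rightarrow> 'a"
  assumes "\<And>x. F (x + 1) = F x"
  shows "F (x + of_int k) = F x"
proof (induction k rule: int_induct[where k = 0])
  case (step1 i) then show ?case using assms[of "x + of_int i"] by (simp add: add.assoc)
next
  case (step2 i) then show ?case using assms[of "x + of_int i - 1"] by (simp add: algebra_simps)
qed simp

text \<open>
  After reduction of the shift modulo 1, the translated period is cut at 1 and its second piece is moved back
  by one period.
\<close>

lemma nn_integral_circle_shift:
  fixes F :: "real \<Rightarrow> ennreal"
  assumes [measurable]: "F \<in> borel_measurable borel" and per: "\<And>x. F (x + 1) = F x"
  shows "(\<integral>\<^sup>+t. F (t + a) \<partial>circle) = (\<integral>\<^sup>+t. F t \<partial>circle)"
proof -
  define b where "b = frac a"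
  have b: "0 \<le> b" "b < 1" by (auto simp: b_def frac_lt_1)
  have "F (t + a) = F (t + b)" for t
    using periodic_add_int[of F "t + b" "\<lfloor>a\<rfloor>"] per by (simp add: b_def frac_def)
  then have "(\<integral>\<^sup>+t. F (t + a) \<partial>circle) = (\<integral>\<^sup>+t. F (t + b) * indicator {0..<1} t \<partial>lborel)"
    by (simp add: nn_integral_circle)
  also have "\<dots> = (\<integral>\<^sup>+t. F t * indicator {b..<1 + b} t \<partial>lborel)"
    by (subst (2) nn_integral_real_affine[where c = 1 and t = b])
       (auto simp: add.commute indicator_def intro!: nn_integral_cong)
  also have "\<dots> = (\<integral>\<^sup>+t. F t * indicator {b..<1} t + F t * indicator {1..<1 + b} t \<partial>lborel)"
    using b by (intro nn_integral_cong) (auto simp: indicator_def)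
  also have "\<dots> = (\<integral>\<^sup>+t. F t * indicator {b..<1} t \<partial>lborel) + (\<integral>\<^sup>+t. F t * indicator {1..<1 + b} t \<partial>lborel)"
    by (intro nn_integral_add) auto
  also have "(\<integral>\<^sup>+t. F t * indicator {1..<1 + b} t \<partial>lborel) = (\<integral>\<^sup>+t. F t * indicator {0..<b} t \<partial>lborel)"
    using per by (subst nn_integral_real_affine[where c = 1 and t = 1])
       (auto simp: add.commute indicator_def intro!: nn_integral_cong)
  also have "(\<integral>\<^sup>+t. F t * indicator {b..<1} t \<partial>lborel) + \<dots> = (\<integral>\<^sup>+t. F t * indicator {b..<1} t + F t * indicator {0..<b} t \<partial>lborel)"
    by (intro nn_integral_add[symmetric]) auto
  also have "\<dots> = (\<integral>\<^sup>+t. F t \<partial>circle)"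
    unfolding nn_integral_circle[OF assms(1)] using b by (intro nn_integral_cong) (auto simp: indicator_def)
  finally show ?thesis .
qed

lemma measurable_circle_L2 [measurable_dest]: "f \<in> circle_L2 \<Longrightarrow> f \<in> borel_measurable borel"
  by (simp add: circle_L2_def)

lemma integrable_circle_L2:
  assumes "f \<in> circle_L2" shows "integrable circle f"
proof -
  interpret prob_space circle by (rule prob_space_circle)
  show ?thesis
  proof (rule Bochner_Integration.integrable_bound)
    show "integrable circle (\<lambda>t. 1 + (norm (f t))\<^sup>2)" using assms by (auto simp: circle_L2_def)
    show "f \<in> borel_measurable circle" using assms by (auto intro: measurable_circle_borel measurable_circle_L2)
    have "x \<le> 1 + x\<^sup>2" for x :: real
      using zero_le_power2[of "x - 1/2"] by (simp add: power2_eq_square algebra_simps)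
    then show "AE t in circle. norm (f t) \<le> norm (1 + (norm (f t))\<^sup>2)" by (auto intro: order_trans)
  qed
qed

lemma set_integrable_shift:
  assumes f: "f \<in> circle_L2"
  shows "set_integrable lborel {0..1} (\<lambda>y. f (y - \<tau>))"
proof -
  have [measurable]: "f \<in> borel_measurable borel" using f by (rule measurable_circle_L2)
  have per: "f (x + 1) = f x" for x using f by (simp add: circle_L2_def)
  have "(\<integral>\<^sup>+y. ennreal (norm (indicat_real {0..1} y *\<^sub>R f (y - \<tau>))) \<partial>lborel) = (\<integral>\<^sup>+y. ennreal (norm (f (y + - \<tau>))) * indicator {0..<1} y \<partial>lborel)"
  proof (rule nn_integral_cong_AE)
    show "AE y in lborel. ennreal (norm (indicat_real {0..1} y *\<^sub>R f (y - \<tau>))) = ennreal (norm (f (y + - \<tau>))) * indicator {0..<1} y"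
      using AE_lborel_singleton[of "1::real"] by eventually_elim (auto simp: indicator_def)
  qed
  also have "\<dots> = (\<integral>\<^sup>+y. ennreal (norm (f (y + - \<tau>))) \<partial>circle)"
    by (subst nn_integral_circle) auto
  also have "\<dots> = (\<integral>\<^sup>+y. ennreal (norm (f y)) \<partial>circle)"
    by (rule nn_integral_circle_shift[where F = "\<lambda>t. ennreal (norm (f t))"]) (auto simp: per)
  also have "\<dots> < \<infinity>" using integrable_circle_L2[OF f] by (simp add: integrable_iff_bounded)
  finally show ?thesis unfolding set_integrable_def by (intro integrableI_bounded) auto
qed

text \<open>
  The deterministic part of an observation with shape \<open>f\<close> and random shift \<open>\<tau>\<close>.
\<close>

definition drift :: "(real \<Rightarrow> complex) \<Rightarrow> real \<Rightarrow> real \<Rightarrow> complex" where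
  "drift f \<tau> x = (LINT y:{0..x}|lborel. f (y - \<tau>))"

lemma measurable_drift [measurable]:
  assumes [measurable]: "f \<in> borel_measurable borel"
  shows "(\<lambda>\<tau>. drift f \<tau> x) \<in> borel_measurable borel"
  unfolding drift_def set_lebesgue_integral_def by measurable

lemma drift_0 [simp]: "drift f \<tau> 0 = 0"
  using AE_lborel_singleton[of "0::real"]
  by (auto simp: drift_def set_lebesgue_integral_def indicator_def intro!: integral_eq_zero_AE)

lemma set_integrable_shift_sub:
  assumes "f \<in> circle_L2" "K \<subseteq> {0..1}" "K \<in> sets borel"
  shows "set_integrable lborel K (\<lambda>y. f (y - \<tau>))"
  using set_integrable_subset[OF set_integrable_shift[OF assms(1)] _ assms(2)] assms(3) by simp

lemma drift_diff:
  assumes f: "f \<in> circle_L2" and st: "0 \<le> s" "s \<le> t" "t \<le> 1"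
  shows "drift f \<tau> t - drift f \<tau> s = (LINT y:{s<..t}|lborel. f (y - \<tau>))"
proof -
  have eq: "{0..t} = {0..s} \<union> {s<..t}" using st by auto
  show ?thesis unfolding drift_def eq using st
    by (subst set_integral_Un) (auto intro!: set_integrable_shift_sub[OF f])
qed

lemma drift_sub_Lipschitz:
  assumes f: "f1 \<in> circle_L2" "f2 \<in> circle_L2" and e: "\<And>t. norm (f1 t - f2 t) \<le> e"
    and st: "0 \<le> s" "s \<le> t" "t \<le> 1"
  shows "norm ((drift f1 \<tau> t - drift f2 \<tau> t) - (drift f1 \<tau> s - drift f2 \<tau> s)) \<le> e * (t - s)"
proof -
  have i: "set_integrable lborel {s<..t} (\<lambda>y. f1 (y - \<tau>))" "set_integrable lborel {s<..t} (\<lambda>y. f2 (y - \<tau>))"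
    using st by (auto intro!: set_integrable_shift_sub f)
  have "(drift f1 \<tau> t - drift f2 \<tau> t) - (drift f1 \<tau> s - drift f2 \<tau> s) =
     (LINT y:{s<..t}|lborel. f1 (y - \<tau>) - f2 (y - \<tau>))"
    using drift_diff[OF f(1) st] drift_diff[OF f(2) st] i by (simp add: set_integral_diff algebra_simps)
  also have "norm \<dots> \<le> (LINT y:{s<..t}|lborel. norm (f1 (y - \<tau>) - f2 (y - \<tau>)))"
    using i by (intro set_integral_norm_bound set_integral_diff)
  also have "\<dots> \<le> (LINT y:{s<..t}|lborel. e)"
    using i e by (intro set_integral_mono set_integrable_norm set_integral_diff)
      (auto simp: set_integrable_def emeasure_lborel_Ioc st intro!: integrable_real_indicator)
  also have "\<dots> = e * (t - s)" using st by (simp add: set_lebesgue_integral_def)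
  finally show ?thesis .
qed

section \<open>The law of an observation\<close>

lemma circle_probsD:
  assumes "g \<in> circle_probs"
  shows "prob_space g" "sets g = sets (restrict_space borel {0..<1})" "space g = {0..<1}"
    "\<And>f M. f \<in> borel \<rightarrow>\<^sub>M M \<Longrightarrow> f \<in> g \<rightarrow>\<^sub>M M"
proof -
  show "prob_space g" using assms by (simp add: circle_probs_def)
  have s: "sets g = sets circle" using assms by (simp add: circle_probs_def)
  then show "sets g = sets (restrict_space borel {0..<1})" by (simp add: sets_circle)
  show "space g = {0..<1}" using sets_eq_imp_space_eq[OF s] by simp
  show "f \<in> g \<rightarrow>\<^sub>M M" if "f \<in> borel \<rightarrow>\<^sub>M M" for f M
    using measurable_circle_borel[OF that] measurable_cong_sets[OF s refl] by auto
qed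

lemma measurable_drift_path:
  assumes f: "f \<in> circle_L2" and g: "g \<in> circle_probs"
  shows "(\<lambda>(\<tau>, w). \<lambda>x\<in>{0..1}. drift f \<tau> x + w x) \<in> g \<Otimes>\<^sub>M brownian_law \<rightarrow>\<^sub>M path_space"
proof -
  have [measurable]: "f \<in> borel_measurable borel" using f by (rule measurable_circle_L2)
  have [measurable]: "(\<lambda>\<tau>. drift f \<tau> x) \<in> borel_measurable g" for x
    by (rule circle_probsD(4)[OF g]) measurable
  show ?thesis by measurable
qed

lemma measurable_emeasure_drift:
  assumes [measurable]: "f \<in> borel_measurable borel" and A: "A \<in> sets path_space"
  shows "(\<lambda>\<tau>. emeasure (distr brownian_law path_space (\<lambda>w. \<lambda>x\<in>{0..1}. drift f \<tau> x + w x)) A)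
    \<in> borel_measurable borel"
proof -
  interpret B: prob_space brownian_law by (rule prob_space_brownian_law)
  let ?S = "\<lambda>(\<tau>, w). \<lambda>x\<in>{0..1}. drift f \<tau> x + w x"
  have m: "?S \<in> borel \<Otimes>\<^sub>M brownian_law \<rightarrow>\<^sub>M path_space" by measurable
  have "(\<lambda>\<tau>. emeasure brownian_law (Pair \<tau> -` (?S -` A \<inter> space (borel \<Otimes>\<^sub>M brownian_law)))) \<in> borel_measurable borel"
    using measurable_sets[OF m A] by (rule B.measurable_emeasure_Pair)
  also have "?this \<longleftrightarrow> ?thesis"
    using A by (intro measurable_cong, subst emeasure_distr)
      (auto simp: space_pair_measure intro!: arg_cong[where f = "emeasure brownian_law"])
  finally show ?thesis .
qed

text \<open>
  The law of an observation is the mixture, over the shift, of translates of the law of \<open>W\<close>.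
\<close>

lemma emeasure_shape_law:
  assumes f: "f \<in> circle_L2" and g: "g \<in> circle_probs" and A: "A \<in> sets path_space"
  shows "emeasure (shape_law f g) A =
    (\<integral>\<^sup>+\<tau>. emeasure (distr brownian_law path_space (\<lambda>w. \<lambda>x\<in>{0..1}. drift f \<tau> x + w x)) A \<partial>g)"
proof -
  interpret g: prob_space g by (rule circle_probsD[OF g])
  interpret B: prob_space brownian_law by (rule prob_space_brownian_law)
  note m = measurable_drift_path[OF f g]
  have "emeasure (shape_law f g) A = emeasure (g \<Otimes>\<^sub>M brownian_law)
     ((\<lambda>(\<tau>, w). \<lambda>x\<in>{0..1}. drift f \<tau> x + w x) -` A \<inter> space (g \<Otimes>\<^sub>M brownian_law))"
    unfolding shape_law_def drift_def[symmetric] using m A by (subst emeasure_distr) auto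
  also have "\<dots> = (\<integral>\<^sup>+\<tau>. emeasure brownian_law (Pair \<tau> -` ((\<lambda>(\<tau>, w). \<lambda>x\<in>{0..1}. drift f \<tau> x + w x) -` A \<inter> space (g \<Otimes>\<^sub>M brownian_law))) \<partial>g)"
    using measurable_sets[OF m A] by (rule B.emeasure_pair_measure_alt)
  also have "\<dots> = (\<integral>\<^sup>+\<tau>. emeasure (distr brownian_law path_space (\<lambda>w. \<lambda>x\<in>{0..1}. drift f \<tau> x + w x)) A \<partial>g)"
    using A by (intro nn_integral_cong, subst emeasure_distr)
      (auto simp: space_pair_measure intro!: arg_cong[where f = "emeasure brownian_law"])
  finally show ?thesis .
qed

lemma sets_shape_law [simp]: "sets (shape_law f g) = sets path_space"
  by (simp add: shape_law_def)

lemma prob_space_shape_law: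
  assumes "f \<in> circle_L2" "g \<in> circle_probs" shows "prob_space (shape_law f g)"
proof -
  interpret g: prob_space g by (rule circle_probsD[OF assms(2)])
  interpret B: prob_space brownian_law by (rule prob_space_brownian_law)
  interpret P: pair_prob_space g brownian_law ..
  show ?thesis unfolding shape_law_def using measurable_drift_path[OF assms]
    by (intro P.P.prob_space_distr) (simp add: drift_def)
qed

text \<open>
  For each shift the two drifts differ by an \<open>e\<close>-Lipschitz function, so their translates of
  \<open>W\<close> are close; mixing over the shift preserves the bound.
\<close>

lemma shape_law_perturb_le:
  assumes f: "f1 \<in> circle_L2" "f2 \<in> circle_L2" and g: "g \<in> circle_probs"
    and e: "\<And>t. norm (f1 t - f2 t) \<le> e" and A: "A \<in> sets path_space"
  shows "emeasure (shape_law f1 g) A \<le> emeasure (shape_law f2 g) A + ennreal (sqrt (exp (2 * e\<^sup>2) - 1))"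
proof -
  interpret g: prob_space g by (rule circle_probsD[OF g])
  interpret B: prob_space brownian_law by (rule prob_space_brownian_law)
  have e0: "e \<ge> 0" using e norm_ge_zero order_trans by blast
  let ?D = "\<lambda>f \<tau>. distr brownian_law path_space (\<lambda>w. \<lambda>x\<in>{0..1}. drift f \<tau> x + w x)"
  let ?d = "sqrt (exp (2 * e\<^sup>2) - 1)"
  have le: "emeasure (?D f1 \<tau>) A \<le> emeasure (?D f2 \<tau>) A + ennreal ?d" for \<tau>
  proof -
    define h where "h t = drift f1 \<tau> t - drift f2 \<tau> t" for t
    let ?T = "\<lambda>w. \<lambda>x\<in>{0..1}. drift f2 \<tau> x + w x"
    let ?S = "distr brownian_law path_space (\<lambda>w. \<lambda>t\<in>{0..1}. w t + h t)"
    have [measurable]: "?T \<in> path_space \<rightarrow>\<^sub>M path_space" by measurable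
    have [measurable]: "(\<lambda>w. \<lambda>t\<in>{0..1}. w t + h t) \<in> path_space \<rightarrow>\<^sub>M path_space" by measurable
    interpret S: prob_space ?S by (rule B.prob_space_distr) simp
    have TA: "?T -` A \<inter> space path_space \<in> sets path_space" using A by (intro measurable_sets) auto
    have "?T (\<lambda>t\<in>{0..1}. w t + h t) = (\<lambda>x\<in>{0..1}. drift f1 \<tau> x + w x)" for w
      by (auto simp: h_def restrict_def fun_eq_iff)
    then have "?D f1 \<tau> = distr ?S path_space ?T"
      by (subst distr_distr) (auto simp: comp_def)
    then have "emeasure (?D f1 \<tau>) A = emeasure ?S (?T -` A \<inter> space path_space)"
      using A by (simp add: emeasure_distr[where M = ?S])
    also have "\<dots> \<le> emeasure brownian_law (?T -` A \<inter> space path_space) + ennreal ?d"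
    proof -
      have "measure ?S (?T -` A \<inter> space path_space) \<le> measure brownian_law (?T -` A \<inter> space path_space) + ?d"
      proof (rule brownian_law_shift_le[OF _ e0 _ TA])
        show "norm (h t - h s) \<le> e * (t - s)" if "0 \<le> s" "s \<le> t" "t \<le> 1" for s t
          unfolding h_def by (rule drift_sub_Lipschitz[OF f e that])
      qed (simp add: h_def)
      then show ?thesis
        using e0 unfolding S.emeasure_eq_measure B.emeasure_eq_measure
        by (simp add: ennreal_plus[symmetric] ennreal_leI del: ennreal_plus)
    qed
    also have "emeasure brownian_law (?T -` A \<inter> space path_space) = emeasure (?D f2 \<tau>) A"
      using A by (subst emeasure_distr) (auto simp: sets_eq_imp_space_eq[OF sets_brownian_law])
    finally show ?thesis .
  qed
  have mD: "(\<lambda>\<tau>. emeasure (?D f2 \<tau>) A) \<in> borel_measurable g"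
    using f(2) A by (intro circle_probsD(4)[OF g] measurable_emeasure_drift) auto
  have "emeasure (shape_law f1 g) A \<le> (\<integral>\<^sup>+\<tau>. emeasure (?D f2 \<tau>) A + ennreal ?d \<partial>g)"
    unfolding emeasure_shape_law[OF f(1) g A] using le by (intro nn_integral_mono) auto
  also have "\<dots> = emeasure (shape_law f2 g) A + ennreal ?d"
    unfolding emeasure_shape_law[OF f(2) g A] using mD
    by (subst nn_integral_add) (auto simp: g.emeasure_space_1)
  finally show ?thesis .
qed

section \<open>Total variation of product measures\<close>

text \<open>
  Layer cake: a function with values in [0,1] is an average of indicators of its superlevel sets.
\<close>

lemma nn_integral_le_add_from_sets:
  assumes M: "prob_space M" and N: "prob_space N" and s: "sets N = sets M"
    and le: "\<And>A. A \<in> sets M \<Longrightarrow> emeasure M A \<le> emeasure N A + d"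
    and \<phi> [measurable]: "\<phi> \<in> borel_measurable M" and \<phi>1: "\<And>x. \<phi> x \<le> 1"
  shows "(\<integral>\<^sup>+x. \<phi> x \<partial>M) \<le> (\<integral>\<^sup>+x. \<phi> x \<partial>N) + d"
proof -
  define E where "E = (\<lambda>t::real. {x\<in>space M. t < enn2real (\<phi> x)})"
  have cake: "(\<integral>\<^sup>+x. \<phi> x \<partial>K) = (\<integral>\<^sup>+t. emeasure K (E t) * indicator {0..1} t \<partial>lborel)"
    (is "_ = ?R") and mE: "(\<lambda>t. emeasure K (E t)) \<in> borel_measurable borel"
    if "prob_space K" and sK: "sets K = sets M" for K
  proof -
    interpret K: prob_space K by fact
    interpret P: pair_sigma_finite K lborel ..
    have [measurable]: "\<phi> \<in> borel_measurable K" using \<phi> by (subst measurable_cong_sets[OF sK refl])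
    have sp: "space K = space M" using sK by (rule sets_eq_imp_space_eq)
    have E[measurable]: "E t \<in> sets K" for t unfolding E_def sp[symmetric] by measurable
    have "\<phi> x = (\<integral>\<^sup>+t. indicator (E t) x * indicator {0..1} t \<partial>lborel)" if x: "x \<in> space K" for x
    proof -
      have f: "\<phi> x = ennreal (enn2real (\<phi> x))" using \<phi>1[of x] by (auto simp: ennreal_enn2real_if top_unique)
      have l: "enn2real (\<phi> x) \<le> 1" using \<phi>1[of x] by (simp add: enn2real_leI)
      have "(\<integral>\<^sup>+t. indicator (E t) x * indicator {0..1} t \<partial>lborel) = (\<integral>\<^sup>+t. indicator {0..<enn2real (\<phi> x)} t \<partial>lborel)"
        using x l by (intro nn_integral_cong) (auto simp: E_def sp indicator_def)
      also have "\<dots> = ennreal (enn2real (\<phi> x))" by simp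
      finally show ?thesis using f by simp
    qed
    then have "(\<integral>\<^sup>+x. \<phi> x \<partial>K) = (\<integral>\<^sup>+x. \<integral>\<^sup>+t. indicator (E t) x * indicator {0..1} t \<partial>lborel \<partial>K)"
      by (intro nn_integral_cong) 
    also have "\<dots> = (\<integral>\<^sup>+t. \<integral>\<^sup>+x. indicator (E t) x * indicator {0..1} t \<partial>K \<partial>lborel)"
      unfolding E_def sp[symmetric] by (intro P.Fubini'[symmetric]) measurable
    also have "\<dots> = ?R"
      by (intro nn_integral_cong) (simp add: nn_integral_multc E)
    finally show "(\<integral>\<^sup>+x. \<phi> x \<partial>K) = ?R" .
    have "(\<lambda>t. \<integral>\<^sup>+x. indicator (E t) x \<partial>K) \<in> borel_measurable borel"
      unfolding E_def sp[symmetric] by measurable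
    then show "(\<lambda>t. emeasure K (E t)) \<in> borel_measurable borel" by (simp add: E)
  qed
  have [measurable]: "(\<lambda>t. emeasure N (E t)) \<in> borel_measurable borel" by (rule mE[OF N s])
  have "(\<integral>\<^sup>+x. \<phi> x \<partial>M) \<le> (\<integral>\<^sup>+t. (emeasure N (E t) * indicator {0..1} t + d * indicator {0..1} t) \<partial>lborel)"
    unfolding cake[OF M refl] using le[of "E _"]
    by (intro nn_integral_mono) (auto simp: indicator_def E_def)
  also have "\<dots> = (\<integral>\<^sup>+t. emeasure N (E t) * indicator {0..1} t \<partial>lborel) + d"
    by (subst nn_integral_add) (auto simp: nn_integral_cmult)
  also have "\<dots> = (\<integral>\<^sup>+x. \<phi> x \<partial>N) + d" unfolding cake[OF N s] ..
  finally show ?thesis .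
qed

text \<open>
  Hybrid argument: replacing the factors one at a time costs \<open>d\<close> each. Replacing the remaining
  \<open>n\<close> factors concerns the integral of a conditional probability, not of an indicator, which is
  why the bound on sets has to be extended to functions.
\<close>

lemma emeasure_PiM_le_add:
  fixes n :: nat and d :: real
  assumes M: "prob_space M" and N: "prob_space N" and s: "sets N = sets M"
    and le: "\<And>A. A \<in> sets M \<Longrightarrow> emeasure M A \<le> emeasure N A + ennreal d" and d: "d \<ge> 0"
    and A: "A \<in> sets (PiM {..<n} (\<lambda>_. M))"
  shows "emeasure (PiM {..<n} (\<lambda>_. M)) A \<le> emeasure (PiM {..<n} (\<lambda>_. N)) A + ennreal (n * d)"
  using A
proof (induction n arbitrary: A)
  case 0
  then show ?case by (simp add: PiM_empty)
next
  case (Suc n)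
  interpret M: prob_space M by fact
  interpret N: prob_space N by fact
  interpret PM: product_prob_space "\<lambda>_::nat. M" "UNIV" ..
  interpret PN: product_prob_space "\<lambda>_::nat. N" "UNIV" ..
  let ?M = "\<lambda>I. PiM I (\<lambda>_::nat. M)" and ?N = "\<lambda>I. PiM I (\<lambda>_::nat. N)"
  interpret Mn: prob_space "?M {..<n}" by (intro prob_space_PiM M)
  interpret Nn: prob_space "?N {..<n}" by (intro prob_space_PiM N)
  have sP: "sets (?N I) = sets (?M I)" for I using s by (intro sets_PiM_cong) auto
  have ins: "{..<Suc n} = insert n {..<n}" by auto
  have A [measurable]: "A \<in> sets (?M (insert n {..<n}))" using Suc.prems by (simp add: ins)
  have A' [measurable]: "A \<in> sets (?N (insert n {..<n}))" using A by (simp add: sP)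
  define \<phi> where "\<phi> x = (\<integral>\<^sup>+y. indicator A (x(n := y)) \<partial>N)" for x
  have [measurable]: "\<phi> \<in> borel_measurable (?N {..<n})" unfolding \<phi>_def by measurable
  then have \<phi>M [measurable]: "\<phi> \<in> borel_measurable (?M {..<n})" by (subst measurable_cong_sets[OF sP[symmetric] refl])
  have \<phi>1: "\<phi> x \<le> 1" for x
    unfolding \<phi>_def using nn_integral_mono[of N "\<lambda>y. indicator A (x(n := y))" "\<lambda>_. 1"]
    by (simp add: N.emeasure_space_1 indicator_def)
  have "emeasure (?M {..<Suc n}) A = (\<integral>\<^sup>+x. \<integral>\<^sup>+y. indicator A (x(n := y)) \<partial>M \<partial>?M {..<n})"
    unfolding ins using PM.product_nn_integral_insert[of "{..<n}" n "indicator A"] A by simp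
  also have "\<dots> \<le> (\<integral>\<^sup>+x. \<phi> x + ennreal d \<partial>?M {..<n})"
    unfolding \<phi>_def
    by (intro nn_integral_mono nn_integral_le_add_from_sets[OF M N s le]) (auto simp: indicator_def)
  also have "\<dots> = (\<integral>\<^sup>+x. \<phi> x \<partial>?M {..<n}) + ennreal d"
    by (subst nn_integral_add) (auto simp: Mn.emeasure_space_1)
  also have "(\<integral>\<^sup>+x. \<phi> x \<partial>?M {..<n}) \<le> (\<integral>\<^sup>+x. \<phi> x \<partial>?N {..<n}) + ennreal (n * d)"
    using Suc.IH by (intro nn_integral_le_add_from_sets[OF Mn.prob_space_axioms Nn.prob_space_axioms sP _ \<phi>M \<phi>1])
  also have "(\<integral>\<^sup>+x. \<phi> x \<partial>?N {..<n}) = emeasure (?N {..<Suc n}) A"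
    unfolding ins \<phi>_def using PN.product_nn_integral_insert[of "{..<n}" n "indicator A"] A' by simp
  finally have le: "emeasure (?M {..<Suc n}) A \<le> emeasure (?N {..<Suc n}) A + ennreal (n * d) + ennreal d"
    by (simp add: add_right_mono)
  have "ennreal (real (Suc n) * d) = ennreal (n * d) + ennreal d"
    using d by (simp add: distrib_right add.commute)
  then show ?case using le by (simp add: add.assoc)
qed

section \<open>The two-point method with a Fourier coefficient as separating functional\<close>

lemma measurable_cis [measurable]: "cis \<in> borel_measurable borel"
  by (intro borel_measurable_continuous_onI continuous_intros)

text \<open>
  A Fourier coefficient is 1-Lipschitz for the \<open>L\<^sup>2\<close> distance. It is therefore measurable
  for \<open>l2_borel\<close>, and a gap between Fourier coefficients bounds the distance from below.
\<close>

lemma norm_fourier_coeff_diff_le: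
  assumes x: "integrable circle x" and y: "integrable circle y"
  shows "ennreal ((norm (fourier_coeff l x - fourier_coeff l y))\<^sup>2) \<le> l2_dist_sq x y"
proof (cases "l2_dist_sq x y < \<infinity>")
  case True
  interpret prob_space circle by (rule prob_space_circle)
  define X where "X t = norm (x t - y t)" for t
  have iX: "integrable circle X" unfolding X_def using x y by auto
  have [measurable]: "X \<in> borel_measurable circle" using iX by (rule borel_measurable_integrable)
  have mX2: "(\<lambda>t. (X t)\<^sup>2) \<in> borel_measurable circle" by measurable
  have iX2: "integrable circle (\<lambda>t. (X t)\<^sup>2)"
    using True by (intro integrableI_nonneg[OF mX2]) (auto simp: l2_dist_sq_def X_def)
  have c: "integrable circle (\<lambda>t. cis (- 2 * pi * real_of_int l * t) * z t)" if "integrable circle z" for z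
  proof (rule Bochner_Integration.integrable_bound[OF that])
    have "(\<lambda>t. cis (- 2 * pi * real_of_int l * t)) \<in> borel_measurable circle"
      by (rule measurable_circle_borel) measurable
    then show "(\<lambda>t. cis (- 2 * pi * real_of_int l * t) * z t) \<in> borel_measurable circle"
      using borel_measurable_integrable[OF that] by (rule borel_measurable_times)
  qed (simp add: norm_mult)
  have "fourier_coeff l x - fourier_coeff l y = (LINT t|circle. cis (- 2 * pi * real_of_int l * t) * (x t - y t))"
    unfolding fourier_coeff_def using c[OF x] c[OF y]
    by (subst Bochner_Integration.integral_diff[symmetric]) (auto simp: algebra_simps)
  also have "norm \<dots> \<le> (LINT t|circle. norm (cis (- 2 * pi * real_of_int l * t) * (x t - y t)))"
    by (rule integral_norm_bound)
  also have "\<dots> = expectation X" by (simp add: norm_mult X_def[abs_def])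
  finally have "(norm (fourier_coeff l x - fourier_coeff l y))\<^sup>2 \<le> (expectation X)\<^sup>2"
    by (intro power_mono) auto
  also have "\<dots> \<le> expectation (\<lambda>t. (X t)\<^sup>2)"
    using variance_eq[OF iX iX2] variance_positive[of X] by simp
  finally show ?thesis
    using iX2 unfolding l2_dist_sq_def X_def[symmetric]
    by (subst nn_integral_eq_integral) (auto intro: ennreal_leI)
qed (simp add: less_top[symmetric])

text \<open>
  If \<open>g\<close> has no density with respect to \<open>circle\<close>, then \<open>RN_deriv\<close> is 0
  by convention, so the claim holds for singular \<open>g\<close> too.
\<close>

lemma integrable_prob_density:
  assumes g: "g \<in> circle_probs" shows "integrable circle (prob_density g)"
proof -
  interpret g: prob_space g by (rule circle_probsD[OF g])
  have "(\<integral>\<^sup>+t. RN_deriv circle g t \<partial>circle) < \<infinity>"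
  proof (cases "\<exists>f. f \<in> borel_measurable circle \<and> density circle f = g")
    case True
    have "density circle (RN_deriv circle g) = g"
      unfolding RN_deriv_def using someI_ex[OF True] True by simp
    then have "emeasure g (space circle) = (\<integral>\<^sup>+t. RN_deriv circle g t * indicator (space circle) t \<partial>circle)"
      using emeasure_density[of "RN_deriv circle g" circle "space circle", OF _ sets.top] by simp
    also have "\<dots> = (\<integral>\<^sup>+t. RN_deriv circle g t \<partial>circle)"
      by (intro nn_integral_cong) auto
    finally have "(\<integral>\<^sup>+t. RN_deriv circle g t \<partial>circle) = emeasure g (space circle)" ..
    then show ?thesis using g.emeasure_space_1 circle_probsD(3)[OF g] by simp
  next
    case False
    then have "RN_deriv circle g = (\<lambda>_. 0)" unfolding RN_deriv_def by (rule if_not_P)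
    then show ?thesis by simp
  qed
  then have "(\<integral>\<^sup>+t. ennreal (norm (prob_density g t)) \<partial>circle) < \<infinity>"
    by (rule le_less_trans[rotated])
       (auto simp: prob_density_def intro!: nn_integral_mono ennreal_enn2real_if[THEN eq_refl] simp: ennreal_enn2real_if)
  moreover have "prob_density g \<in> borel_measurable circle" unfolding prob_density_def[abs_def] by measurable
  ultimately show ?thesis by (rule integrableI_bounded[rotated])
qed

text \<open>
  Le Cam's two-point argument. The event that the estimate has a positive real part in its \<open>l\<close>-th
  coefficient is a test between \<open>a\<close> and \<open>b\<close>; where the test errs, the estimate is at
  distance at least \<open>r\<close> from the truth. As the laws differ by at most 1/2 in total variation, one
  of the two error probabilities is at least 1/4.
\<close>

lemma two_point_lower_bound:
  assumes T: "T \<in> P \<rightarrow>\<^sub>M l2_borel S e" and P: "prob_space P" and Q: "prob_space Q" and s: "sets Q = sets P"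
    and close: "\<And>A. A \<in> sets P \<Longrightarrow> emeasure P A \<le> emeasure Q A + ennreal (1 / 2)"
    and iS: "\<And>x. x \<in> S \<Longrightarrow> integrable circle (e x)" and ia: "integrable circle a" and ib: "integrable circle b"
    and ra: "Re (fourier_coeff l a) \<ge> r" and rb: "Re (fourier_coeff l b) \<le> - r" and r: "r \<ge> 0"
  shows "ennreal (r\<^sup>2 / 4) \<le> max (\<integral>\<^sup>+y. l2_dist_sq (e (T y)) a \<partial>P) (\<integral>\<^sup>+y. l2_dist_sq (e (T y)) b \<partial>Q)"
proof -
  interpret P: prob_space P by fact
  interpret Q: prob_space Q by fact
  define U where "U = {x\<in>S. Re (fourier_coeff l (e x)) > 0}"
  have "\<exists>q>0. \<forall>y\<in>S. l2_dist_sq (e y) (e x) < ennreal q \<longrightarrow> y \<in> U" if x: "x \<in> U" for x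
  proof (intro exI conjI ballI impI)
    let ?q = "Re (fourier_coeff l (e x))"
    show q: "?q\<^sup>2 > 0" using x by (simp add: U_def)
    fix y assume y: "y \<in> S" "l2_dist_sq (e y) (e x) < ennreal (?q\<^sup>2)"
    then have "ennreal ((norm (fourier_coeff l (e y) - fourier_coeff l (e x)))\<^sup>2) < ennreal (?q\<^sup>2)"
      using x by (intro le_less_trans[OF norm_fourier_coeff_diff_le] iS) (auto simp: U_def)
    then have "norm (fourier_coeff l (e y) - fourier_coeff l (e x)) < ?q"
      using x by (auto simp: ennreal_less_iff U_def intro: power_less_imp_less_base)
    then show "y \<in> U"
      using y abs_Re_le_cmod[of "fourier_coeff l (e y) - fourier_coeff l (e x)"] by (auto simp: U_def)
  qed
  then have "U \<in> sets (l2_borel S e)"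
    unfolding l2_borel_def by (subst sets_measure_of) (auto simp: U_def)
  then have B: "T -` U \<inter> space P \<in> sets P" using T by (rule measurable_sets[rotated])
  define B where "B = T -` U \<inter> space P"
  have BP [measurable]: "B \<in> sets P" and BQ [measurable]: "B \<in> sets Q" using B s by (auto simp: B_def)
  have sp: "space Q = space P" using s by (rule sets_eq_imp_space_eq)
  have TS: "T y \<in> S" if "y \<in> space P" for y
    using measurable_space[OF T that] by (simp add: l2_borel_def space_measure_of_conv)
  have sep: "ennreal (r\<^sup>2) \<le> l2_dist_sq (e x) c"
    if "x \<in> S" "integrable circle c" "r \<le> \<bar>Re (fourier_coeff l (e x) - fourier_coeff l c)\<bar>" for x c
  proof -
    have "r \<le> norm (fourier_coeff l (e x) - fourier_coeff l c)"
      using that(3) abs_Re_le_cmod order_trans by blast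
    then have "ennreal (r\<^sup>2) \<le> ennreal ((norm (fourier_coeff l (e x) - fourier_coeff l c))\<^sup>2)"
      using r by (intro ennreal_leI power_mono) auto
    also have "\<dots> \<le> l2_dist_sq (e x) c" using that by (intro norm_fourier_coeff_diff_le iS)
    finally show ?thesis .
  qed
  have "(\<integral>\<^sup>+y. ennreal (r\<^sup>2) * indicator (space P - B) y \<partial>P) \<le> (\<integral>\<^sup>+y. l2_dist_sq (e (T y)) a \<partial>P)"
    using TS ra by (intro nn_integral_mono) (auto simp: indicator_def B_def U_def intro!: sep ia)
  then have 1: "ennreal (r\<^sup>2) * emeasure P (space P - B) \<le> (\<integral>\<^sup>+y. l2_dist_sq (e (T y)) a \<partial>P)"
    by (simp add: nn_integral_cmult_indicator)
  have "(\<integral>\<^sup>+y. ennreal (r\<^sup>2) * indicator B y \<partial>Q) \<le> (\<integral>\<^sup>+y. l2_dist_sq (e (T y)) b \<partial>Q)"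
    using TS rb by (intro nn_integral_mono) (auto simp: sp indicator_def B_def U_def intro!: sep ib)
  then have 2: "ennreal (r\<^sup>2) * emeasure Q B \<le> (\<integral>\<^sup>+y. l2_dist_sq (e (T y)) b \<partial>Q)"
    by (simp add: nn_integral_cmult_indicator)
  have "ennreal (Q.prob B) + ennreal (1 / 2) = ennreal (Q.prob B + 1 / 2)"
    by (rule ennreal_plus[symmetric]) auto
  from close[OF BP, unfolded P.emeasure_eq_measure Q.emeasure_eq_measure this]
  have "P.prob B \<le> Q.prob B + 1 / 2" by (subst (asm) ennreal_le_iff) auto
  then have "1 / 4 \<le> P.prob (space P - B) \<or> 1 / 4 \<le> Q.prob B" using P.prob_compl[OF BP] by auto
  then show ?thesis
  proof
    assume "1 / 4 \<le> P.prob (space P - B)"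
    then have "r\<^sup>2 * (1 / 4) \<le> r\<^sup>2 * P.prob (space P - B)" by (intro mult_left_mono) auto
    then have "ennreal (r\<^sup>2 / 4) \<le> ennreal (r\<^sup>2) * emeasure P (space P - B)"
      by (simp add: P.emeasure_eq_measure ennreal_mult'[symmetric] ennreal_leI)
    then show ?thesis using 1 by (auto simp: max.coboundedI1)
  next
    assume "1 / 4 \<le> Q.prob B"
    then have "r\<^sup>2 * (1 / 4) \<le> r\<^sup>2 * Q.prob B" by (intro mult_left_mono) auto
    then have "ennreal (r\<^sup>2 / 4) \<le> ennreal (r\<^sup>2) * emeasure Q B"
      by (simp add: Q.emeasure_eq_measure ennreal_mult'[symmetric] ennreal_leI)
    then show ?thesis using 2 by (auto simp: max.coboundedI2)
  qed
qed

section \<open>Trigonometric shapes and densities\<close>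

lemma integral_circle:
  fixes h :: "real \<Rightarrow> 'a::{banach, second_countable_topology}"
  assumes [measurable]: "h \<in> borel_measurable borel"
  shows "(LINT t|circle. h t) = (LINT t:{0..1}|lborel. h t)"
proof -
  have "(LINT t|circle. h t) = (LINT t:{0..<1}|lborel. h t)"
    unfolding circle_def set_lebesgue_integral_def by (subst integral_restrict_space) auto
  also have "\<dots> = (LINT t:{0..1}|lborel. h t)"
    unfolding set_lebesgue_integral_def
  proof (rule integral_cong_AE)
    show "AE t in lborel. indicat_real {0..<1} t *\<^sub>R h t = indicat_real {0..1} t *\<^sub>R h t"
      using AE_lborel_singleton[of "1::real"] by eventually_elim (auto simp: indicator_def)
  qed auto
  finally show ?thesis .
qed

lemma integral_cis_circle:
  "(LINT t|circle. cis (2 * pi * real_of_int m * t)) = (if m = 0 then 1 else 0)"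
proof (cases "m = 0")
  case True
  interpret prob_space circle by (rule prob_space_circle)
  show ?thesis using True by (simp add: prob_space[simplified])
next
  case False
  let ?c = "2 * pi * real_of_int m"
  have "(LINT t|circle. cis (?c * t)) = (\<integral>t. indicator {0..1} t *\<^sub>R cis (?c * t) \<partial>lborel)"
    by (subst integral_circle) (auto simp: set_lebesgue_integral_def)
  also have "\<dots> = cis (?c * 1) / (\<i> * ?c) - cis (?c * 0) / (\<i> * ?c)"
  proof (rule integral_FTC_atLeastAtMost)
    fix x :: real
    have "((\<lambda>t. cis (?c * t)) has_vector_derivative (?c *\<^sub>R (\<i> * cis (?c * x)))) (at x within {0..1})"
      unfolding has_vector_derivative_def
      by (auto intro!: derivative_eq_intros simp: scaleR_conv_of_real)
    then have "((\<lambda>t. cis (?c * t) / (\<i> * ?c)) has_vector_derivative (?c *\<^sub>R (\<i> * cis (?c * x))) / (\<i> * ?c)) (at x within {0..1})"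
      by (rule has_vector_derivative_divide)
    then show "((\<lambda>t. cis (?c * t) / (\<i> * ?c)) has_vector_derivative cis (?c * x)) (at x within {0..1})"
      using False by (simp add: scaleR_conv_of_real field_simps)
  qed (auto intro!: continuous_intros)
  also have "\<dots> = 0" using cis_multiple_2pi[of "of_int m"] by (simp add: mult_ac)
  finally show ?thesis using False by simp
qed

text \<open>
  The mode \<open>e\<^sub>1\<close> carries the positive first coefficient that \<open>shape_class\<close>
  demands, and \<open>b\<close> is the coefficient of the mode \<open>e\<^sub>-\<^sub>1\<close>.
\<close>

definition two_mode :: "real \<Rightarrow> complex \<Rightarrow> real \<Rightarrow> complex" where
  "two_mode a b t = of_real a * cis (2 * pi * t) + b * cis (- (2 * pi * t))"

lemma cis_add_2pi: "cis (x + 2 * pi) = cis x" "cis (x - 2 * pi) = cis x"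
  by (simp_all add: cis_mult[symmetric] cis_divide[symmetric])

lemma integrable_circle_bounded:
  fixes h :: "real \<Rightarrow> 'a::{banach, second_countable_topology}"
  assumes "h \<in> borel_measurable borel" "\<And>t. norm (h t) \<le> C"
  shows "integrable circle h"
proof -
  interpret prob_space circle by (rule prob_space_circle)
  show ?thesis using assms by (intro integrable_const_bound[of _ C] measurable_circle_borel) auto
qed

lemma two_mode_circle_L2: "two_mode a b \<in> circle_L2"
proof -
  have [measurable]: "two_mode a b \<in> borel_measurable borel"
    unfolding two_mode_def by (intro borel_measurable_continuous_onI continuous_intros)
  have n: "norm (two_mode a b t) \<le> \<bar>a\<bar> + norm b" for t
    unfolding two_mode_def by (rule norm_triangle_le) (simp add: norm_mult)
  have "two_mode a b (x + 1) = two_mode a b x" for x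
  proof -
    have "2 * pi * (x + 1) = 2 * pi * x + 2 * pi" "- (2 * pi * x + 2 * pi) = - (2 * pi * x) - 2 * pi"
      by (simp_all add: algebra_simps)
    then show ?thesis by (simp only: two_mode_def cis_add_2pi)
  qed
  moreover have "integrable circle (\<lambda>t. (norm (two_mode a b t))\<^sup>2)"
    using n by (intro integrable_circle_bounded[of _ "(\<bar>a\<bar> + norm b)\<^sup>2"]) (auto intro!: power_mono)
  ultimately show ?thesis by (simp add: circle_L2_def)
qed

lemma fourier_coeff_two_mode:
  "fourier_coeff l (two_mode a b) = (if l = 1 then of_real a else 0) + (if l = -1 then b else 0)"
proof -
  have eq: "cis (- 2 * pi * real_of_int l * t) * two_mode a b t =
     of_real a * cis (2 * pi * real_of_int (1 - l) * t) + b * cis (2 * pi * real_of_int (- 1 - l) * t)" for t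
    by (simp add: two_mode_def distrib_left mult.left_commute[of "cis _"] cis_mult algebra_simps)
  have i: "integrable circle (\<lambda>t. cis (c * t))" for c
    by (rule integrable_circle_bounded[of _ 1]) auto
  show ?thesis
    unfolding fourier_coeff_def eq using i
    by (subst Bochner_Integration.integral_add) (auto simp: integral_cis_circle simp del: of_int_diff of_int_minus)
qed

lemma two_mode_shape_class:
  assumes "a > 0" shows "two_mode a b \<in> shape_class s"
proof -
  have "(\<lambda>l::int. (1 + real_of_int \<bar>l\<bar> powr (2 * s)) * (norm (fourier_coeff l (two_mode a b)))\<^sup>2) summable_on UNIV"
  proof (rule finite_nonzero_values_imp_summable_on)
    show "finite {l \<in> UNIV. (1 + real_of_int \<bar>l\<bar> powr (2 * s)) * (norm (fourier_coeff l (two_mode a b)))\<^sup>2 \<noteq> 0}"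
      by (rule finite_subset[of _ "{1, -1}"]) (auto simp: fourier_coeff_two_mode split: if_splits)
  qed
  then show ?thesis using assms two_mode_circle_L2 by (simp add: shape_class_def fourier_coeff_two_mode)
qed

text \<open>
  The simplest family of smooth shift distributions whose first Fourier coefficient \<open>c / 2\<close> can
  have either sign; \<open>c = 0\<close> gives the uniform distribution.
\<close>

definition cosine_prob :: "real \<Rightarrow> real measure" where
  "cosine_prob c = density circle (\<lambda>t. ennreal (1 + c * cos (2 * pi * t)))"

lemma
  assumes c: "\<bar>c\<bar> \<le> 1"
  shows cosine_prob_circle_probs: "cosine_prob c \<in> circle_probs"
    and fourier_coeff_cosine_prob: "fourier_coeff_measure k (cosine_prob c) =
      (if k = 0 then 1 else if k = 1 \<or> k = -1 then of_real (c / 2) else 0)" (is "?F k = ?R k")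
    and fourier_coeff_density_cosine_prob: "fourier_coeff 1 (prob_density (cosine_prob c)) = of_real (c / 2)"
proof -
  define p where "p t = 1 + c * cos (2 * pi * t)" for t
  interpret C: prob_space circle by (rule prob_space_circle)
  have [measurable]: "p \<in> borel_measurable borel"
    unfolding p_def by (intro borel_measurable_continuous_onI continuous_intros)
  have pc [measurable]: "p \<in> borel_measurable circle" by (rule measurable_circle_borel) measurable
  have "\<bar>c * cos (2 * pi * t)\<bar> \<le> 1" for t
    using mult_mono[OF c abs_cos_le_one, of "2 * pi * t"] by (simp add: abs_mult)
  then have p0: "0 \<le> p t" and p2: "p t \<le> 2" for t unfolding p_def by (smt (verit))+
  have G: "cosine_prob c = density circle (\<lambda>t. ennreal (p t))" by (simp add: cosine_prob_def p_def)
  have i: "integrable circle (\<lambda>t. cis (c * t))" for c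
    by (rule integrable_circle_bounded[of _ 1]) auto
  have fp: "fourier_coeff k (\<lambda>t. of_real (p t)) = ?R k" for k
  proof -
    have eq: "cis (- 2 * pi * real_of_int k * t) * of_real (p t) = cis (2 * pi * real_of_int (- k) * t)
      + of_real (c / 2) * cis (2 * pi * real_of_int (1 - k) * t) + of_real (c / 2) * cis (2 * pi * real_of_int (- 1 - k) * t)" for t
    proof -
      have "of_real (p t) = 1 + of_real (c / 2) * cis (2 * pi * t) + of_real (c / 2) * cis (- (2 * pi * t))"
        by (simp add: p_def complex_eq_iff)
      then show ?thesis
        by (simp add: distrib_left mult.left_commute[of "cis _"] cis_mult algebra_simps)
    qed
    show ?thesis
      unfolding fourier_coeff_def eq using i
      by (simp add: integral_cis_circle del: of_int_diff of_int_minus)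
  qed
  have "(LINT t|circle. p t) = 1"
  proof -
    have "complex_of_real (LINT t|circle. p t) = fourier_coeff 0 (\<lambda>t. of_real (p t))"
      by (simp add: fourier_coeff_def)
    then show ?thesis using fp[of 0] by simp
  qed
  moreover have ip: "integrable circle p" using p0 p2 by (intro integrable_circle_bounded[of _ 2]) auto
  ultimately have 1: "(\<integral>\<^sup>+t. ennreal (p t) \<partial>circle) = 1"
    using p0 by (subst nn_integral_eq_integral) auto
  have "emeasure (cosine_prob c) (space circle) = (\<integral>\<^sup>+t. ennreal (p t) * indicator (space circle) t \<partial>circle)"
    unfolding G by (rule emeasure_density[OF _ sets.top]) measurable
  also have "\<dots> = (\<integral>\<^sup>+t. ennreal (p t) \<partial>circle)" by (intro nn_integral_cong) auto
  finally have "emeasure (cosine_prob c) (space (cosine_prob c)) = 1"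
    using 1 by (simp add: G)
  then show probs: "cosine_prob c \<in> circle_probs"
    by (auto simp: circle_probs_def G intro: prob_spaceI)
  have "?F k = fourier_coeff k (\<lambda>t. of_real (p t))"
    unfolding fourier_coeff_measure_def fourier_coeff_def G
  proof (subst integral_density)
    show "(\<lambda>t. cis (- 2 * pi * real_of_int k * t)) \<in> borel_measurable circle"
      by (rule measurable_circle_borel) measurable
  qed (use p0 in \<open>auto simp: scaleR_conv_of_real mult.commute\<close>)
  then show "?F k = ?R k" by (simp only: fp)
  have "AE t in circle. ennreal (p t) = RN_deriv circle (cosine_prob c) t"
    by (rule C.RN_deriv_unique) (auto simp: G)
  then have "AE t in circle. prob_density (cosine_prob c) t = of_real (p t)"
    by eventually_elim (use p0 in \<open>auto simp: prob_density_def dest: sym\<close>)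
  moreover have "prob_density (cosine_prob c) \<in> borel_measurable circle"
    using integrable_prob_density[OF probs] by (rule borel_measurable_integrable)
  ultimately have "fourier_coeff 1 (prob_density (cosine_prob c)) = fourier_coeff 1 (\<lambda>t. of_real (p t))"
    unfolding fourier_coeff_def
  proof (intro integral_cong_AE)
    have c: "(\<lambda>t. cis (- 2 * pi * real_of_int 1 * t)) \<in> borel_measurable circle"
      by (rule measurable_circle_borel) measurable
    show "(\<lambda>t. cis (- 2 * pi * real_of_int 1 * t) * complex_of_real (p t)) \<in> borel_measurable circle"
      by (rule measurable_circle_borel) measurable
    show "(\<lambda>t. cis (- 2 * pi * real_of_int 1 * t) * prob_density (cosine_prob c) t) \<in> borel_measurable circle"
      if "prob_density (cosine_prob c) \<in> borel_measurable circle"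
      using c that by (rule borel_measurable_times)
  qed auto
  then show "fourier_coeff 1 (prob_density (cosine_prob c)) = of_real (c / 2)" by (simp add: fp)
qed

lemma cosine_prob_smooth:
  assumes c: "\<bar>c\<bar> \<le> 1" and cA: "c\<^sup>2 / 2 < A\<^sup>2"
  shows "cosine_prob c \<in> probs_smooth \<nu> A"
proof -
  let ?h = "\<lambda>k::int. real_of_int \<bar>k\<bar> powr (2 * \<nu>) * (norm (fourier_coeff_measure k (cosine_prob c)))\<^sup>2"
  have h: "?h k = (if k = 1 \<or> k = -1 then (c / 2)\<^sup>2 else 0)" for k
    by (auto simp: fourier_coeff_cosine_prob[OF c] power_divide)
  have "?h summable_on UNIV"
    unfolding h by (rule finite_nonzero_values_imp_summable_on) (rule finite_subset[of _ "{1, -1}"], auto)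
  moreover have "infsum ?h UNIV = infsum ?h {1, -1}"
    unfolding h by (rule infsum_cong_neutral) auto
  then have "infsum ?h UNIV = c\<^sup>2 / 2" unfolding h by (simp add: power2_eq_square)
  ultimately show ?thesis
    using cA cosine_prob_circle_probs[OF c] by (simp add: probs_smooth_def)
qed

section \<open>Indistinguishable pairs and the lower bounds\<close>

lemma shape_law_cong_emeasure:
  assumes "\<And>A. A \<in> sets path_space \<Longrightarrow> emeasure (shape_law f g) A = emeasure (shape_law f' g') A"
  shows "shape_law f g = shape_law f' g'"
  using assms by (intro measure_eqI) auto

text \<open>
  Shifting the zero function has no effect.
\<close>

lemma shape_law_zero:
  assumes "g \<in> circle_probs" "g' \<in> circle_probs"
  shows "shape_law (two_mode 0 0) g = shape_law (two_mode 0 0) g'"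
proof (rule shape_law_cong_emeasure)
  fix A assume A: "A \<in> sets path_space"
  interpret g: prob_space g by (rule circle_probsD[OF assms(1)])
  interpret g': prob_space g' by (rule circle_probsD[OF assms(2)])
  have "drift (two_mode 0 0) \<tau> x = 0" for \<tau> x by (simp add: drift_def two_mode_def set_lebesgue_integral_def)
  then show "emeasure (shape_law (two_mode 0 0) g) A = emeasure (shape_law (two_mode 0 0) g') A"
    using assms A by (simp add: emeasure_shape_law two_mode_circle_L2 g.emeasure_space_1 g'.emeasure_space_1)
qed

text \<open>
  Shifting the mode \<open>e\<^sub>-\<^sub>1\<close> by half a period changes its sign, and the uniform
  distribution is invariant under this shift.
\<close>

lemma shape_law_sign_uniform:
  "shape_law (two_mode 0 (- b)) circle = shape_law (two_mode 0 b) circle"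
proof (rule shape_law_cong_emeasure)
  fix A assume A: "A \<in> sets path_space"
  have U: "circle \<in> circle_probs" by (simp add: circle_probs_def prob_space_circle)
  let ?D = "\<lambda>f \<tau>. emeasure (distr brownian_law path_space (\<lambda>w. \<lambda>x\<in>{0..1}. drift f \<tau> x + w x)) A"
  have half: "two_mode 0 (- b) (y - \<tau>) = two_mode 0 b (y - (\<tau> + 1 / 2))" for y \<tau>
  proof -
    have "- (2 * pi * (y - (\<tau> + 1 / 2))) = - (2 * pi * (y - \<tau>)) + pi" by (simp add: algebra_simps)
    then have "cis (- (2 * pi * (y - (\<tau> + 1 / 2)))) = - cis (- (2 * pi * (y - \<tau>)))"
      by (simp only: cis_mult[symmetric] cis_pi) simp
    then show ?thesis by (simp only: two_mode_def) simp
  qed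
  have per: "two_mode 0 b (y - (\<tau> + 1)) = two_mode 0 b (y - \<tau>)" for y \<tau>
    using two_mode_circle_L2[of 0 b] by (auto simp: circle_L2_def diff_diff_eq2[symmetric] dest!: spec[of _ "y - (\<tau> + 1)"])
  have d: "drift (two_mode 0 (- b)) \<tau> = drift (two_mode 0 b) (\<tau> + 1 / 2)"
    "drift (two_mode 0 b) (\<tau> + 1) = drift (two_mode 0 b) \<tau>" for \<tau>
    by (simp_all only: drift_def half per fun_eq_iff) auto
  have "(\<integral>\<^sup>+\<tau>. ?D (two_mode 0 (- b)) \<tau> \<partial>circle) = (\<integral>\<^sup>+\<tau>. ?D (two_mode 0 b) (\<tau> + 1 / 2) \<partial>circle)"
    by (simp only: d)
  also have "\<dots> = (\<integral>\<^sup>+\<tau>. ?D (two_mode 0 b) \<tau> \<partial>circle)"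
    by (rule nn_integral_circle_shift)
       (use A two_mode_circle_L2 in \<open>auto intro!: measurable_emeasure_drift measurable_circle_L2 simp: d\<close>)
  finally show "emeasure (shape_law (two_mode 0 (- b)) circle) A = emeasure (shape_law (two_mode 0 b) circle) A"
    using A U by (simp add: emeasure_shape_law two_mode_circle_L2)
qed

text \<open>
  If two parameters with vanishing first coefficient give the same law, then adding a sufficiently small
  multiple of \<open>e\<^sub>1\<close>, depending on the sample size, puts the shapes into
  \<open>shape_class\<close> and leaves the laws of the samples hardly distinguishable.
\<close>

lemma sample_laws_close:
  assumes eq: "shape_law (two_mode 0 b) g = shape_law (two_mode 0 b') g'"
    and g: "g \<in> circle_probs" "g' \<in> circle_probs"
  shows "\<exists>a>0. \<forall>A\<in>sets (sample_law n (two_mode a b) g).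
     emeasure (sample_law n (two_mode a b) g) A \<le> emeasure (sample_law n (two_mode a b') g') A + ennreal (1 / 2)"
proof -
  \<comment> \<open>Each observation passes through two perturbations that cost \<open>d\<close> each, so the total cost is \<open>2 n d \<le> 1/2\<close>;
  \<open>a\<close> solves \<open>sqrt (exp (2 * a\<^sup>2) - 1) = d\<close>.\<close>
  define d where "d = 1 / (4 * (real n + 1))"
  define a where "a = sqrt (ln (1 + d\<^sup>2) / 2)"
  have d: "d > 0" by (simp add: d_def)
  then have "ln (1 + d\<^sup>2) > 0" by (intro ln_gt_zero) simp
  then have a: "a > 0" by (simp add: a_def)
  have "exp (2 * a\<^sup>2) = 1 + d\<^sup>2" using \<open>ln (1 + d\<^sup>2) > 0\<close> d by (simp add: a_def add_pos_nonneg)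
  then have da: "sqrt (exp (2 * a\<^sup>2) - 1) = d" using d by simp
  have n: "norm (two_mode x c t - two_mode y c t) \<le> a" if "\<bar>x - y\<bar> = a" for c t x y
  proof -
    have "two_mode x c t - two_mode y c t = of_real (x - y) * cis (2 * pi * t)"
      by (simp add: two_mode_def algebra_simps)
    then show ?thesis using that by (simp add: norm_mult del: of_real_diff)
  qed
  have le: "emeasure (shape_law (two_mode a b) g) A \<le> emeasure (shape_law (two_mode a b') g') A + ennreal (2 * d)"
    if A: "A \<in> sets (shape_law (two_mode a b) g)" for A
  proof -
    have A: "A \<in> sets path_space" using A by simp
    have "emeasure (shape_law (two_mode a b) g) A \<le> emeasure (shape_law (two_mode 0 b) g) A + ennreal d"
      using shape_law_perturb_le[OF two_mode_circle_L2 two_mode_circle_L2 g(1) n A] a by (simp add: da)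
    also have "emeasure (shape_law (two_mode 0 b) g) A \<le> emeasure (shape_law (two_mode a b') g') A + ennreal d"
      using shape_law_perturb_le[OF two_mode_circle_L2 two_mode_circle_L2 g(2) n A] a by (simp add: da eq)
    finally show ?thesis using d by (simp add: add.assoc ennreal_plus[symmetric] del: ennreal_plus)
  qed
  show ?thesis
  proof (intro exI[of _ a] conjI a ballI)
    fix A assume A: "A \<in> sets (sample_law n (two_mode a b) g)"
    have "emeasure (sample_law n (two_mode a b) g) A \<le> emeasure (sample_law n (two_mode a b') g') A + ennreal (n * (2 * d))"
      using A g d unfolding sample_law_def
      by (intro emeasure_PiM_le_add prob_space_shape_law two_mode_circle_L2 le) auto
    also have "\<dots> \<le> emeasure (sample_law n (two_mode a b') g') A + ennreal (1 / 2)"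
      by (intro add_left_mono ennreal_leI) (simp add: d_def field_simps)
    finally show "emeasure (sample_law n (two_mode a b) g) A \<le> emeasure (sample_law n (two_mode a b') g') A + ennreal (1 / 2)" .
  qed
qed

lemma prob_space_sample_law:
  "f \<in> circle_L2 \<Longrightarrow> g \<in> circle_probs \<Longrightarrow> prob_space (sample_law n f g)"
  unfolding sample_law_def by (intro prob_space_PiM prob_space_shape_law)

lemma sets_sample_law: "sets (sample_law n f g) = sets (PiM {..<n} (\<lambda>_. path_space))"
  unfolding sample_law_def by (intro sets_PiM_cong) auto

text \<open>
  The pair of shapes \<open>a e\<^sub>1 \<plusminus> e\<^sub>-\<^sub>1\<close>, observed under uniform shifts.
\<close>

lemma minimax_risk_shape_ge: 
  assumes A: "A > 0"
  shows "ennreal (1 / 4) \<le> minimax_risk_shape n s \<nu> A"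
  unfolding minimax_risk_shape_def
proof (rule INF_greatest)
  fix fh assume "fh \<in> shape_estimators n s"
  then have fh: "fh \<in> sample_law n f g \<rightarrow>\<^sub>M l2_borel (shape_class s) (\<lambda>f. f)" for f g
    unfolding shape_estimators_def by (subst measurable_cong_sets[OF sets_sample_law refl])
  have U: "circle \<in> circle_probs" by (simp add: circle_probs_def prob_space_circle)
  have "cosine_prob 0 = circle" by (simp add: cosine_prob_def density_1)
  then have Us: "circle \<in> probs_smooth \<nu> A" using cosine_prob_smooth[of 0 A \<nu>] A by simp
  obtain a where a: "a > 0" and close: "\<And>X. X \<in> sets (sample_law n (two_mode a 1) circle) \<Longrightarrow>
     emeasure (sample_law n (two_mode a 1) circle) X \<le> emeasure (sample_law n (two_mode a (-1)) circle) X + ennreal (1 / 2)"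
    using sample_laws_close[OF shape_law_sign_uniform[of 1, symmetric] U U] by blast
  let ?R = "\<lambda>f. \<integral>\<^sup>+y. l2_dist_sq (fh y) f \<partial>sample_law n f circle"
  have "ennreal (1\<^sup>2 / 4) \<le> max (?R (two_mode a 1)) (?R (two_mode a (-1)))"
    by (rule two_point_lower_bound[OF fh _ _ _ close, where l = "-1"])
       (auto intro!: prob_space_sample_law two_mode_circle_L2 U integrable_circle_L2
         simp: sets_sample_law fourier_coeff_two_mode shape_class_def)
  also have "\<dots> \<le> (SUP (f, g) \<in> shape_class s \<times> probs_smooth \<nu> A. \<integral>\<^sup>+y. l2_dist_sq (fh y) f \<partial>sample_law n f g)"
    using Us two_mode_shape_class[OF a] 
    by (intro max.boundedI; intro SUP_upper2[of "(two_mode a _, circle)"]) auto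
  finally show "ennreal (1 / 4) \<le> (SUP (f, g) \<in> shape_class s \<times> probs_smooth \<nu> A. \<integral>\<^sup>+y. l2_dist_sq (fh y) f \<partial>sample_law n f g)"
    by simp
qed

text \<open>
  The single shape \<open>a e\<^sub>1\<close> reveals little about the shift when \<open>a\<close> is small.
  The two shift distributions are \<open>1 \<plusminus> c cos(2 \<pi> t)\<close>, with \<open>c\<close> small
  enough for the smoothness constraint.
\<close>

lemma minimax_risk_prob_ge: 
  assumes A: "A > 0"
  shows "ennreal ((min 1 A)\<^sup>2 / 16) \<le> minimax_risk_prob n s \<nu> A"
  unfolding minimax_risk_prob_def
proof (rule INF_greatest)
  fix gh assume "gh \<in> prob_estimators n \<nu> A"
  then have gh: "gh \<in> sample_law n f g \<rightarrow>\<^sub>M l2_borel (probs_smooth \<nu> A) prob_density" for f g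
    unfolding prob_estimators_def by (subst measurable_cong_sets[OF sets_sample_law refl])
  define c where "c = min 1 A"
  have c: "0 < c" "\<bar>c\<bar> \<le> 1" "\<bar>- c\<bar> \<le> 1" using A by (auto simp: c_def)
  have "c\<^sup>2 \<le> A\<^sup>2" using A by (intro power_mono) (auto simp: c_def)
  moreover have "0 < A\<^sup>2" using A by simp
  ultimately have "c\<^sup>2 / 2 < A\<^sup>2" by linarith
  then have cA: "c\<^sup>2 / 2 < A\<^sup>2" "(- c)\<^sup>2 / 2 < A\<^sup>2" by simp_all
  let ?g = "cosine_prob c" and ?g' = "cosine_prob (- c)"
  have gp: "?g \<in> circle_probs" "?g' \<in> circle_probs" using c by (auto intro: cosine_prob_circle_probs)
  have gs: "?g \<in> probs_smooth \<nu> A" "?g' \<in> probs_smooth \<nu> A" using c cA by (auto intro: cosine_prob_smooth)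
  obtain a where a: "a > 0" and close: "\<And>X. X \<in> sets (sample_law n (two_mode a 0) ?g) \<Longrightarrow>
     emeasure (sample_law n (two_mode a 0) ?g) X \<le> emeasure (sample_law n (two_mode a 0) ?g') X + ennreal (1 / 2)"
    using sample_laws_close[OF shape_law_zero[OF gp] gp] by blast
  let ?R = "\<lambda>g. \<integral>\<^sup>+y. l2_dist_sq (prob_density (gh y)) (prob_density g) \<partial>sample_law n (two_mode a 0) g"
  have "ennreal ((c / 2)\<^sup>2 / 4) \<le> max (?R ?g) (?R ?g')"
    by (rule two_point_lower_bound[OF gh _ _ _ close, where l = 1])
       (use c in \<open>auto intro!: prob_space_sample_law two_mode_circle_L2 gp integrable_prob_density
         simp: sets_sample_law fourier_coeff_density_cosine_prob probs_smooth_def\<close>)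
  also have "\<dots> \<le> (SUP (f, g) \<in> shape_class s \<times> probs_smooth \<nu> A.
      \<integral>\<^sup>+y. l2_dist_sq (prob_density (gh y)) (prob_density g) \<partial>sample_law n f g)"
  proof (rule max.boundedI, goal_cases)
    case 1 show ?case using gs two_mode_shape_class[OF a] by (intro SUP_upper2[of "(two_mode a 0, ?g)"]) auto
  next
    case 2 show ?case using gs two_mode_shape_class[OF a] by (intro SUP_upper2[of "(two_mode a 0, ?g')"]) auto
  qed
  finally show "ennreal ((min 1 A)\<^sup>2 / 16) \<le> (SUP (f, g) \<in> shape_class s \<times> probs_smooth \<nu> A.
      \<integral>\<^sup>+y. l2_dist_sq (prob_density (gh y)) (prob_density g) \<partial>sample_law n f g)"
    by (simp add: c_def power_divide)
qed

lemma liminf_ln_powr_mult_ge: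
  assumes "p \<ge> 0" and R: "\<And>n. ennreal c \<le> R n"
  shows "ennreal c \<le> liminf (\<lambda>n. ennreal (ln (real n) powr p) * R n)"
proof (rule Liminf_bounded)
  show "\<forall>\<^sub>F n in sequentially. ennreal c \<le> ennreal (ln (real n) powr p) * R n"
    \<comment> \<open>The logarithm is at least 1 from \<open>n = 3\<close> on, since \<open>exp 1 < 3\<close>.\<close>
    using eventually_ge_at_top[of "3::nat"]
  proof eventually_elim
    fix n :: nat assume "3 \<le> n"
    then have "exp 1 \<le> real n" using exp_le by linarith
    then have "1 \<le> ln (real n)" using \<open>3 \<le> n\<close> by (subst ln_ge_iff) auto
    then have "1 \<le> ln (real n) powr p" using assms(1) by (rule ge_one_powr_ge_zero)
    then have "1 * ennreal c \<le> ennreal (ln (real n) powr p) * R n"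
      using R by (intro mult_mono) (auto simp: ennreal_1[symmetric] simp del: ennreal_1 intro!: ennreal_leI)
    then show "ennreal c \<le> ennreal (ln (real n) powr p) * R n" by simp
  qed
qed

section \<open>Bounded random vectors are determined by their characteristic functions\<close>

text \<open>
  The phases \<open>b\<close> cover sines and constants, so that closure under products needs only one base
  case.
\<close>

inductive trig_poly :: "('a::euclidean_space \<Rightarrow> real) \<Rightarrow> bool" where
  trig_poly_cos: "trig_poly (\<lambda>z. r * cos (c \<bullet> z + b))"
| trig_poly_add: "trig_poly p \<Longrightarrow> trig_poly q \<Longrightarrow> trig_poly (\<lambda>z. p z + q z)"

lemma trig_poly_mult:
  assumes "trig_poly p" "trig_poly q"
  shows "trig_poly (\<lambda>z. p z * q z)"
  using assms(1)
proof induction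
  case (trig_poly_cos r c b)
  show ?case using assms(2)
  proof induction
    case (trig_poly_cos r' c' b')
    have "r * cos (c \<bullet> z + b) * (r' * cos (c' \<bullet> z + b')) =
      (r * r' / 2) * cos ((c - c') \<bullet> z + (b - b')) + (r * r' / 2) * cos ((c + c') \<bullet> z + (b + b'))" for z
    proof -
      have "(c - c') \<bullet> z + (b - b') = (c \<bullet> z + b) - (c' \<bullet> z + b')"
        "(c + c') \<bullet> z + (b + b') = (c \<bullet> z + b) + (c' \<bullet> z + b')"
        by (simp_all add: inner_diff_left inner_add_left)
      then show ?thesis by (simp only: cos_diff cos_add) (simp add: algebra_simps)
    qed
    then show ?case by (simp only: trig_poly.intros)
  next
    case (trig_poly_add p q)
    then show ?case by (simp only: distrib_left trig_poly.intros)
  qed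
next
  case (trig_poly_add p q)
  then show ?case by (simp only: distrib_right trig_poly.intros)
qed

lemma trig_poly_continuous: "trig_poly p \<Longrightarrow> continuous_on S p"
  by (induction rule: trig_poly.induct) (auto intro!: continuous_intros)

text \<open>
  Stone-Weierstrass: trigonometric polynomials form an algebra, and a frequency in the direction \<open>x -
  y\<close> for which the phase changes by \<open>\<pi>\<close> separates \<open>x\<close> from
  \<open>y\<close>.
\<close>

lemma trig_poly_approx:
  fixes f :: "'a::euclidean_space \<Rightarrow> real"
  assumes "continuous_on UNIV f" "e > 0"
  shows "\<exists>p. trig_poly p \<and> (\<forall>z\<in>cball 0 C. \<bar>f z - p z\<bar> < e)"
proof (rule Stone_Weierstrass_HOL[where P = trig_poly])
  show "trig_poly (\<lambda>x. c)" for c using trig_poly_cos[of c 0 0] by simp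
  show "\<exists>p. trig_poly p \<and> p x \<noteq> p y" if "x \<in> cball 0 C \<and> y \<in> cball 0 C \<and> x \<noteq> y" for x y :: 'a
  proof (intro exI conjI)
    let ?c = "(pi / (norm (x - y))\<^sup>2) *\<^sub>R (x - y)"
    show "trig_poly (\<lambda>z. 1 * cos (?c \<bullet> z + - (?c \<bullet> y)))" by (rule trig_poly_cos)
    have "?c \<bullet> x + - (?c \<bullet> y) = ?c \<bullet> (x - y)" by (simp only: inner_diff_right add_uminus_conv_diff)
    also have "\<dots> = (pi / (norm (x - y))\<^sup>2) * ((x - y) \<bullet> (x - y))" by (rule inner_scaleR_left)
    also have "\<dots> = pi" using that by (simp add: power2_norm_eq_inner[symmetric])
    finally show "1 * cos (?c \<bullet> x + - (?c \<bullet> y)) \<noteq> 1 * cos (?c \<bullet> y + - (?c \<bullet> y))" by simp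
  qed
qed (use assms in \<open>auto intro: trig_poly_continuous continuous_on_subset trig_poly_mult trig_poly.intros\<close>)

text \<open>
  The characteristic function gives the expectations of trigonometric polynomials, by uniform approximation on
  the bounded range those of continuous functions, and by monotone approximation of indicators the measures of
  closed sets.
\<close>

lemma distr_eqI_bounded_char:
  fixes X :: "'m \<Rightarrow> 'a::euclidean_space" and Y :: "'n \<Rightarrow> 'a"
  assumes M: "prob_space M" and N: "prob_space N"
    and X [measurable]: "X \<in> borel_measurable M" and Y [measurable]: "Y \<in> borel_measurable N"
    and bX: "\<And>x. x \<in> space M \<Longrightarrow> norm (X x) \<le> C" and bY: "\<And>y. y \<in> space N \<Longrightarrow> norm (Y y) \<le> C"
    and char: "\<And>c. (LINT x|M. iexp (c \<bullet> X x)) = (LINT y|N. iexp (c \<bullet> Y y))"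
  shows "distr M borel X = distr N borel Y"
proof -
  interpret M: prob_space M by fact
  interpret N: prob_space N by fact
  interpret DX: prob_space "distr M borel X" by (rule M.prob_space_distr) simp
  interpret DY: prob_space "distr N borel Y" by (rule N.prob_space_distr) simp
  have intX: "integrable M (\<lambda>x. f (X x))" and intY: "integrable N (\<lambda>x. f (Y x))"
    if "continuous_on UNIV f" for f :: "'a \<Rightarrow> real"
  proof -
    have [measurable]: "f \<in> borel_measurable borel" using that by (rule borel_measurable_continuous_onI)
    have "compact (f ` cball 0 C)"
      using that by (intro compact_continuous_image continuous_on_subset[OF that]) auto
    then obtain B where B: "\<And>z. z \<in> cball 0 C \<Longrightarrow> \<bar>f z\<bar> \<le> B"
      by (metis compact_imp_bounded bounded_iff imageI real_norm_def)
    show "integrable M (\<lambda>x. f (X x))" by (rule M.integrable_const_bound[of _ B]) (auto intro!: AE_I2 B bX)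
    show "integrable N (\<lambda>x. f (Y x))" by (rule N.integrable_const_bound[of _ B]) (auto intro!: AE_I2 B bY)
  qed
  have trig: "(LINT x|M. p (X x)) = (LINT y|N. p (Y y))" if "trig_poly p" for p
    using that
  proof induction
    case (trig_poly_cos r c b)
    have eq: "r * cos (c \<bullet> z + b) = Re ((of_real r * cis b) * iexp (c \<bullet> z))" for z :: 'a
      by (simp add: cis_conv_exp exp_add[symmetric] distrib_left flip: of_real_mult)
         (simp add: Re_exp Im_exp cis_conv_exp[symmetric] cos_add algebra_simps)
    have "integrable M (\<lambda>x. iexp (c \<bullet> X x))" "integrable N (\<lambda>x. iexp (c \<bullet> Y x))"
      by (auto intro!: M.integrable_const_bound[of _ 1] N.integrable_const_bound[of _ 1])
    then show ?case unfolding eq using char[of c] by (simp del: of_real_mult)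
  next
    case (trig_poly_add p q)
    then show ?case
      by (simp add: intX intY trig_poly_continuous)
  qed
  have cont: "(LINT x|M. f (X x)) = (LINT y|N. f (Y y))" if f: "continuous_on UNIV f" for f :: "'a \<Rightarrow> real"
  proof -
    have "\<bar>(LINT x|M. f (X x)) - (LINT y|N. f (Y y))\<bar> \<le> e" if "e > 0" for e
    proof -
      obtain p where p: "trig_poly p" and close: "\<And>z. z \<in> cball 0 C \<Longrightarrow> \<bar>f z - p z\<bar> < e / 2"
        using trig_poly_approx[OF f, of "e / 2" C] \<open>e > 0\<close> by auto
      note i = intX[OF f] intY[OF f] intX[OF trig_poly_continuous[OF p]] intY[OF trig_poly_continuous[OF p]]
      have 1: "\<bar>LINT x|M. f (X x) - p (X x)\<bar> \<le> (LINT x|M. e / 2)"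
        using i close bX
        by (intro order_trans[OF integral_abs_bound] integral_mono_AE) (auto intro!: less_imp_le)
      have 2: "\<bar>LINT y|N. f (Y y) - p (Y y)\<bar> \<le> (LINT y|N. e / 2)"
        using i close bY
        by (intro order_trans[OF integral_abs_bound] integral_mono_AE) (auto intro!: less_imp_le)
      have "(LINT x|M. f (X x)) - (LINT y|N. f (Y y)) = (LINT x|M. f (X x) - p (X x)) - (LINT y|N. f (Y y) - p (Y y))"
        using i trig[OF p] by simp
      then show ?thesis using 1 2 by (simp add: M.prob_space N.prob_space)
    qed
    then show ?thesis using field_le_epsilon[of "\<bar>(LINT x|M. f (X x)) - (LINT y|N. f (Y y))\<bar>" 0] by simp
  qed
  have closed: "measure (distr M borel X) A = measure (distr N borel Y) A" if A: "closed A" for A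
  proof (cases "A = {}")
    case False
    \<comment> \<open>These functions decrease to the indicator of the closed set \<open>A\<close>.\<close>
    define f where "f n z = max 0 (1 - real n * infdist z A)" for n z
    have fc: "continuous_on UNIV (f n)" for n unfolding f_def by (intro continuous_intros)
    then have [measurable]: "f n \<in> borel_measurable borel" for n by (rule borel_measurable_continuous_onI)
    have [measurable]: "A \<in> sets borel" using A by auto
    have f1: "norm (f n z) \<le> 1" for n z by (auto simp: f_def infdist_nonneg)
    have lim: "(\<lambda>n. f n z) \<longlonglongrightarrow> indicator A z" for z
    proof (cases "z \<in> A")
      case True then show ?thesis by (simp add: f_def)
    next
      case z: False
      then have pos: "infdist z A > 0" using in_closed_iff_infdist_zero[OF A False, of z] infdist_nonneg[of z A] by auto
      obtain k where k: "1 < real k * infdist z A" using reals_Archimedean3[OF pos] by blast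
      have "f n z = indicator A z" if "n \<ge> k" for n
      proof -
        have "real k * infdist z A \<le> real n * infdist z A" using pos that by (intro mult_right_mono) auto
        then show ?thesis using k z by (simp add: f_def)
      qed
      then show ?thesis by (intro tendsto_eventually) (auto simp: eventually_sequentially)
    qed
    have "(\<lambda>n. LINT z|distr M borel X. f n z) \<longlonglongrightarrow> (LINT z|distr M borel X. indicator A z)"
      by (rule integral_dominated_convergence[where w = "\<lambda>_. 1"]) (use lim f1 in auto)
    moreover have "(\<lambda>n. LINT z|distr N borel Y. f n z) \<longlonglongrightarrow> (LINT z|distr N borel Y. indicator A z)"
      by (rule integral_dominated_convergence[where w = "\<lambda>_. 1"]) (use lim f1 in auto)
    moreover have "(LINT z|distr M borel X. f n z) = (LINT z|distr N borel Y. f n z)" for n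
      using cont[OF fc[of n]] by (simp add: integral_distr)
    ultimately have "(LINT z|distr M borel X. indicator A z) = (LINT z|distr N borel Y. (indicator A z :: real))"
      by (simp add: LIMSEQ_unique)
    then show ?thesis by simp
  qed simp
  show ?thesis
  proof (rule measure_eqI_generator_eq[where E = "{A. closed A}" and \<Omega> = UNIV and A = "\<lambda>_. UNIV"])
    show "Int_stable {A::'a set. closed A}" by (auto simp: Int_stable_def)
    show "sets (distr M borel X) = sigma_sets UNIV {A. closed A}" "sets (distr N borel Y) = sigma_sets UNIV {A. closed A}"
      by (simp_all add: borel_eq_closed)
  qed (use closed in \<open>auto simp: DX.emeasure_eq_measure DY.emeasure_eq_measure\<close>)
qed

text \<open>
  A Borel left inverse of \<open>t \<mapsto> cis (- 2 * pi * t)\<close> on [0,1). The real part is clamped to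
  [-1,1] because \<open>arccos\<close> is continuous there only.
\<close>

definition circle_angle :: "complex \<Rightarrow> real" where
  "circle_angle z = (let t = arccos (max (- 1) (min 1 (Re z))) / (2 * pi) in if Im z \<le> 0 then t else 1 - t)"

lemma measurable_circle_angle [measurable]: "circle_angle \<in> borel_measurable borel"
proof -
  have "(\<lambda>x::real. arccos (max (- 1) (min 1 x))) \<in> borel_measurable borel"
    by (intro borel_measurable_continuous_onI continuous_intros) auto
  from measurable_compose[OF _ this, of Re] have [measurable]: "(\<lambda>z. arccos (max (- 1) (min 1 (Re z)))) \<in> borel_measurable borel"
    by simp
  show ?thesis unfolding circle_angle_def[abs_def] Let_def by measurable
qed

lemma circle_angle_cis:
  assumes "0 \<le> t" "t < 1"
  shows "circle_angle (cis (- 2 * pi * t)) = t"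
proof (cases "t \<le> 1 / 2")
  case True
  then have "2 * pi * t \<le> pi" using mult_left_mono[of t "1/2" "2 * pi"] by simp
  moreover have "0 \<le> 2 * pi * t" using assms by simp
  ultimately have "arccos (cos (2 * pi * t)) = 2 * pi * t" "0 \<le> sin (2 * pi * t)"
    by (auto intro: arccos_cos sin_ge_zero)
  then show ?thesis by (simp add: circle_angle_def Let_def)
next
  case False
  define u where "u = 1 - t"
  have u: "0 < u" "u < 1 / 2" using False assms by (auto simp: u_def)
  have "2 * pi * u < pi" using mult_strict_left_mono[of u "1/2" "2 * pi"] u by simp
  moreover have "0 < 2 * pi * u" using u by simp
  ultimately have a: "arccos (cos (2 * pi * u)) = 2 * pi * u" "0 < sin (2 * pi * u)"
    by (auto intro: arccos_cos sin_gt_zero)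
  have "2 * pi * t = 2 * pi - 2 * pi * u" by (simp add: u_def algebra_simps)
  then have "cos (2 * pi * t) = cos (2 * pi * u)" "sin (2 * pi * t) = - sin (2 * pi * u)"
    by (simp_all add: cos_diff sin_diff)
  then show ?thesis using a by (simp add: circle_angle_def Let_def) (simp add: u_def)
qed

section \<open>Shifted shapes and their Fourier coefficients\<close>

lemma integral_circle_shift:
  fixes F :: "real \<Rightarrow> 'a::{banach, second_countable_topology}"
  assumes [measurable]: "F \<in> borel_measurable borel" and per: "\<And>x. F (x + 1) = F x"
  shows "(LINT t|circle. F (t + a)) = (LINT t|circle. F t)"
proof -
  have fr [measurable]: "(\<lambda>t::real. frac (t + a)) \<in> borel_measurable borel" for a unfolding frac_def by measurable
  have [measurable]: "(\<lambda>t. frac (t + a)) \<in> circle \<rightarrow>\<^sub>M borel"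
    by (rule measurable_circle_borel) measurable
  have [measurable]: "(\<lambda>t. t) \<in> circle \<rightarrow>\<^sub>M borel"
    by (rule measurable_circle_borel) simp
  have eq: "distr circle borel (\<lambda>t. frac (t + a)) = distr circle borel (\<lambda>t. t)"
  proof (rule measure_eqI)
    fix A assume "A \<in> sets (distr circle borel (\<lambda>t. frac (t + a)))"
    then have [measurable]: "A \<in> sets borel" by simp
    have [measurable]: "(\<lambda>t::real. frac t) \<in> borel_measurable borel" using fr[of 0] by simp
    have "emeasure (distr circle borel (\<lambda>t. frac (t + a))) A = (\<integral>\<^sup>+t. indicator A (frac (t + a)) \<partial>circle)"
      using nn_integral_distr[of "\<lambda>t. frac (t + a)" circle borel "indicator A"] by simp
    also have "\<dots> = (\<integral>\<^sup>+t. indicator A (frac t) \<partial>circle)"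
      by (rule nn_integral_circle_shift[where F = "\<lambda>t. indicator A (frac t)"]) (measurable, simp add: frac_1_eq)
    also have "\<dots> = (\<integral>\<^sup>+t. indicator A t \<partial>circle)"
      by (intro nn_integral_cong) (auto simp: frac_eq[THEN iffD2])
    also have "\<dots> = emeasure (distr circle borel (\<lambda>t. t)) A"
      using nn_integral_distr[of "\<lambda>t. t" circle borel "indicator A"] by simp
    finally show "emeasure (distr circle borel (\<lambda>t. frac (t + a))) A = emeasure (distr circle borel (\<lambda>t. t)) A" .
  qed simp
  have "F (t + a) = F (frac (t + a))" for t
    using periodic_add_int[of F "frac (t + a)" "\<lfloor>t + a\<rfloor>", OF per] by (simp add: frac_def)
  then have "(LINT t|circle. F (t + a)) = (LINT t|distr circle borel (\<lambda>t. frac (t + a)). F t)"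
    by (simp add: integral_distr)
  also have "\<dots> = (LINT t|circle. F t)" unfolding eq by (simp add: integral_distr)
  finally show ?thesis .
qed

lemma fourier_coeff_shift:
  assumes f: "f \<in> circle_L2"
  shows "(LINT y:{0..1}|lborel. cis (- 2 * pi * y) * f (y - \<tau>)) = cis (- 2 * pi * \<tau>) * fourier_coeff 1 f"
proof -
  have [measurable]: "f \<in> borel_measurable borel" using f by (rule measurable_circle_L2)
  define F where "F y = cis (- 2 * pi * y) * f y" for y
  have [measurable]: "F \<in> borel_measurable borel" unfolding F_def by measurable
  have per: "F (y + 1) = F y" for y
  proof -
    have "- 2 * pi * (y + 1) = - 2 * pi * y - 2 * pi" by (simp add: algebra_simps)
    then have "cis (- 2 * pi * (y + 1)) = cis (- 2 * pi * y)" by (simp only: cis_add_2pi)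
    then show ?thesis unfolding F_def using f by (simp add: circle_L2_def del: mult_minus_left)
  qed
  have eq: "cis (- 2 * pi * y) * f (y - \<tau>) = cis (- 2 * pi * \<tau>) * F (y + - \<tau>)" for y
  proof -
    have "- 2 * pi * y = - 2 * pi * \<tau> + - 2 * pi * (y + - \<tau>)" by (simp add: algebra_simps)
    then have "cis (- 2 * pi * y) = cis (- 2 * pi * \<tau>) * cis (- 2 * pi * (y + - \<tau>))" by (simp only: cis_mult)
    then show ?thesis by (simp only: F_def mult.assoc) simp
  qed
  have m: "(\<lambda>y. cis (- 2 * pi * \<tau>) * F (y + - \<tau>)) \<in> borel_measurable borel" by measurable
  have "(LINT y:{0..1}|lborel. cis (- 2 * pi * y) * f (y - \<tau>)) = (LINT y|circle. cis (- 2 * pi * \<tau>) * F (y + - \<tau>))"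
    by (simp only: eq integral_circle[OF m])
  also have "\<dots> = cis (- 2 * pi * \<tau>) * (LINT y|circle. F (y + - \<tau>))" by (rule integral_mult_right_zero)
  also have "(LINT y|circle. F (y + - \<tau>)) = (LINT y|circle. F y)"
    by (rule integral_circle_shift) (measurable, rule per)
  also have "\<dots> = fourier_coeff 1 f" by (simp add: F_def fourier_coeff_def)
  finally show ?thesis .
qed

lemma norm_drift_le:
  assumes f: "f \<in> circle_L2" and x: "0 \<le> x" "x \<le> 1"
  shows "norm (drift f \<tau> x) \<le> (LINT t|circle. norm (f t))"
proof -
  have [measurable]: "f \<in> borel_measurable borel" using f by (rule measurable_circle_L2)
  have i: "set_integrable lborel {0..1} (\<lambda>y. norm (f (y - \<tau>)))"
    using set_integrable_norm[OF set_integrable_shift[OF f]] .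
  have ix: "set_integrable lborel {0..x} (\<lambda>y. f (y - \<tau>))"
    using x by (intro set_integrable_shift_sub f) auto
  have "norm (drift f \<tau> x) \<le> (LINT y:{0..x}|lborel. norm (f (y - \<tau>)))"
    unfolding drift_def using ix by (rule set_integral_norm_bound)
  also have "\<dots> \<le> (LINT y:{0..1}|lborel. norm (f (y - \<tau>)))"
    unfolding set_lebesgue_integral_def
    using i set_integrable_norm[OF ix] x by (intro integral_mono) (auto simp: set_integrable_def indicator_def)
  also have "\<dots> = (LINT y|circle. norm (f (y + - \<tau>)))"
    by (subst integral_circle) auto
  also have "\<dots> = (LINT y|circle. norm (f y))"
    using f by (intro integral_circle_shift[where F = "\<lambda>y. norm (f y)"]) (auto simp: circle_L2_def)
  finally show ?thesis .
qed

section \<open>Linear functionals of the path\<close>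

text \<open>
  Finite linear combinations of evaluations of a path, as real functions. Generating them inductively avoids
  merging the sampling points when functionals are added.
\<close>

inductive path_functional :: "((real \<Rightarrow> complex) \<Rightarrow> real) \<Rightarrow> bool" where
  path_functional_eval: "t \<in> {0..1} \<Longrightarrow> path_functional (\<lambda>w. c \<bullet> w t)"
| path_functional_add: "path_functional L \<Longrightarrow> path_functional M \<Longrightarrow> path_functional (\<lambda>w. L w + M w)"

lemma path_functional_sum:
  assumes "\<And>i. i \<in> K \<Longrightarrow> path_functional (L i)"
  shows "path_functional (\<lambda>w. \<Sum>i\<in>K. L i w)"
  using assms
proof (induction K rule: infinite_finite_induct)
  case (insert i K)
  then show ?case by (simp add: path_functional_add)
qed (use path_functional_eval[of 0 0] in simp_all)

lemma measurable_path_functional: "path_functional L \<Longrightarrow> L \<in> borel_measurable path_space"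
  by (induction rule: path_functional.induct) auto

lemma path_functional_plus: "path_functional L \<Longrightarrow> L (\<lambda>x\<in>{0..1}. u x + w x) = L u + L w"
  by (induction rule: path_functional.induct) (auto simp: inner_add_right)

lemma path_functional_finite:
  "path_functional L \<Longrightarrow> \<exists>J c. finite J \<and> J \<subseteq> {0..1} \<and> (\<forall>w. L w = (\<Sum>t\<in>J. c t \<bullet> w t))"
proof (induction rule: path_functional.induct)
  case (path_functional_eval t c)
  then show ?case by (intro exI[of _ "{t}"] exI[of _ "\<lambda>_. c"]) auto
next
  case (path_functional_add L M)
  then obtain J c K d where J: "finite J" "J \<subseteq> {0..1}" "\<And>w. L w = (\<Sum>t\<in>J. c t \<bullet> w t)"
    and K: "finite K" "K \<subseteq> {0..1}" "\<And>w. M w = (\<Sum>t\<in>K. d t \<bullet> w t)" by blast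
  let ?e = "\<lambda>t. (if t \<in> J then c t else 0) + (if t \<in> K then d t else 0)"
  have "L w + M w = (\<Sum>t\<in>J \<union> K. ?e t \<bullet> w t)" for w
  proof -
    have "(\<Sum>t\<in>J. c t \<bullet> w t) = (\<Sum>t\<in>J \<union> K. (if t \<in> J then c t else 0) \<bullet> w t)"
      using J K by (intro sum.mono_neutral_cong_left) auto
    moreover have "(\<Sum>t\<in>K. d t \<bullet> w t) = (\<Sum>t\<in>J \<union> K. (if t \<in> K then d t else 0) \<bullet> w t)"
      using J K by (intro sum.mono_neutral_cong_left) auto
    ultimately show ?thesis by (simp add: J(3) K(3) sum.distrib[symmetric] inner_add_left)
  qed
  then show ?case using J K by (intro exI[of _ "J \<union> K"] exI[of _ ?e]) auto
qed

lemma integral_iexp_complex_gauss: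
  assumes "v \<ge> 0"
  shows "(LINT z|complex_gauss v. iexp (c \<bullet> z)) = complex_of_real (exp (- (v * (norm c)\<^sup>2) / 4))"
proof -
  interpret A: prob_space "real_gauss (v/2)" by (rule prob_space_real_gauss)
  interpret AB: pair_prob_space "real_gauss (v/2)" "real_gauss (v/2)" ..
  have m: "(\<lambda>(a, b). Complex a b) \<in> borel_measurable (real_gauss (v/2) \<Otimes>\<^sub>M real_gauss (v/2))"
    unfolding case_prod_beta by simp
  have "(LINT z|complex_gauss v. iexp (c \<bullet> z))
     = (LINT p|(real_gauss (v/2) \<Otimes>\<^sub>M real_gauss (v/2)). iexp (Re c * fst p) * iexp (Im c * snd p))"
    unfolding complex_gauss_def using m
    by (subst integral_distr)
      (auto simp: case_prod_beta inner_complex_def distrib_left exp_add intro!: Bochner_Integration.integral_cong)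
  also have "\<dots> = (LINT x|real_gauss (v/2). LINT y|real_gauss (v/2). iexp (Re c * x) * iexp (Im c * y))"
    by (subst AB.integral_fst'[symmetric])
       (auto intro!: AB.P.integrable_const_bound[where B=1] simp: norm_mult)
  also have "\<dots> = char (real_gauss (v/2)) (Re c) * char (real_gauss (v/2)) (Im c)"
    by (simp add: char_def)
  also have "\<dots> = complex_of_real (exp (- (v / 2 * (Re c)\<^sup>2) / 2) * exp (- (v / 2 * (Im c)\<^sup>2) / 2))"
    using assms by (simp add: char_real_gauss)
  also have "exp (- (v / 2 * (Re c)\<^sup>2) / 2) * exp (- (v / 2 * (Im c)\<^sup>2) / 2) = exp (- (v * (norm c)\<^sup>2) / 4)"
    unfolding exp_add[symmetric] by (rule arg_cong[where f = exp]) (simp add: cmod_power2 field_simps)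
  finally show ?thesis .
qed

text \<open>
  A functional of the path is a functional of its independent increments, and Gaussian characteristic
  functions have no zeros.
\<close>

lemma brownian_char_nonzero:
  assumes "path_functional L"
  shows "(LINT w|brownian_law. iexp (L w)) \<noteq> 0"
proof -
  obtain J c where J: "finite J" "J \<subseteq> {0..1}" and L: "\<And>w. L w = (\<Sum>t\<in>J. c t \<bullet> w t)"
    using path_functional_finite[OF assms] by blast
  define v where "v t = t - prev_time J t" for t
  define N where "N = PiM J (\<lambda>t. complex_gauss (v t))"
  interpret C: product_prob_space "\<lambda>t. complex_gauss (v t)"
    by (simp add: prob_space_complex_gauss product_prob_space_def product_prob_space_axioms_def product_sigma_finite_def prob_space_imp_sigma_finite)
  have sN [measurable_cong]: "sets N = sets (PiM J (\<lambda>_. borel))"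
    unfolding N_def by (intro sets_PiM_cong) auto
  define d where "d u = (\<Sum>t\<in>{t\<in>J. u \<le> t}. c t)" for u
  have v: "v t \<ge> 0" if "t \<in> J" for t using prev_time_le[OF J that] by (simp add: v_def)
  let ?L = "\<lambda>w. \<Sum>t\<in>J. c t \<bullet> w t"
  have mL [measurable]: "?L \<in> borel_measurable (PiM J (\<lambda>_. borel))" by measurable
  have r: "(\<lambda>w. restrict w J) \<in> brownian_law \<rightarrow>\<^sub>M PiM J (\<lambda>_. borel)"
    using J by (subst measurable_cong_sets[OF sets_brownian_law refl]) (intro measurable_restrict_subset)
  have "(LINT w|brownian_law. iexp (L w)) = (LINT w|distr brownian_law (PiM J (\<lambda>_. borel)) (\<lambda>w. restrict w J). iexp (?L w))"
    using r by (subst integral_distr) (auto simp: L)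
  also have "\<dots> = (LINT z|N. iexp (?L (\<lambda>t\<in>J. \<Sum>u\<in>{u\<in>J. u \<le> t}. z u)))"
    unfolding brownian_law_marginal[OF J] brownian_fdd_def N_def[unfolded v_def, symmetric]
    by (subst integral_distr) auto
  also have "\<dots> = (LINT z|N. (\<Prod>u\<in>J. iexp (d u \<bullet> z u)))"
  proof (intro Bochner_Integration.integral_cong refl)
    fix z :: "real \<Rightarrow> complex"
    have "?L (\<lambda>t\<in>J. \<Sum>u\<in>{u\<in>J. u \<le> t}. z u) = (\<Sum>t\<in>J. \<Sum>u\<in>{u\<in>J. u \<le> t}. c t \<bullet> z u)"
      by (simp add: inner_sum_right)
    also have "\<dots> = (\<Sum>u\<in>J. \<Sum>t\<in>{t\<in>J. u \<le> t}. c t \<bullet> z u)"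
      using J by (subst sum.swap_restrict) auto
    also have "\<dots> = (\<Sum>u\<in>J. d u \<bullet> z u)" by (simp add: d_def inner_sum_left)
    finally show "iexp (?L (\<lambda>t\<in>J. \<Sum>u\<in>{u\<in>J. u \<le> t}. z u)) = (\<Prod>u\<in>J. iexp (d u \<bullet> z u))"
      using J by (simp add: exp_sum[symmetric] sum_distrib_left)
  qed
  also have "\<dots> = (\<Prod>u\<in>J. LINT z|complex_gauss (v u). iexp (d u \<bullet> z))"
    unfolding N_def
    by (intro C.product_integral_prod[OF J(1)] finite_measure.integrable_const_bound[where B = 1]
        prob_space.finite_measure prob_space_complex_gauss) auto
  also have "\<dots> \<noteq> 0" using J v by (simp add: integral_iexp_complex_gauss)
  finally show ?thesis .
qed

text \<open>
  Drift and noise are independent, so the characteristic function of an observation factors. As the factor of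
  the noise is known and nonzero, the law of the observation determines that of the drift.
\<close>

lemma char_shape_law:
  assumes L: "path_functional L" and f: "f \<in> circle_L2" and g: "g \<in> circle_probs"
  shows "(LINT y|shape_law f g. iexp (L y)) = (LINT \<tau>|g. iexp (L (drift f \<tau>))) * (LINT w|brownian_law. iexp (L w))"
    and "(\<lambda>\<tau>. L (drift f \<tau>)) \<in> borel_measurable g"
proof -
  interpret g: prob_space g by (rule circle_probsD[OF g])
  interpret B: prob_space brownian_law by (rule prob_space_brownian_law)
  interpret P: pair_prob_space g brownian_law ..
  note [measurable] = measurable_path_functional[OF L]
  have mf: "f \<in> borel_measurable borel" using f by (rule measurable_circle_L2)
  have "(\<lambda>\<tau>. L (drift f \<tau>)) \<in> borel_measurable borel"
    using L mf by induction auto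
  then show mL [measurable]: "(\<lambda>\<tau>. L (drift f \<tau>)) \<in> borel_measurable g"
    by (rule circle_probsD(4)[OF g])
  have "(LINT y|shape_law f g. iexp (L y)) = (LINT p|(g \<Otimes>\<^sub>M brownian_law). iexp (L (drift f (fst p))) * iexp (L (snd p)))"
    unfolding shape_law_def drift_def[symmetric] using measurable_drift_path[OF f g]
    by (subst integral_distr)
       (auto simp: case_prod_beta path_functional_plus[OF L] distrib_left exp_add intro!: Bochner_Integration.integral_cong)
  also have "\<dots> = (LINT \<tau>|g. LINT w|brownian_law. iexp (L (drift f \<tau>)) * iexp (L w))"
    by (subst P.integral_fst'[symmetric])
       (auto intro!: P.P.integrable_const_bound[where B=1] simp: norm_mult)
  also have "\<dots> = (LINT \<tau>|g. iexp (L (drift f \<tau>))) * (LINT w|brownian_law. iexp (L w))"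
    by simp
  finally show "(LINT y|shape_law f g. iexp (L y)) = (LINT \<tau>|g. iexp (L (drift f \<tau>))) * (LINT w|brownian_law. iexp (L w))" .
qed

section \<open>Recovering the shape and the shift distribution\<close>

text \<open>
  The Fourier coefficient of an observation would be a stochastic integral. These sums approximate its
  deterministic part by functionals of the path.
\<close>

lemma Riemann_Stieltjes_sums:
  fixes e h :: "real \<Rightarrow> complex"
  assumes e: "continuous_on UNIV e" "\<And>y. norm (e y) \<le> 1" and h: "set_integrable lborel {0..1} h"
  defines "H \<equiv> \<lambda>x. LINT y:{0..x}|lborel. h y"
  shows "(\<lambda>N. \<Sum>j<Suc N. e (j / Suc N) * (H (Suc j / Suc N) - H (j / Suc N))) \<longlonglongrightarrow> (LINT y:{0..1}|lborel. e y * h y)"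
proof -
  \<comment> \<open>\<open>E N y\<close> samples \<open>e\<close> at the left end \<open>j / N\<close> of the interval \<open>{j / N<..(j + 1) / N}\<close> that contains
  \<open>y\<close>.\<close>
  define E where "E N y = e ((\<lceil>real N * y\<rceil> - 1) / real N)" for N :: nat and y
  have [measurable]: "e \<in> borel_measurable borel" using e(1) by (rule borel_measurable_continuous_onI)
  have [measurable]: "E N \<in> borel_measurable borel" for N unfolding E_def by measurable
  have mh [measurable]: "(\<lambda>y. indicator {0..1} y *\<^sub>R h y) \<in> borel_measurable lborel"
    using h unfolding set_integrable_def by (rule borel_measurable_integrable)
  have iE: "set_integrable lborel K (\<lambda>y. E N y * h y)" if "K \<subseteq> {0..1}" "K \<in> sets borel" for K N
  proof -
    have "set_integrable lborel {0..1} (\<lambda>y. E N y * h y)"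
      unfolding set_integrable_def
    proof (rule Bochner_Integration.integrable_bound[OF h[unfolded set_integrable_def]])
      have "(\<lambda>y. E N y * (indicator {0..1} y *\<^sub>R h y)) \<in> borel_measurable lborel" by measurable
      then show "(\<lambda>y. indicator {0..1} y *\<^sub>R (E N y * h y)) \<in> borel_measurable lborel" by (simp add: mult_scaleR_right)
      show "AE y in lborel. norm (indicat_real {0..1} y *\<^sub>R (E N y * h y)) \<le> norm (indicat_real {0..1} y *\<^sub>R h y)"
        using e(2) by (auto simp: E_def norm_mult indicator_def intro!: mult_left_le_one_le)
    qed
    then show ?thesis using that by (intro set_integrable_subset[of lborel "{0..1}" _ K]) auto
  qed
  have ih: "set_integrable lborel K h" if "K \<subseteq> {0..1}" "K \<in> sets borel" for K
    using that by (intro set_integrable_subset[OF h]) auto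
  have part: "(\<Sum>j<n. e (j / N) * (H (Suc j / N) - H (j / N))) = (LINT y:{0<..n / N}|lborel. E N y * h y)"
    if "n \<le> N" "N > 0" for n N :: nat
    using that
  proof (induction n)
    case 0 then show ?case by (simp add: set_lebesgue_integral_def)
  next
    case (Suc n)
    define p q where "p = real n / N" and "q = real (Suc n) / N"
    have pq: "0 \<le> p" "p \<le> q" "q \<le> 1" using Suc.prems by (auto simp: p_def q_def divide_right_mono)
    have "{0..q} = {0..p} \<union> {p<..q}" using pq by auto
    then have "H q - H p = (LINT y:{p<..q}|lborel. h y)"
      unfolding H_def using pq by (simp only:) (subst set_integral_Un, auto intro!: ih)
    then have "e p * (H q - H p) = (LINT y:{p<..q}|lborel. e p * h y)" by simp
    also have "\<dots> = (LINT y:{p<..q}|lborel. E N y * h y)"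
    proof (rule set_lebesgue_integral_cong)
      have "\<lceil>real N * y\<rceil> = int n + 1" if "p < y" "y \<le> q" for y
        using that Suc.prems by (intro ceiling_unique) (auto simp: p_def q_def field_simps)
      then show "\<forall>y. y \<in> {p<..q} \<longrightarrow> e p * h y = E N y * h y"
        by (auto simp: E_def p_def)
    qed auto
    also have "(LINT y:{0<..p}|lborel. E N y * h y) + \<dots> = (LINT y:{0<..p} \<union> {p<..q}|lborel. E N y * h y)"
      using pq by (subst set_integral_Un) (auto intro!: iE)
    also have "{0<..p} \<union> {p<..q} = {0<..q}" using pq by auto
    finally have "(LINT y:{0<..p}|lborel. E N y * h y) + e p * (H q - H p) = (LINT y:{0<..q}|lborel. E N y * h y)" .
    moreover have "(\<Sum>j<n. e (j / N) * (H (Suc j / N) - H (j / N))) = (LINT y:{0<..p}|lborel. E N y * h y)"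
      using Suc by (simp add: p_def)
    ultimately show ?case by (simp only: sum.lessThan_Suc p_def q_def)
  qed
  have "(\<lambda>N. LINT y|lborel. indicator {0<..1} y *\<^sub>R (E (Suc N) y * h y)) \<longlonglongrightarrow> (LINT y|lborel. indicator {0<..1} y *\<^sub>R (e y * h y))"
  proof (rule integral_dominated_convergence)
    show "integrable lborel (\<lambda>y. norm (indicator {0..1} y *\<^sub>R h y))"
      using h unfolding set_integrable_def by (rule integrable_norm)
    have eq: "indicator {0<..1} y *\<^sub>R (z * h y) = indicator {0<..1} y *\<^sub>R (z * (indicator {0..1} y *\<^sub>R h y))" for z and y :: real
      by (auto simp: indicator_def)
    show "(\<lambda>y. indicator {0<..1} y *\<^sub>R (e y * h y)) \<in> borel_measurable lborel"
      unfolding eq by measurable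
    show "(\<lambda>y. indicator {0<..1} y *\<^sub>R (E (Suc N) y * h y)) \<in> borel_measurable lborel" for N
      unfolding eq by measurable
    show "AE y in lborel. norm (indicator {0<..1} y *\<^sub>R (E (Suc N) y * h y)) \<le> norm (indicator {0..1} y *\<^sub>R h y)" for N
      using e(2) by (auto simp: E_def norm_mult indicator_def intro!: mult_left_le_one_le)
    show "AE y in lborel. (\<lambda>N. indicator {0<..1} y *\<^sub>R (E (Suc N) y * h y)) \<longlonglongrightarrow> indicator {0<..1} y *\<^sub>R (e y * h y)"
    proof (intro AE_I2 tendsto_intros)
      fix y :: real
      have lim: "(\<lambda>N. (\<lceil>real (Suc N) * y\<rceil> - 1) / real (Suc N)) \<longlonglongrightarrow> y"
      proof (rule tendsto_sandwich)
        show "\<forall>\<^sub>F N in sequentially. y - 1 / real (Suc N) \<le> (\<lceil>real (Suc N) * y\<rceil> - 1) / real (Suc N)"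
          proof (intro always_eventually allI)
            fix N show "y - 1 / real (Suc N) \<le> (\<lceil>real (Suc N) * y\<rceil> - 1) / real (Suc N)"
            proof -
              have "y - 1 / real (Suc N) = (real (Suc N) * y - 1) / real (Suc N)" by (simp add: field_simps)
              also have "\<dots> \<le> (\<lceil>real (Suc N) * y\<rceil> - 1) / real (Suc N)"
                using le_of_int_ceiling[of "real (Suc N) * y"] by (intro divide_right_mono of_nat_0_le_iff) linarith
              finally show ?thesis .
            qed
          qed
        show "\<forall>\<^sub>F N in sequentially. (\<lceil>real (Suc N) * y\<rceil> - 1) / real (Suc N) \<le> y"
          proof (intro always_eventually allI)
            fix N show "(\<lceil>real (Suc N) * y\<rceil> - 1) / real (Suc N) \<le> y"
            proof -
              have "(\<lceil>real (Suc N) * y\<rceil> - 1) / real (Suc N) \<le> (real (Suc N) * y) / real (Suc N)"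
                using of_int_ceiling_le_add_one[of "real (Suc N) * y"] by (intro divide_right_mono of_nat_0_le_iff) linarith
              then show ?thesis by simp
            qed
          qed
        show "(\<lambda>N. y - 1 / real (Suc N)) \<longlonglongrightarrow> y"
          using tendsto_diff[OF tendsto_const LIMSEQ_inverse_real_of_nat, of y] by (simp add: inverse_eq_divide)
      qed simp
      have "isCont e y" using e(1) by (simp add: continuous_on_eq_continuous_at)
      then show "(\<lambda>N. E (Suc N) y) \<longlonglongrightarrow> e y"
        unfolding E_def by (rule isCont_tendsto_compose[OF _ lim])
    qed
  qed
  also have "(LINT y|lborel. indicator {0<..1} y *\<^sub>R (e y * h y)) = (LINT y:{0..1}|lborel. e y * h y)"
  proof -
    have "(LINT y|lborel. indicator {0<..1} y *\<^sub>R (e y * h y)) = (LINT y|lborel. indicator {0<..1} y *\<^sub>R (e y * (indicator {0..1} y *\<^sub>R h y)))"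
      by (intro Bochner_Integration.integral_cong) (auto simp: indicator_def)
    also have "\<dots> = (LINT y|lborel. indicator {0..1} y *\<^sub>R (e y * (indicator {0..1} y *\<^sub>R h y)))"
    proof (rule integral_cong_AE)
      show "AE y in lborel. indicat_real {0<..1} y *\<^sub>R (e y * (indicat_real {0..1} y *\<^sub>R h y)) = indicat_real {0..1} y *\<^sub>R (e y * (indicat_real {0..1} y *\<^sub>R h y))"
        using AE_lborel_singleton[of "0::real"] by eventually_elim (auto simp: indicator_def)
    qed measurable
    also have "\<dots> = (LINT y:{0..1}|lborel. e y * h y)"
      unfolding set_lebesgue_integral_def by (intro Bochner_Integration.integral_cong) (auto simp: indicator_def)
    finally show ?thesis .
  qed
  also have "(\<lambda>N. LINT y|lborel. indicator {0<..1} y *\<^sub>R (E (Suc N) y * h y)) =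
      (\<lambda>N. \<Sum>j<Suc N. e (j / Suc N) * (H (Suc j / Suc N) - H (j / Suc N)))"
  proof
    fix N
    show "(LINT y|lborel. indicator {0<..1} y *\<^sub>R (E (Suc N) y * h y)) = (\<Sum>j<Suc N. e (j / Suc N) * (H (Suc j / Suc N) - H (j / Suc N)))"
      using part[of "Suc N" "Suc N"] by (simp only: set_lebesgue_integral_def) simp
  qed
  finally show ?thesis .
qed

text \<open>
  The first Fourier coefficient of the shifted shape is a limit of linear functionals of the drift, so its
  joint law with a value of the drift is determined by the law of an observation.
\<close>

lemma joint_char_determined:
  assumes f: "f \<in> circle_L2" and f': "f' \<in> circle_L2" and g: "g \<in> circle_probs" and g': "g' \<in> circle_probs"
    and eq: "shape_law f g = shape_law f' g'" and x: "0 \<le> x" "x \<le> 1"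
  shows "(LINT \<tau>|g. iexp (a \<bullet> (cis (- 2 * pi * \<tau>) * fourier_coeff 1 f) + b \<bullet> drift f \<tau> x)) =
    (LINT \<tau>|g'. iexp (a \<bullet> (cis (- 2 * pi * \<tau>) * fourier_coeff 1 f') + b \<bullet> drift f' \<tau> x))"
proof -
  let ?e = "\<lambda>y. cis (- 2 * pi * y)"
  define L where "L N w = (\<Sum>j<Suc N. a \<bullet> (?e (j / Suc N) * (w (Suc j / Suc N) - w (j / Suc N)))) + b \<bullet> w x"
    for N :: nat and w :: "real \<Rightarrow> complex"
  have mult: "a \<bullet> (c * (z - z')) = (a * cnj c) \<bullet> z + (- (a * cnj c)) \<bullet> z'" for c z z'
    by (simp add: inner_complex_def algebra_simps)
  have L: "path_functional (L N)" for N
    unfolding L_def mult using x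
    by (intro path_functional_add path_functional_sum path_functional_eval) (auto simp: divide_le_eq)
  have same: "(LINT \<tau>|g. iexp (L N (drift f \<tau>))) = (LINT \<tau>|g'. iexp (L N (drift f' \<tau>)))" for N
    using char_shape_law(1)[OF L f g, of N] char_shape_law(1)[OF L f' g', of N] brownian_char_nonzero[OF L, of N]
    by (simp add: eq)
  have lim: "(\<lambda>N. LINT \<tau>|g. iexp (L N (drift f \<tau>))) \<longlonglongrightarrow>
      (LINT \<tau>|g. iexp (a \<bullet> (?e \<tau> * fourier_coeff 1 f) + b \<bullet> drift f \<tau> x))"
    if f: "f \<in> circle_L2" and g: "g \<in> circle_probs" for f g
  proof (rule integral_dominated_convergence[where w = "\<lambda>_. 1"])
    interpret g: prob_space g by (rule circle_probsD[OF g])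
    have [measurable]: "f \<in> borel_measurable borel" using f by (rule measurable_circle_L2)
    show "(\<lambda>\<tau>. iexp (a \<bullet> (?e \<tau> * fourier_coeff 1 f) + b \<bullet> drift f \<tau> x)) \<in> borel_measurable g"
      by (rule circle_probsD(4)[OF g]) measurable
    show "(\<lambda>\<tau>. iexp (L N (drift f \<tau>))) \<in> borel_measurable g" for N
      using char_shape_law(2)[OF L f g, of N] by measurable
    show "integrable g (\<lambda>_. 1::real)" by simp
    show "AE \<tau> in g. (\<lambda>N. iexp (L N (drift f \<tau>))) \<longlonglongrightarrow> iexp (a \<bullet> (?e \<tau> * fourier_coeff 1 f) + b \<bullet> drift f \<tau> x)"
    proof (rule AE_I2)
      fix \<tau>
      have c: "continuous_on UNIV ?e" by (intro continuous_intros)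
      from Riemann_Stieltjes_sums[OF c _ set_integrable_shift[OF f, of \<tau>]]
      have "(\<lambda>N. \<Sum>j<Suc N. ?e (j / Suc N) * (drift f \<tau> (Suc j / Suc N) - drift f \<tau> (j / Suc N)))
          \<longlonglongrightarrow> ?e \<tau> * fourier_coeff 1 f"
        by (simp only: drift_def[symmetric] fourier_coeff_shift[OF f]) (simp add: drift_def[abs_def])
      then have "(\<lambda>N. L N (drift f \<tau>)) \<longlonglongrightarrow> a \<bullet> (?e \<tau> * fourier_coeff 1 f) + b \<bullet> drift f \<tau> x"
        unfolding L_def inner_sum_right[symmetric] by (intro tendsto_intros)
      then show "(\<lambda>N. iexp (L N (drift f \<tau>))) \<longlonglongrightarrow> iexp (a \<bullet> (?e \<tau> * fourier_coeff 1 f) + b \<bullet> drift f \<tau> x)"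
        by (intro tendsto_intros)
    qed
  qed simp
  show ?thesis
    using lim[OF f g] lim[OF f' g'] unfolding same by (rule LIMSEQ_unique)
qed

lemma joint_law_determined:
  assumes f: "f \<in> circle_L2" and f': "f' \<in> circle_L2" and g: "g \<in> circle_probs" and g': "g' \<in> circle_probs"
    and eq: "shape_law f g = shape_law f' g'" and x: "0 \<le> x" "x \<le> 1"
  shows "distr g borel (\<lambda>\<tau>. (cis (- 2 * pi * \<tau>) * fourier_coeff 1 f, drift f \<tau> x)) =
    distr g' borel (\<lambda>\<tau>. (cis (- 2 * pi * \<tau>) * fourier_coeff 1 f', drift f' \<tau> x))"
proof -
  let ?V = "\<lambda>f \<tau>. (cis (- 2 * pi * \<tau>) * fourier_coeff 1 f, drift f \<tau> x)"
  have mV: "?V f \<in> borel_measurable g" if f: "f \<in> circle_L2" and g: "g \<in> circle_probs" for f g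
  proof -
    have [measurable]: "f \<in> borel_measurable borel" using f by (rule measurable_circle_L2)
    have "?V f \<in> borel \<rightarrow>\<^sub>M borel \<Otimes>\<^sub>M borel" by measurable
    then show ?thesis by (intro circle_probsD(4)[OF g]) (simp add: borel_prod)
  qed
  define C where "C f = norm (fourier_coeff 1 f) + (LINT t|circle. norm (f t))" for f
  have bV: "norm (?V f \<tau>) \<le> C f" if "f \<in> circle_L2" for f \<tau>
  proof -
    have "norm (?V f \<tau>) \<le> norm (cis (- 2 * pi * \<tau>) * fourier_coeff 1 f) + norm (drift f \<tau> x)"
      by (rule norm_Pair_le)
    then show ?thesis using norm_drift_le[OF that x, of \<tau>] by (simp add: C_def norm_mult)
  qed
  show ?thesis
  proof (rule distr_eqI_bounded_char[OF circle_probsD(1)[OF g] circle_probsD(1)[OF g'] mV[OF f g] mV[OF f' g']])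
    show "norm (?V f \<tau>) \<le> max (C f) (C f')" for \<tau> using bV[OF f, of \<tau>] by (rule max.coboundedI1)
    show "norm (?V f' \<tau>) \<le> max (C f) (C f')" for \<tau> using bV[OF f', of \<tau>] by (rule max.coboundedI2)
    show "(LINT \<tau>|g. iexp (c \<bullet> ?V f \<tau>)) = (LINT \<tau>|g'. iexp (c \<bullet> ?V f' \<tau>))" for c
      using joint_char_determined[OF f f' g g' eq x, of "fst c" "snd c"] by (simp add: inner_prod_def)
  qed
qed

text \<open>
  The rays with rational endpoints are an intersection-stable generator of the Borel sets, so the integral
  over every Borel set vanishes.
\<close>

lemma AE_eq_0_from_rational_primitives:
  fixes h :: "real \<Rightarrow> complex"
  assumes h: "set_integrable lborel {0..1} h"
    and 0: "\<And>x. x \<in> \<rat> \<Longrightarrow> 0 \<le> x \<Longrightarrow> x \<le> 1 \<Longrightarrow> (LINT y:{0..x}|lborel. h y) = 0"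
  shows "AE y in lborel. y \<in> {0..1} \<longrightarrow> h y = 0"
proof -
  define k where "k y = indicat_real {0..1} y *\<^sub>R h y" for y
  have ik: "integrable lborel k" using h by (simp add: set_integrable_def k_def[abs_def])
  have ikA: "set_integrable lborel A k" if "A \<in> sets lborel" for A
    unfolding set_integrable_def using that by (rule integrable_mult_indicator) (rule ik)
  define E where "E = range (\<lambda>q::rat. {..real_of_rat q})"
  have total: "(LINT y|lborel. k y) = 0"
    using 0[of 1] by (simp add: k_def[abs_def] set_lebesgue_integral_def)
  have ray: "(LINT y:{..x}|lborel. k y) = 0" if x: "x \<in> \<rat>" for x
  proof -
    consider "x < 0" | "0 \<le> x" "x \<le> 1" | "1 < x" by linarith
    then show ?thesis
    proof cases
      case 1
      then have "indicat_real {..x} y *\<^sub>R k y = 0" for y by (auto simp: k_def indicator_def)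
      then show ?thesis unfolding set_lebesgue_integral_def by (simp only: Bochner_Integration.integral_zero)
    next
      case 2
      then have "indicat_real {..x} y *\<^sub>R k y = indicat_real {0..x} y *\<^sub>R h y" for y by (auto simp: k_def indicator_def)
      then show ?thesis using 0[OF x 2] by (simp add: set_lebesgue_integral_def)
    next
      case 3
      then have "indicat_real {..x} y *\<^sub>R k y = k y" for y by (auto simp: k_def indicator_def)
      then show ?thesis using total by (simp add: set_lebesgue_integral_def)
    qed
  qed
  have Int: "Int_stable E"
  proof -
    have "{..real_of_rat p} \<inter> {..real_of_rat q} = {..real_of_rat (min p q)}" for p q
      by (auto simp: min_def of_rat_less_eq)
    then show ?thesis unfolding Int_stable_def E_def by auto
  qed
  have gen: "sets lborel = sigma_sets UNIV E"
  proof -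
    have "borel = sigma UNIV E"
      unfolding E_def
    proof (rule borel_eq_sigmaI1[OF borel_eq_atMost[where 'a = real]], unfold E_def[symmetric])
      fix X :: "real set" assume "X \<in> range atMost"
      then obtain x where X: "X = {..x}" by auto
      show "X \<in> sets (sigma UNIV E)"
      proof -
        have "{..x} = (\<Inter>q\<in>{q::rat. x \<le> real_of_rat q}. {..real_of_rat q})"
        proof (intro equalityI subsetI)
          fix y assume y: "y \<in> (\<Inter>q\<in>{q::rat. x \<le> real_of_rat q}. {..real_of_rat q})"
          show "y \<in> {..x}"
          proof (rule ccontr)
            assume "y \<notin> {..x}"
            then obtain q where "x < of_rat q" "of_rat q < y" using of_rat_dense[of x y] by auto
            then have "q \<in> {q. x \<le> real_of_rat q}" by simp
            from INT_D[OF y this] show False using \<open>of_rat q < y\<close> by simp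
          qed
        qed auto
        also have "\<dots> \<in> sets (sigma UNIV E)"
        proof (intro sets.countable_INT'')
          show "countable {q::rat. x \<le> real_of_rat q}" by simp
          show "{..real_of_rat q} \<in> sets (sigma UNIV E)" for q
            by (simp add: E_def sigma_sets.Basic)
        qed (simp add: sigma_sets_top)
        finally show ?thesis unfolding X .
      qed
    qed auto
    then have "sets lborel = sets (sigma UNIV E)" by (metis sets_lborel)
    also have "\<dots> = sigma_sets UNIV E" by (rule sets_measure_of) simp
    finally show ?thesis .
  qed
  have zero: "(LINT y:A|lborel. k y) = 0" if A: "A \<in> sets lborel" for A
  proof -
    have "E \<subseteq> Pow UNIV" and "A \<in> sigma_sets UNIV E" using A unfolding gen by auto
    with Int show ?thesis
    proof (induction rule: sigma_sets_induct_disjoint)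
      case (basic A) then show ?case using ray by (auto simp: E_def)
    next
      case empty then show ?case by (simp add: set_lebesgue_integral_def)
    next
      case (compl A)
      have Am: "A \<in> sets lborel" using compl.hyps unfolding gen by simp
      have "(LINT y:A \<union> (UNIV - A)|lborel. k y) = (LINT y:A|lborel. k y) + (LINT y:UNIV - A|lborel. k y)"
        using Am by (intro set_integral_Un ikA) auto
      then show ?case using compl total by (simp add: set_lebesgue_integral_def)
    next
      case (union A)
      have Am: "A i \<in> sets lborel" for i using union.hyps unfolding gen by auto
      have "(LINT y:(\<Union>i. A i)|lborel. k y) = (\<Sum>i. LINT y:A i|lborel. k y)"
        using union.hyps Am by (intro lebesgue_integral_countable_add ikA) (auto simp: disjoint_family_on_def)
      then show ?case using union by simp
    qed
  qed
  have "AE y in lborel. k y \<in> {0}"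
    by (rule sigma_finite_measure.averaging_theorem[OF sigma_finite_lborel ik]) (use zero in auto)
  then show ?thesis by eventually_elim (auto simp: k_def indicator_def)
qed

text \<open>
  The modulus of the first coordinate \<open>cis (- 2 * pi * \<tau>) * fourier_coeff 1 f\<close> of the joint
  law is the first Fourier coefficient, because that is positive; its argument encodes the shift
  \<open>\<tau>\<close>. Hence the joint law determines \<open>g\<close> and, as a function of
  \<open>\<tau>\<close>, the drift. At a single shift outside a null set the drifts of \<open>f\<close> and
  \<open>f'\<close> agree at all rational times.
\<close>

lemma shape_model_identifiable:
  assumes f: "f \<in> shape_class s" and f': "f' \<in> shape_class s'" and g: "g \<in> circle_probs" and g': "g' \<in> circle_probs"
    and eq: "shape_law f g = shape_law f' g'"
  shows "(AE t in circle. f t = f' t) \<and> g = g'"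
proof -
  have L2: "f \<in> circle_L2" "f' \<in> circle_L2" using f f' by (auto simp: shape_class_def)
  have [measurable]: "f \<in> borel_measurable borel" "f' \<in> borel_measurable borel" using L2 by (auto intro: measurable_circle_L2)
  interpret g: prob_space g by (rule circle_probsD[OF g])
  interpret g': prob_space g' by (rule circle_probsD[OF g'])
  let ?V = "\<lambda>f x \<tau>. (cis (- 2 * pi * \<tau>) * fourier_coeff 1 f, drift f \<tau> x)"
  have mV: "?V f x \<in> g \<rightarrow>\<^sub>M borel \<Otimes>\<^sub>M borel" "?V f' x \<in> g' \<rightarrow>\<^sub>M borel \<Otimes>\<^sub>M borel" for x
  proof -
    have "?V u x \<in> borel \<rightarrow>\<^sub>M borel \<Otimes>\<^sub>M borel" if [measurable]: "u \<in> borel_measurable borel" for u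
      by measurable
    then show "?V f x \<in> g \<rightarrow>\<^sub>M borel \<Otimes>\<^sub>M borel" "?V f' x \<in> g' \<rightarrow>\<^sub>M borel \<Otimes>\<^sub>M borel"
      by (auto intro: circle_probsD(4)[OF g] circle_probsD(4)[OF g'])
  qed
  have law: "distr g (borel \<Otimes>\<^sub>M borel) (?V f x) = distr g' (borel \<Otimes>\<^sub>M borel) (?V f' x)"
    if "0 \<le> x" "x \<le> 1" for x
    using joint_law_determined[OF L2 g g' eq that] by (simp only: borel_prod)
  define r where "r = Re (fourier_coeff 1 f)"
  have r: "fourier_coeff 1 f = of_real r" "r > 0" using f by (auto simp: r_def shape_class_def complex_is_Real_iff complex_eq_iff)
  have r': "fourier_coeff 1 f' = of_real (Re (fourier_coeff 1 f'))" "Re (fourier_coeff 1 f') > 0"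
    using f' by (auto simp: shape_class_def complex_is_Real_iff complex_eq_iff)
  have mfst: "(\<lambda>p. norm (fst p :: complex)) \<in> borel_measurable (borel \<Otimes>\<^sub>M (borel :: complex measure))" by measurable
  have "(LINT p|distr g (borel \<Otimes>\<^sub>M borel) (?V f 0). norm (fst p)) = (LINT p|distr g' (borel \<Otimes>\<^sub>M borel) (?V f' 0). norm (fst p))"
    using law[of 0] by simp
  then have "norm (fourier_coeff 1 f) = norm (fourier_coeff 1 f')"
    unfolding integral_distr[OF mV(1), of "\<lambda>p. norm (fst p)", OF mfst]
      integral_distr[OF mV(2), of "\<lambda>p. norm (fst p)", OF mfst]
    by (simp add: norm_mult g.prob_space g'.prob_space)
  then have "fourier_coeff 1 f' = of_real r"
    using r r' by (metis norm_of_real abs_of_pos)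
  note r' = this
  let ?\<kappa> = "\<lambda>z::complex. circle_angle (z / of_real r)"
  have [measurable]: "?\<kappa> \<in> borel_measurable borel" by measurable
  have r0: "r \<noteq> 0" using r by simp
  have ang: "circle_angle (cis (- (2 * pi * \<tau>))) = \<tau>" if "0 \<le> \<tau>" "\<tau> < 1" for \<tau>
    using circle_angle_cis[OF that] by simp
  have gg: "g = g'"
  proof (rule measure_eqI)
    show s: "sets g = sets g'" using circle_probsD(2)[OF g] circle_probsD(2)[OF g'] by simp
    fix A assume A: "A \<in> sets g"
    then have Ab: "A \<in> sets borel" and A01: "A \<subseteq> {0..<1}"
      using circle_probsD(2)[OF g] by (auto simp: sets_restrict_space)
    define B where "B = (\<lambda>p :: complex \<times> complex. ?\<kappa> (fst p)) -` A"
    have "(\<lambda>p :: complex \<times> complex. ?\<kappa> (fst p)) \<in> borel \<Otimes>\<^sub>M borel \<rightarrow>\<^sub>M borel" by measurable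
    from measurable_sets[OF this Ab] have Bm: "B \<in> sets (borel \<Otimes>\<^sub>M borel)"
      by (simp add: B_def space_pair_measure)
    have "emeasure h A = emeasure (distr h (borel \<Otimes>\<^sub>M borel) (?V u 0)) B"
      if h: "h \<in> circle_probs" and u: "fourier_coeff 1 u = of_real r" "?V u 0 \<in> h \<rightarrow>\<^sub>M borel \<Otimes>\<^sub>M borel" for h u
    proof -
      have "?V u 0 -` B \<inter> space h = A"
        using A01 by (auto simp: circle_probsD(3)[OF h] B_def u space_pair_measure ang r0)
      then show ?thesis using Bm u(2) by (simp add: emeasure_distr)
    qed
    from this[OF g r(1) mV(1)] this[OF g' r' mV(2)] law[of 0] show "emeasure g A = emeasure g' A" by simp
  qed
  have "AE \<tau> in g. drift f \<tau> x = drift f' \<tau> x" if x: "0 \<le> x" "x \<le> 1" for x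
  proof -
    let ?P = "\<lambda>p. snd p = drift f (?\<kappa> (fst p)) x"
    have [measurable]: "Measurable.pred (borel \<Otimes>\<^sub>M borel) ?P" by measurable
    have "AE \<tau> in g. ?P (?V f x \<tau>)"
      by (rule AE_I2) (simp add: r(1) circle_probsD(3)[OF g] ang r0)
    then have "AE p in distr g (borel \<Otimes>\<^sub>M borel) (?V f x). ?P p"
      using mV(1) by (subst AE_distr_iff) auto
    then have "AE p in distr g' (borel \<Otimes>\<^sub>M borel) (?V f' x). ?P p" by (simp only: law[OF x])
    then have "AE \<tau> in g'. ?P (?V f' x \<tau>)"
      using mV(2) by (subst (asm) AE_distr_iff) auto
    then have "AE \<tau> in g'. drift f \<tau> x = drift f' \<tau> x"
      using AE_space by eventually_elim (simp add: r' circle_probsD(3)[OF g'] ang r0)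
    then show ?thesis unfolding gg .
  qed
  then have "AE \<tau> in g. \<forall>x\<in>\<rat> \<inter> {0..1}. drift f \<tau> x = drift f' \<tau> x"
    by (subst AE_ball_countable) (auto simp: countable_rat)
  then obtain \<tau> where \<tau>: "\<And>x. x \<in> \<rat> \<Longrightarrow> 0 \<le> x \<Longrightarrow> x \<le> 1 \<Longrightarrow> drift f \<tau> x = drift f' \<tau> x"
    using eventually_happens'[of "ae_filter g"]
    by (fastforce simp: ae_filter_eq_bot_iff g.emeasure_space_1)
  define h where "h y = f (y - \<tau>) - f' (y - \<tau>)" for y
  have "AE y in lborel. y \<in> {0..1} \<longrightarrow> h y = 0"
  proof (rule AE_eq_0_from_rational_primitives)
    show "set_integrable lborel {0..1} h"
      unfolding h_def by (intro set_integral_diff set_integrable_shift L2)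
    show "(LINT y:{0..x}|lborel. h y) = 0" if "x \<in> \<rat>" "0 \<le> x" "x \<le> 1" for x
      using \<tau>[OF that] that unfolding h_def drift_def
      by (subst set_integral_diff) (auto intro!: set_integrable_shift_sub L2)
  qed
  let ?I = "\<lambda>t. indicator {t. f t \<noteq> f' t} t :: ennreal"
  have [measurable]: "{t. f t \<noteq> f' t} \<in> sets borel" by measurable
  have "(\<integral>\<^sup>+t. ?I t \<partial>circle) = (\<integral>\<^sup>+t. ?I (t + - \<tau>) \<partial>circle)"
    using L2 by (intro nn_integral_circle_shift[symmetric]) (auto simp: circle_L2_def indicator_def)
  also have "\<dots> = (\<integral>\<^sup>+t. ?I (t + - \<tau>) * indicator {0..<1} t \<partial>lborel)"
    by (rule nn_integral_circle) measurable
  also have "\<dots> = 0"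
  proof (subst nn_integral_0_iff_AE)
    show "AE t in lborel. ?I (t + - \<tau>) * indicator {0..<1} t = 0"
      using \<open>AE y in lborel. y \<in> {0..1} \<longrightarrow> h y = 0\<close>
      by eventually_elim (auto simp: h_def indicator_def)
  qed measurable
  finally have "AE t in circle. ?I t = 0"
    by (subst (asm) nn_integral_0_iff_AE) (auto intro: measurable_circle_borel)
  then have "AE t in circle. f t = f' t" by eventually_elim (auto simp: indicator_def split: if_splits)
  with gg show ?thesis by simp
qed

theorem theorem2p5:
  fixes s :: real
  assumes "s \<ge> 1"
  shows
    "(\<forall>f \<in> shape_class s. \<forall>g \<in> probs_star. \<forall>f' \<in> shape_class s. \<forall>g' \<in> probs_star.
        shape_law f g = shape_law f' g' \<longrightarrow> (AE t in circle. f t = f' t) \<and> g = g') \<and>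
     (\<forall>\<nu> A :: real. \<nu> > 1 \<and> A > 0 \<longrightarrow>
        (\<exists>c::real. c > 0 \<and>
           liminf (\<lambda>n. ennreal (ln (real n) powr (2 * s + 2)) * minimax_risk_shape n s \<nu> A) \<ge> ennreal c \<and>
           liminf (\<lambda>n. ennreal (ln (real n) powr (2 * \<nu> + 1)) * minimax_risk_prob n s \<nu> A) \<ge> ennreal c))"
proof (intro conjI allI impI ballI)
  fix f g f' g'
  assume "f \<in> shape_class s" "g \<in> probs_star" "f' \<in> shape_class s" "g' \<in> probs_star"
    and "shape_law f g = shape_law f' g'"
  then have "(AE t in circle. f t = f' t) \<and> g = g'"
    by (intro shape_model_identifiable) (auto simp: probs_star_def)
  then show "AE t in circle. f t = f' t" and "g = g'" by auto
next
  fix \<nu> A :: real assume \<nu>A: "\<nu> > 1 \<and> A > 0"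
  define c where "c = (min 1 A)\<^sup>2 / 16"
  have "(min 1 A)\<^sup>2 \<le> 1" using \<nu>A by (intro power_le_one) auto
  then have c: "c > 0" "c \<le> 1 / 4" using \<nu>A by (auto simp: c_def min_def)
  have "ennreal c \<le> minimax_risk_shape n s \<nu> A" for n
    using order_trans[OF ennreal_leI[OF c(2)] minimax_risk_shape_ge[of A n s \<nu>]] \<nu>A by simp
  moreover have "ennreal c \<le> minimax_risk_prob n s \<nu> A" for n
    using minimax_risk_prob_ge[of A n s \<nu>] \<nu>A by (simp add: c_def)
  ultimately show "\<exists>c::real. c > 0 \<and>
      liminf (\<lambda>n. ennreal (ln (real n) powr (2 * s + 2)) * minimax_risk_shape n s \<nu> A) \<ge> ennreal c \<and>
      liminf (\<lambda>n. ennreal (ln (real n) powr (2 * \<nu> + 1)) * minimax_risk_prob n s \<nu> A) \<ge> ennreal c"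
    using c \<nu>A assms by (intro exI[of _ c] conjI liminf_ln_powr_mult_ge) auto
qed

end
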